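(* Let $N\ge 1$ and $n\ge 1$ be integers and let $p_1,p_2,\dots$ be formal variables. As formal power series in $p_1,p_2,\dots$ (the exponential is expanded as a formal Taylor series in the variables $p_1,p_2,\dots$ and integrated coefficientwise), $$\int_{\Sigma_N^{\times n}} \exp\Big(N\sum_{m=1}^\infty \frac{p_m}{m}\,\mathrm{tr}\big((H_1\cdots H_n)^m\big)\Big)\prod_{i=1}^n d\mu(H_i)=\sum_{\lambda:\ \ell(\lambda)\le N} s_\lambda(I_N)\, s_\lambda(N\mathbf{p})\left(\frac{\langle s_\lambda(H)\rangle_{\Sigma}}{s_\lambda(I_N)}\right)^n,$$ where the sum is over all partitions $\lambda$ with at most $N$ parts, $N\mathbf{p}=(Np_1,Np_2,\dots)$, and $\langle s_\lambda(H)\rangle_{\Sigma}=\int_{\Sigma_N}s_\lambda(H)\,d\mu(H)$.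
   Context: $\Sigma_N$ is the space of $N\times N$ Hermitian matrices with the Gaussian probability measure $d\mu(H)=C_N e^{-\frac N2\mathrm{tr}(HH^\dagger)}\prod_{i=1}^N dH_{ii}\prod_{i<j}d^2H_{ij}$, where $d^2H_{ij}=d\,\mathrm{Re}H_{ij}\,d\,\mathrm{Im}H_{ij}$ and the constant $C_N$ is such that $\int_{\Sigma_N}d\mu(H)=1$. For a partition $\lambda$, $\ell(\lambda)$ is the number of its nonzero parts. $s_\lambda(\mathbf p)$ denotes the Schur function written as a polynomial in power sum variables $\mathbf p=(p_1,p_2,\dots)$: $s_\lambda(\mathbf p)=\sum_{|\mu|=|\lambda|}\frac{1}{z_\mu}\chi_\lambda(\mu)\mathbf p_\mu$, with $\mathbf p_\mu=p_{\mu_1}p_{\mu_2}\cdots$, $z_\mu=\prod_i m_i!\,i^{m_i}$ ($m_i$ the multiplicity of $i$ in $\mu$), and $\chi_\lambda$ the irreducible character of the symmetric group $S_{|\lambda|}$. For an $N\times N$ matrix $A$, $s_\lambda(A)$ is $s_\lambda(\mathbf p)$ evaluated at $p_m=\mathrm{tr}(A^m)$, i.e. the Schur polynomial in the eigenvalues of $A$. $I_N$ is the identity matrix. *)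

theory Defs
  imports
    "HOL-Probability.Probability"
    "HOL-Library.Function_Algebras"
    "HOL-Combinatorics.Combinatorics"
begin

section \<open>Formal power series in infinitely many variables\<close>

text \<open>The monomial \<open>p\<^sub>\<mu> = p\<^bsub>\<mu>\<^sub>1\<^esub> p\<^bsub>\<mu>\<^sub>2\<^esub> \<dots>\<close> is represented by the multiset of its
  indices; a formal power series is an arbitrary family of coefficients. The type also has a
  variable \<open>p\<^sub>0\<close>, which is not used below.\<close>

typedef 'a mps = "UNIV :: (nat multiset \<Rightarrow> 'a) set"
  morphisms coeff_mps Abs_mps ..

lemma coeff_Abs_mps [simp]: "coeff_mps (Abs_mps f) = f"
  by (simp add: Abs_mps_inverse)

lemma mps_eqI: "(\<And>M. coeff_mps f M = coeff_mps g M) \<Longrightarrow> f = g"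
  by (metis coeff_mps_inject ext)

lemma finite_mset_splits: "finite {(A, B). A + B = (M :: 'a multiset)}"
proof -
  let ?L = "mset ` {xs. set xs \<subseteq> set_mset M \<and> length xs \<le> size M}"
  have L: "A \<in> ?L" if "A \<subseteq># M" for A
  proof -
    obtain xs where xs: "A = mset xs" by (metis ex_mset)
    with that have "set xs \<subseteq> set_mset M" "length xs \<le> size M"
      using set_mset_mono[OF that] size_mset_mono[OF that] by auto
    with xs show ?thesis by blast
  qed
  have "{(A, B). A + B = M} \<subseteq> ?L \<times> ?L"
  proof
    fix P assume "P \<in> {(A, B). A + B = M}"
    then obtain A B where "P = (A, B)" "M = A + B" by auto
    then show "P \<in> ?L \<times> ?L" using L[of A] L[of B] by (simp del: image_iff)
  qed
  moreover have "finite ?L" by (simp add: finite_lists_length_le)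
  ultimately show ?thesis by (meson finite_SigmaI finite_subset)
qed

instantiation mps :: (comm_ring_1) comm_ring_1
begin

definition "0 = Abs_mps (\<lambda>M. 0)"
definition "1 = Abs_mps (\<lambda>M. if M = {#} then 1 else 0)"
definition "f + g = Abs_mps (\<lambda>M. coeff_mps f M + coeff_mps g M)"
definition "f - g = Abs_mps (\<lambda>M. coeff_mps f M - coeff_mps g M)"
definition "- f = Abs_mps (\<lambda>M. - coeff_mps f M)"
definition "f * g = Abs_mps (\<lambda>M. \<Sum>(A, B) | A + B = M. coeff_mps f A * coeff_mps g B)"

instance
proof
  fix f g h :: "'a mps"
  show "f * g * h = f * (g * h)"
  proof (rule mps_eqI)
    fix M
    let ?F = "\<lambda>N. {(A, B). A + B = (N :: nat multiset)}"
    have "coeff_mps (f * g * h) M =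
        (\<Sum>(P, (A, B)) \<in> (SIGMA P : ?F M. ?F (fst P)).
           coeff_mps f A * coeff_mps g B * coeff_mps h (snd P))"
      by (subst sum.Sigma [symmetric])
         (auto simp: times_mps_def finite_mset_splits sum_distrib_right case_prod_beta)
    also have "\<dots> =
        (\<Sum>(P, (A, B)) \<in> (SIGMA P : ?F M. ?F (snd P)).
           coeff_mps f (fst P) * (coeff_mps g A * coeff_mps h B))"
      by (rule sum.reindex_bij_witness
            [where i = "\<lambda>((A, S), (B, C)). ((A + B, C), (A, B))"
               and j = "\<lambda>((S, C), (A, B)). ((A, B + C), (B, C))"])
         (auto simp: ac_simps)
    also have "\<dots> = coeff_mps (f * (g * h)) M"
      by (subst sum.Sigma [symmetric])
         (auto simp: times_mps_def finite_mset_splits sum_distrib_left case_prod_beta)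
    finally show "coeff_mps (f * g * h) M = coeff_mps (f * (g * h)) M" .
  qed
  show "f * g = g * f"
  proof (rule mps_eqI)
    fix M
    show "coeff_mps (f * g) M = coeff_mps (g * f) M"
      unfolding times_mps_def coeff_Abs_mps
      by (rule sum.reindex_bij_witness
            [where i = "\<lambda>(A, B). (B, A)" and j = "\<lambda>(A, B). (B, A)"])
         (auto simp: ac_simps)
  qed
  show "1 * f = f"
  proof (rule mps_eqI)
    fix M
    have "coeff_mps (1 * f) M
        = (\<Sum>(A, B) | A + B = M. if (A, B) = ({#}, M) then coeff_mps f M else 0)"
      unfolding times_mps_def one_mps_def coeff_Abs_mps
      by (rule sum.cong) auto
    also have "\<dots> = (\<Sum>P\<in>{(A, B). A + B = M}. if P = ({#}, M) then coeff_mps f M else 0)"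
      by (rule sum.cong) (auto split: if_splits)
    also have "\<dots> = coeff_mps f M"
      by (subst sum.delta[OF finite_mset_splits]) simp
    finally show "coeff_mps (1 * f) M = coeff_mps f M" .
  qed
  show "(f + g) * h = f * h + g * h"
    by (rule mps_eqI)
       (simp add: times_mps_def plus_mps_def sum.distrib [symmetric] distrib_right case_prod_beta)
  have "coeff_mps (0 :: 'a mps) {#} \<noteq> coeff_mps 1 {#}"
    by (simp add: zero_mps_def one_mps_def)
  then show "(0 :: 'a mps) \<noteq> 1" by auto
qed (rule mps_eqI, simp add: plus_mps_def zero_mps_def minus_mps_def uminus_mps_def algebra_simps)+

end

definition mps_const :: "'a::zero \<Rightarrow> 'a mps" where
  "mps_const c = Abs_mps (\<lambda>M. if M = {#} then c else 0)"

definition mps_var :: "nat \<Rightarrow> 'a::zero_neq_one mps" where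
  "mps_var m = Abs_mps (\<lambda>M. if M = {#m#} then 1 else 0)"

text \<open>Formal infinite sum of a family in which each monomial occurs in only finitely many members
  (this is the case for all the sums used here).\<close>

definition mps_sum :: "('i \<Rightarrow> 'a::comm_monoid_add mps) \<Rightarrow> 'i set \<Rightarrow> 'a mps" where
  "mps_sum f I = Abs_mps (\<lambda>M. \<Sum>i | i \<in> I \<and> coeff_mps (f i) M \<noteq> 0. coeff_mps (f i) M)"

text \<open>Formal Taylor series of the exponential, for series without constant term.\<close>

definition mps_exp :: "complex mps \<Rightarrow> complex mps" where
  "mps_exp f = mps_sum (\<lambda>k. mps_const (1 / fact k) * f ^ k) UNIV"

definition mps_integral :: "'b measure \<Rightarrow> ('b \<Rightarrow> complex mps) \<Rightarrow> complex mps" where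
  "mps_integral M F = Abs_mps (\<lambda>m. \<integral>x. coeff_mps (F x) m \<partial>M)"


section \<open>Irreducible characters of the symmetric groups\<close>

definition partitions :: "nat list set" where
  "partitions = {la. sorted_wrt (\<ge>) la \<and> 0 \<notin> set la}"

definition partitions_of :: "nat \<Rightarrow> nat list set" where
  "partitions_of d = {la \<in> partitions. sum_list la = d}"

definition cycle_type :: "nat \<Rightarrow> (nat \<Rightarrow> nat) \<Rightarrow> nat multiset" where
  "cycle_type d g = image_mset card (mset_set (orbit g ` {..<d}))"

text \<open>The symmetric group on \<open>d\<close> letters consists of the permutations of \<open>{..<d}\<close>. The boxes of the
  Young diagram of a partition of \<open>d\<close> are filled with \<open>0, \<dots>, d - 1\<close> row by row; the next
  two functions give the row and the column of the box that contains \<open>m\<close>.\<close>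

definition row_index :: "nat list \<Rightarrow> nat \<Rightarrow> nat" where
  "row_index la m = (LEAST i. m < sum_list (take (Suc i) la))"

definition col_index :: "nat list \<Rightarrow> nat \<Rightarrow> nat" where
  "col_index la m = m - sum_list (take (row_index la m) la)"

definition row_group :: "nat list \<Rightarrow> (nat \<Rightarrow> nat) set" where
  "row_group la = {p. p permutes {..<sum_list la} \<and>
     (\<forall>m<sum_list la. row_index la (p m) = row_index la m)}"

definition col_group :: "nat list \<Rightarrow> (nat \<Rightarrow> nat) set" where
  "col_group la = {q. q permutes {..<sum_list la} \<and>
     (\<forall>m<sum_list la. col_index la (q m) = col_index la m)}"

text \<open>Elements of the complex group algebra are represented by their coefficient functions.\<close>

definition fun_scale :: "complex \<Rightarrow> ('a \<Rightarrow> complex) \<Rightarrow> 'a \<Rightarrow> complex" where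
  "fun_scale c f = (\<lambda>x. c * f x)"

interpretation cfun: vector_space fun_scale
  by unfold_locales (auto simp: fun_scale_def fun_eq_iff algebra_simps)

text \<open>Young symmetrizer: the product of \<open>\<Sum>p\<in>row_group la. p\<close> and
  \<open>\<Sum>q\<in>col_group la. sign q \<cdot> q\<close>.\<close>

definition young_symmetrizer :: "nat list \<Rightarrow> (nat \<Rightarrow> nat) \<Rightarrow> complex" where
  "young_symmetrizer la x =
     (\<Sum>p\<in>row_group la. \<Sum>q\<in>col_group la. if p \<circ> q = x then of_int (sign q) else 0)"

definition left_translate :: "(nat \<Rightarrow> nat) \<Rightarrow> ((nat \<Rightarrow> nat) \<Rightarrow> complex) \<Rightarrow> (nat \<Rightarrow> nat) \<Rightarrow> complex" where
  "left_translate g f = (\<lambda>x. f (inv g \<circ> x))"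

text \<open>The irreducible representation attached to a partition is the left ideal of the group algebra
  generated by its Young symmetrizer, with the group acting by left translation. One-row
  partitions give the trivial representation, one-column partitions the sign.\<close>

definition irrep :: "nat list \<Rightarrow> ((nat \<Rightarrow> nat) \<Rightarrow> complex) set" where
  "irrep la = cfun.span
     {left_translate g (young_symmetrizer la) | g. g permutes {..<sum_list la}}"

definition trace_on :: "('a \<Rightarrow> complex) set \<Rightarrow> (('a \<Rightarrow> complex) \<Rightarrow> 'a \<Rightarrow> complex) \<Rightarrow> complex" where
  "trace_on V T =
     (let B = (SOME B. B \<subseteq> V \<and> cfun.independent B \<and> cfun.span B = V)
      in \<Sum>b\<in>B. cfun.representation B (T b) b)"

text \<open>Value of the character of \<open>irrep la\<close> on the class of permutations of cycle type \<open>mu\<close>.\<close>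

definition sym_char :: "nat list \<Rightarrow> nat list \<Rightarrow> complex" where
  "sym_char la mu = trace_on (irrep la) (left_translate
     (SOME g. g permutes {..<sum_list la} \<and> cycle_type (sum_list la) g = mset mu))"


section \<open>Schur functions\<close>

definition z_part :: "nat list \<Rightarrow> nat" where
  "z_part mu = (\<Prod>i\<in>set mu. fact (count_list mu i) * i ^ count_list mu i)"

text \<open>The Schur function in the power sum variables, evaluated in an arbitrary commutative ring;
  \<open>emb\<close> embeds the complex scalars into that ring.\<close>

definition schur_gen :: "(complex \<Rightarrow> 'a::comm_ring_1) \<Rightarrow> nat list \<Rightarrow> (nat \<Rightarrow> 'a) \<Rightarrow> 'a" where
  "schur_gen emb la p =
     (\<Sum>mu\<in>partitions_of (sum_list la).
        emb (1 / of_nat (z_part mu) * sym_char la mu) * prod_list (map p mu))"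

type_synonym 'n cmat = "((complex, 'n) vec, 'n) vec"

definition mat_pow :: "'n::finite cmat \<Rightarrow> nat \<Rightarrow> 'n cmat" where
  "mat_pow A m = ((**) A ^^ m) (mat 1)"

definition schur_mat :: "nat list \<Rightarrow> 'n::finite cmat \<Rightarrow> complex" where
  "schur_mat la A = schur_gen id la (\<lambda>m. trace (mat_pow A m))"

definition schur_mps :: "nat list \<Rightarrow> (nat \<Rightarrow> complex mps) \<Rightarrow> complex mps" where
  "schur_mps la p = schur_gen mps_const la p"


section \<open>The Gaussian measure on Hermitian matrices\<close>

definition conj_transpose :: "complex^'n^'m \<Rightarrow> complex^'m^'n" where
  "conj_transpose A = map_matrix cnj (transpose A)"

text \<open>Real coordinates on the Hermitian matrices: \<open>x (i, i) = H\<^sub>i\<^sub>i\<close>, and for \<open>i < j\<close>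
  \<open>x (i, j) = Re H\<^sub>i\<^sub>j\<close> and \<open>x (j, i) = Im H\<^sub>i\<^sub>j\<close>.\<close>

definition herm_of :: "('n::{finite,linorder} \<times> 'n \<Rightarrow> real) \<Rightarrow> 'n::{finite,linorder} cmat" where
  "herm_of x = (\<chi> i j. if i = j then complex_of_real (x (i, i))
     else if i < j then Complex (x (i, j)) (x (j, i))
     else Complex (x (j, i)) (- x (i, j)))"

lemma bij_herm_of: "bij_betw herm_of UNIV {H. conj_transpose H = H}"
proof (rule bij_betwI')
  fix x y :: "'n::{finite,linorder} \<times> 'n \<Rightarrow> real"
  have "x (i, j) = y (i, j)" if "herm_of x = herm_of y" for i j
    using arg_cong[OF that, of "\<lambda>H. H $ i $ j"] arg_cong[OF that, of "\<lambda>H. H $ j $ i"]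
    by (auto simp: herm_of_def split: if_splits)
  then show "(herm_of x = herm_of y) = (x = y)" by auto
next
  fix x :: "'n::{finite,linorder} \<times> 'n \<Rightarrow> real"
  show "herm_of x \<in> {H. conj_transpose H = H}"
    by (auto simp: herm_of_def conj_transpose_def vec_eq_iff transpose_def complex_eq_iff)
next
  fix H :: "'n::{finite,linorder} cmat" assume "H \<in> {H. conj_transpose H = H}"
  then have H: "H $ j $ i = cnj (H $ i $ j)" for i j
    by (auto simp: conj_transpose_def vec_eq_iff transpose_def)
  let ?x = "\<lambda>(i, j). if i \<le> j then Re (H $ i $ j) else Im (H $ j $ i)"
  have "herm_of ?x $ i $ j = H $ i $ j" for i j
  proof -
    have sym: "Re (H $ j $ i) = Re (H $ i $ j)" "Im (H $ j $ i) = - Im (H $ i $ j)"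
      by (subst H, simp)+
    have diag: "Im (H $ k $ k) = 0" for k
      using arg_cong[OF H[of k k], of Im] by simp
    show ?thesis
    proof (rule linorder_cases[of i j])
      assume less: "i < j"
      then have "i \<le> j" "i \<noteq> j" "\<not> j \<le> i" by auto
      with less show ?thesis by (simp add: herm_of_def complex_eq_iff sym)
    next
      assume equal: "i = j"
      then show ?thesis by (simp add: herm_of_def complex_eq_iff diag)
    next
      assume greater: "j < i"
      then have "j \<le> i" "i \<noteq> j" "\<not> i \<le> j" "\<not> i < j" by auto
      with greater show ?thesis by (simp add: herm_of_def complex_eq_iff sym)
    qed
  qed
  then have "herm_of ?x = H" by (simp add: vec_eq_iff)
  then show "\<exists>x\<in>UNIV. H = herm_of x" by (intro bexI[of _ ?x]) simp_all
qed

definition herm_lebesgue :: "('n::{finite,linorder} cmat) measure" where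
  "herm_lebesgue = distr (Pi\<^sub>M UNIV (\<lambda>_. lborel)) borel herm_of"

definition gue_weight :: "'n::finite cmat \<Rightarrow> real" where
  "gue_weight H = exp (- (real CARD('n) / 2) * Re (trace (H ** conj_transpose H)))"

definition gue_const :: "'n::{finite,linorder} itself \<Rightarrow> real" where
  "gue_const _ = 1 / (\<integral>H. gue_weight (H :: 'n::{finite,linorder} cmat) \<partial>herm_lebesgue)"

text \<open>Since \<^const>\<open>herm_lebesgue\<close> is concentrated on the Hermitian matrices, so is
  this measure, although its underlying type is that of all complex matrices.\<close>

definition gue :: "('n::{finite,linorder} cmat) measure" where
  "gue = density herm_lebesgue (\<lambda>H. ennreal (gue_const TYPE('n) * gue_weight H))"

definition gue_schur :: "'n::{finite,linorder} itself \<Rightarrow> nat list \<Rightarrow> complex" where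
  "gue_schur _ la = (\<integral>H. schur_mat la (H :: 'n::{finite,linorder} cmat) \<partial>gue)"

definition ordered_prod :: "(nat \<Rightarrow> 'n::finite cmat) \<Rightarrow> nat \<Rightarrow> 'n cmat" where
  "ordered_prod H n = foldr (**) (map H [1..<Suc n]) (mat 1)"

end

theory Submission
  imports Defs
begin

text \<open>
  Both sides are compared coefficientwise. For \<open>g\<close> in the symmetric group \<open>S\<^sub>d\<close> let \<open>F\<^sub>n(g)\<close> be the
  expectation of the power sum product \<open>p\<^sub>\<mu>(H\<^sub>1 \<dots> H\<^sub>n)\<close>, where \<open>\<mu>\<close> is the cycle type of \<open>g\<close>. Since
  \<open>p\<^sub>\<mu>(A) = \<Sum>\<^sub>f \<Prod>\<^sub>k A(f k, f (g k))\<close>, Wick's formula for the last factor gives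
  \<open>F\<^bsub>n+1\<^esub>(g) = \<Sum>\<^sub>z w(z) F\<^sub>n(g z)\<close>, where \<open>w\<close> is \<open>N\<^bsup>-d/2\<^esup>\<close> on fixed point free involutions and \<open>0\<close>
  elsewhere. As \<open>w\<close> is a class function, convolution with it multiplies the Young symmetrizer of
  \<open>\<lambda>\<close> by a scalar \<open>\<omega>\<^sub>\<lambda>\<close>, so that the pairing of \<open>\<chi>\<^sub>\<lambda>\<close> with \<open>F\<^sub>n\<close> is \<open>\<omega>\<^sub>\<lambda>\<^sup>n s\<^sub>\<lambda>(I\<^sub>N)\<close>; the case \<open>n = 1\<close>
  identifies \<open>\<omega>\<^sub>\<lambda>\<close> with \<open>\<langle>s\<^sub>\<lambda>(H)\<rangle> / s\<^sub>\<lambda>(I\<^sub>N)\<close>. Expanding \<open>F\<^sub>n\<close> in the irreducible characters, which are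
  orthonormal and as numerous as the conjugacy classes, gives the claim.
\<close>

section \<open>The group algebra of the symmetric group\<close>

text \<open>The modules are given as left ideals, with a trace taken over an arbitrarily chosen
  basis; their irreducibility is not built into the definition. All that is used about them flows
  from one fact, \<open>young_unique\<close>: up to a factor, the Young symmetrizer \<open>c\<close>
  is the only function that is left invariant under the row group and right alternating under the
  column group. It yields \<open>c c = k c\<close>, the scalar action of class functions and the
  norm of a character, while its vanishing variant for two different shapes yields orthogonality. On
  the ideal, \<open>v = v c / k\<close> is a reproducing formula, which makes the trace an explicit
  sum. Against a class function the character may then be replaced by \<open>c\<close> itself, and
  that is the form in which moments are paired with characters. The expansion of a moment runs over
  all partitions of \<open>d\<close>. The bound on the number of parts enters because s_la(I_N) is a
  sum over colourings of the boxes by \<open>N\<close> colours, and a first column longer than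
  \<open>N\<close> must repeat a colour.\<close>

definition Sy :: "nat \<Rightarrow> (nat \<Rightarrow> nat) set" where
  "Sy d = {g. g permutes {..<d}}"

lemma finite_Sy [simp]: "finite (Sy d)"
  by (simp add: Sy_def finite_permutations)

lemma card_Sy: "card (Sy d) = fact d"
  by (simp add: Sy_def card_permutations)

lemma Sy_id [simp]: "id \<in> Sy d" "(\<lambda>x. x) \<in> Sy d"
  using permutes_id[of "{..<d}"] by (simp_all add: Sy_def id_def)

lemma Sy_comp [simp]: "g \<in> Sy d \<Longrightarrow> h \<in> Sy d \<Longrightarrow> g \<circ> h \<in> Sy d"
  by (simp add: Sy_def permutes_compose)

lemma Sy_inv [simp]: "g \<in> Sy d \<Longrightarrow> inv g \<in> Sy d"
  by (simp add: Sy_def permutes_inv)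

lemma Sy_bij: "g \<in> Sy d \<Longrightarrow> bij g"
  by (auto simp: Sy_def permutes_bij)

lemma Sy_cancel [simp]:
  assumes "g \<in> Sy d"
  shows "inv g \<circ> g = id" "g \<circ> inv g = id" "inv (inv g) = g"
    "inv g \<circ> (g \<circ> h) = h" "g \<circ> (inv g \<circ> h) = h"
  using Sy_bij[OF assms]
  by (auto simp: bij_is_inj bij_is_surj inv_inv_eq surj_f_inv_f fun_eq_iff bij_inv_eq_iff)

lemma Sy_inv_comp [simp]: "g \<in> Sy d \<Longrightarrow> h \<in> Sy d \<Longrightarrow> inv (g \<circ> h) = inv h \<circ> inv g"
  by (auto simp: o_inv_distrib Sy_bij)

lemma Sy_lt_iff [simp]: "g \<in> Sy d \<Longrightarrow> g x < d \<longleftrightarrow> x < d"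
  using permutes_in_image[of g "{..<d}" x] by (simp add: Sy_def)

lemma sum_Sy_inv: "(\<Sum>y\<in>Sy d. f (inv y)) = (\<Sum>y\<in>Sy d. f y)"
  by (rule sum.reindex_bij_witness[where i = inv and j = inv]) auto

lemma sum_Sy_left: "g \<in> Sy d \<Longrightarrow> (\<Sum>y\<in>Sy d. f (g \<circ> y)) = (\<Sum>y\<in>Sy d. f y)"
  by (rule sum.reindex_bij_witness[where i = "\<lambda>y. inv g \<circ> y" and j = "\<lambda>y. g \<circ> y"]) auto

lemma sum_Sy_right: "g \<in> Sy d \<Longrightarrow> (\<Sum>y\<in>Sy d. f (y \<circ> g)) = (\<Sum>y\<in>Sy d. f y)"
  by (rule sum.reindex_bij_witness[where i = "\<lambda>y. y \<circ> inv g" and j = "\<lambda>y. y \<circ> g"])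
     (auto simp: comp_assoc)

section \<open>Convolution in the group algebra and its identity coefficient\<close>

definition supp :: "nat \<Rightarrow> ((nat \<Rightarrow> nat) \<Rightarrow> complex) \<Rightarrow> bool" where
  "supp d f \<longleftrightarrow> (\<forall>x. x \<notin> Sy d \<longrightarrow> f x = 0)"

definition conv :: "nat \<Rightarrow> ((nat \<Rightarrow> nat) \<Rightarrow> complex) \<Rightarrow> ((nat \<Rightarrow> nat) \<Rightarrow> complex) \<Rightarrow> (nat \<Rightarrow> nat) \<Rightarrow> complex" where
  "conv d f g x = (if x \<in> Sy d then \<Sum>y\<in>Sy d. f y * g (inv y \<circ> x) else 0)"

definition unit_vec :: "(nat \<Rightarrow> nat) \<Rightarrow> (nat \<Rightarrow> nat) \<Rightarrow> complex" where
  "unit_vec u x = (if x = u then 1 else 0)"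

lemma supp_conv [simp]: "supp d (conv d f g)"
  by (simp add: supp_def conv_def)

lemma supp_eqI:
  "supp d f \<Longrightarrow> supp d g \<Longrightarrow> (\<And>x. x \<in> Sy d \<Longrightarrow> f x = g x) \<Longrightarrow> f = g"
  unfolding supp_def by (metis ext)

text \<open>Replaces \<open>y\<close> by \<open>x \<circ> inv y\<close>. The definition shows how
  right multiplication acts on the second factor, this form how left multiplication acts on the
  first; the invariance lemmas need one or the other.\<close>

lemma conv_altdef:
  assumes "x \<in> Sy d" shows "conv d f g x = (\<Sum>y\<in>Sy d. f (x \<circ> inv y) * g y)"
proof -
  have "conv d f g x = (\<Sum>y\<in>Sy d. f (x \<circ> y) * g (inv (x \<circ> y) \<circ> x))"
    using sum_Sy_left[OF assms, of "\<lambda>y. f y * g (inv y \<circ> x)"] assms by (simp add: conv_def)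
  also have "\<dots> = (\<Sum>y\<in>Sy d. f (x \<circ> y) * g (inv y))"
    by (rule sum.cong) (use assms in \<open>auto simp: comp_assoc\<close>)
  also have "\<dots> = (\<Sum>y\<in>Sy d. f (x \<circ> inv y) * g y)"
    using sum_Sy_inv[of "\<lambda>y. f (x \<circ> inv y) * g y"] by (simp cong: sum.cong)
  finally show ?thesis .
qed

lemma conv_assoc: "conv d (conv d f g) h = conv d f (conv d g h)"
proof (rule supp_eqI[of d])
  fix x assume x: "x \<in> Sy d"
  have "conv d (conv d f g) h x = (\<Sum>z\<in>Sy d. (\<Sum>y\<in>Sy d. f y * g (inv y \<circ> (x \<circ> inv z))) * h z)"
    using x by (simp add: conv_altdef[of _ _ _ h]) (simp add: conv_def cong: sum.cong)
  also have "\<dots> = (\<Sum>y\<in>Sy d. \<Sum>z\<in>Sy d. f y * (g (inv y \<circ> x \<circ> inv z) * h z))"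
    by (simp add: sum_distrib_right comp_assoc mult.assoc) (rule sum.swap)
  also have "\<dots> = conv d f (conv d g h) x"
    using x by (simp add: conv_def[of d f]) (simp add: conv_altdef sum_distrib_left comp_assoc cong: sum.cong)
  finally show "conv d (conv d f g) h x = conv d f (conv d g h) x" .
qed auto

lemma conv_unit_left: "u \<in> Sy d \<Longrightarrow> x \<in> Sy d \<Longrightarrow> conv d (unit_vec u) f x = f (inv u \<circ> x)"
  by (simp add: conv_def unit_vec_def if_distrib[of "\<lambda>t. t * _"] cong: if_cong)

lemma conv_unit_right:
  assumes "u \<in> Sy d" "x \<in> Sy d" shows "conv d f (unit_vec u) x = f (x \<circ> inv u)"
  using assms by (simp add: conv_altdef unit_vec_def if_distrib[of "\<lambda>t. _ * t"] cong: if_cong)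

lemma conv_add_left: "conv d (\<lambda>x. f x + g x) h = (\<lambda>x. conv d f h x + conv d g h x)"
  by (auto simp: conv_def fun_eq_iff sum.distrib algebra_simps)

lemma conv_scale_left: "conv d (\<lambda>x. c * f x) h = (\<lambda>x. c * conv d f h x)"
  by (auto simp: conv_def fun_eq_iff sum_distrib_left algebra_simps)

lemma conv_scale_right: "conv d h (\<lambda>x. c * f x) = (\<lambda>x. c * conv d h f x)"
  by (auto simp: conv_def fun_eq_iff sum_distrib_left algebra_simps)

lemma conv_at_id: "conv d f g id = (\<Sum>y\<in>Sy d. f y * g (inv y))"
  by (simp add: conv_def)

text \<open>The identity coefficient is, up to a factor, the trace of the regular representation.
  Its symmetry lets scalars be computed by moving factors cyclically.\<close>

lemma conv_at_id_commute: "conv d f g id = conv d g f id"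
proof -
  have "(\<Sum>y\<in>Sy d. f y * g (inv y)) = (\<Sum>y\<in>Sy d. f (inv y) * g y)"
    using sum_Sy_inv[of "\<lambda>y. f (inv y) * g y" d] by (simp cong: sum.cong)
  then show ?thesis by (simp add: conv_at_id mult.commute)
qed

section \<open>Young diagrams\<close>

text \<open>A set of n + 1 numbers lies in \<open>{..Max A}\<close>, so its maximum is at least n.
  The remaining elements are left to the induction, and equality of the sums forces equality in both
  places.\<close>

lemma sum_ge_sum_lessThan_card:
  fixes A :: "nat set"
  assumes "finite A"
  shows "\<Sum>{..<card A} \<le> \<Sum>A \<and> (\<Sum>A = \<Sum>{..<card A} \<longrightarrow> A = {..<card A})"
  using assms
proof (induction "card A" arbitrary: A)
  case 0
  then show ?case by simp
next
  case (Suc n)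
  let ?M = "Max A" and ?B = "A - {Max A}"
  from Suc have ne: "A \<noteq> {}" by auto
  with Suc have M: "?M \<in> A" by (simp add: Max_in)
  have cB: "card ?B = n" using Suc M by simp
  have IH: "\<Sum>{..<n} \<le> \<Sum>?B \<and> (\<Sum>?B = \<Sum>{..<n} \<longrightarrow> ?B = {..<n})"
    using Suc.hyps(1)[of ?B] cB Suc.prems by auto
  have "A \<subseteq> {..?M}" using Suc.prems by auto
  then have "card A \<le> Suc ?M" using card_mono[of "{..?M}" A] by simp
  then have Mn: "n \<le> ?M" using Suc by simp
  have sA: "\<Sum>A = ?M + \<Sum>?B" using sum.remove[OF Suc.prems M] by simp
  have "A = insert ?M ?B" using M by auto
  moreover have "{..<Suc n} = insert n {..<n}" by auto
  ultimately have "A = {..<Suc n}" if eq: "\<Sum>A = \<Sum>{..<Suc n}"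
  proof -
    have "?M + \<Sum>?B = n + \<Sum>{..<n}" using eq sA by simp
    then have "?M = n" "?B = {..<n}" using IH Mn by auto
    then show ?thesis using \<open>A = insert ?M ?B\<close> \<open>{..<Suc n} = insert n {..<n}\<close> by metis
  qed
  moreover have "\<Sum>{..<Suc n} \<le> \<Sum>A" using sA IH Mn by simp
  ultimately show ?case unfolding Suc(2)[symmetric] by blast
qed

text \<open>Here \<open>r\<close> gives rows and \<open>c\<close> the true column numbers, which
  fill an initial segment in every row. Any other numbering that is injective on rows has at least
  the same total in each row, and equality pins down the set of cells. Comparing these totals takes
  the place of the dominance order on shapes.\<close>

lemma column_sum_le:
  fixes r c c' :: "'a \<Rightarrow> nat"
  assumes fin: "finite D" and inj: "inj_on (\<lambda>m. (r m, c' m)) D" and injc: "inj_on (\<lambda>m. (r m, c m)) D"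
    and init: "\<And>i. c ` {m \<in> D. r m = i} = {..<card {m \<in> D. r m = i}}"
  shows "sum c D \<le> sum c' D"
    and "sum c D = sum c' D \<Longrightarrow> (\<lambda>m. (r m, c' m)) ` D = (\<lambda>m. (r m, c m)) ` D"
proof -
  define R where "R i = {m \<in> D. r m = i}" for i
  have injR: "inj_on c (R i)" "inj_on c' (R i)" for i
    using inj injc by (auto simp: R_def inj_on_def)
  have finR: "finite (R i)" for i using fin by (simp add: R_def)
  have grp: "sum f D = (\<Sum>i\<in>r ` D. \<Sum>(f ` R i))" if "\<And>i. inj_on f (R i)" for f :: "'a \<Rightarrow> nat"
    using sum.image_gen[OF fin, of f r] that by (simp add: R_def sum.reindex)
  have cR: "c ` R i = {..<card (R i)}" for i using init by (simp add: R_def)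
  have cc: "card (c' ` R i) = card (R i)" for i using injR card_image by blast
  have le: "\<Sum>(c ` R i) \<le> \<Sum>(c' ` R i)" for i
    using sum_ge_sum_lessThan_card[of "c' ` R i"] finR cc cR by simp
  have Sig: "(\<lambda>m. (r m, f m)) ` D = (SIGMA i:r ` D. f ` R i)" for f :: "'a \<Rightarrow> nat"
    by (auto simp: R_def) (metis (no_types, lifting) image_eqI)
  show "sum c D \<le> sum c' D"
    unfolding grp[OF injR(1)] grp[OF injR(2)] using le by (intro sum_mono) auto
  assume "sum c D = sum c' D"
  then have "\<Sum>(c ` R i) = \<Sum>(c' ` R i)" if "i \<in> r ` D" for i
    unfolding grp[OF injR(1)] grp[OF injR(2)] using le that fin
    using sum_mono_inv[of "\<lambda>i. \<Sum>(c ` R i)" "r ` D" "\<lambda>i. \<Sum>(c' ` R i)"] by blast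
  then have "c' ` R i = c ` R i" if "i \<in> r ` D" for i
    using sum_ge_sum_lessThan_card[of "c' ` R i"] finR cc cR that by simp
  then show "(\<lambda>m. (r m, c' m)) ` D = (\<lambda>m. (r m, c m)) ` D"
    using Sig[of c] Sig[of c'] by (metis (mono_tags, lifting) Sigma_cong)
qed

lemma row_index_eqI:
  assumes "i < length la" "j < la ! i"
  shows "row_index la (sum_list (take i la) + j) = i"
  unfolding row_index_def
proof (rule Least_equality)
  show "sum_list (take i la) + j < sum_list (take (Suc i) la)"
    using assms by (simp add: take_Suc_conv_app_nth)
next
  fix y assume y: "sum_list (take i la) + j < sum_list (take (Suc y) la)"
  show "i \<le> y"
  proof (rule ccontr)
    assume "\<not> i \<le> y"
    then have "take i la = take (Suc y) la @ take (i - Suc y) (drop (Suc y) la)"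
      by (metis le_add_diff_inverse not_less_eq_eq take_add)
    then show False using y by simp
  qed
qed

lemma box_of:
  assumes "m < sum_list la"
  shows "row_index la m < length la" "col_index la m < la ! row_index la m"
    "m = sum_list (take (row_index la m) la) + col_index la m"
proof -
  let ?P = "\<lambda>i. m < sum_list (take (Suc i) la)"
  have ex: "?P (length la)" using assms by simp
  have P: "m < sum_list (take (Suc (row_index la m)) la)"
    unfolding row_index_def by (rule LeastI[of ?P, OF ex])
  have ge: "sum_list (take (row_index la m) la) \<le> m"
  proof (cases "row_index la m")
    case (Suc i)
    then have "\<not> ?P i" using not_less_Least[of i ?P] by (simp add: row_index_def)
    then show ?thesis using Suc by simp
  qed simp
  have "\<not> length la \<le> row_index la m"
    using P ge by (auto simp: not_less)
  then show l: "row_index la m < length la" by simp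
  show "m = sum_list (take (row_index la m) la) + col_index la m"
    using ge by (simp add: col_index_def)
  show "col_index la m < la ! row_index la m"
    using P l ge by (simp add: col_index_def take_Suc_conv_app_nth)
qed

lemma box_lt:
  fixes la :: "nat list"
  assumes "i < length la" "j < la ! i"
  shows "sum_list (take i la) + j < sum_list la"
proof -
  have "sum_list la = sum_list (take (Suc i) la) + sum_list (drop (Suc i) la)"
    by (metis append_take_drop_id sum_list_append)
  moreover have "sum_list (take (Suc i) la) = sum_list (take i la) + la ! i"
    using assms by (simp add: take_Suc_conv_app_nth)
  ultimately show ?thesis using assms(2) by linarith
qed

lemma box_bij:
  "bij_betw (\<lambda>m. (row_index la m, col_index la m)) {..<sum_list la} (SIGMA i:{..<length la}. {..<la ! i})"
proof (rule bij_betwI[where g = "\<lambda>(i, j). sum_list (take i la) + j"])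
  show "(\<lambda>m. (row_index la m, col_index la m)) \<in> {..<sum_list la} \<rightarrow> (SIGMA i:{..<length la}. {..<la ! i})"
    using box_of by auto
  show "(\<lambda>(i, j). sum_list (take i la) + j) \<in> (SIGMA i:{..<length la}. {..<la ! i}) \<rightarrow> {..<sum_list la}"
    using box_lt by auto
next
  fix m assume "m \<in> {..<sum_list la}"
  then show "(case (row_index la m, col_index la m) of (i, j) \<Rightarrow> sum_list (take i la) + j) = m"
    using box_of(3)[of m la] by auto
next
  fix y assume "y \<in> (SIGMA i:{..<length la}. {..<la ! i})"
  then show "(row_index la (case y of (i, j) \<Rightarrow> sum_list (take i la) + j),
          col_index la (case y of (i, j) \<Rightarrow> sum_list (take i la) + j)) = y"
    by (auto simp: row_index_eqI col_index_def)
qed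

lemma box_inj: "m < sum_list la \<Longrightarrow> m' < sum_list la \<Longrightarrow> row_index la m = row_index la m' \<Longrightarrow>
    col_index la m = col_index la m' \<Longrightarrow> m = m'"
  using box_of(3)[of m la] box_of(3)[of m' la] by simp

lemma row_cells:
  "col_index la ` {m \<in> {..<sum_list la}. row_index la m = i} =
     {..<card {m \<in> {..<sum_list la}. row_index la m = i}}"
proof (cases "i < length la")
  case True
  have im: "col_index la ` {m \<in> {..<sum_list la}. row_index la m = i} = {..<la ! i}"
  proof (intro set_eqI iffI)
    fix j assume "j \<in> {..<la ! i}"
    then show "j \<in> col_index la ` {m \<in> {..<sum_list la}. row_index la m = i}"
      using True box_lt[OF True] row_index_eqI[OF True]
      by (intro image_eqI[where x = "sum_list (take i la) + j"]) (auto simp: col_index_def)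
  qed (use box_of in auto)
  have "inj_on (col_index la) {m \<in> {..<sum_list la}. row_index la m = i}"
    using box_inj by (auto simp: inj_on_def)
  from card_image[OF this] have "card {m \<in> {..<sum_list la}. row_index la m = i} = la ! i"
    unfolding im by simp
  with im show ?thesis by simp
next
  case False
  then have "{m \<in> {..<sum_list la}. row_index la m = i} = {}" using box_of(1) by auto
  then show ?thesis by (simp only: card.empty image_empty lessThan_0)
qed

lemma card_column:
  "card {m \<in> {..<sum_list la}. col_index la m = j} = size (filter_mset (\<lambda>x. j < x) (mset la))"
proof -
  have "bij_betw (\<lambda>m. row_index la m) {m \<in> {..<sum_list la}. col_index la m = j} {i. i < length la \<and> j < la ! i}"
  proof (rule bij_betwI[where g = "\<lambda>i. sum_list (take i la) + j"], goal_cases)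
    case 1 then show ?case using box_of by auto
  next
    case 2 then show ?case using box_lt by (auto simp: col_index_def row_index_eqI)
  next
    case (3 m) then show ?case using box_of(3)[of m la] by simp
  next
    case (4 i) then show ?case by (simp add: row_index_eqI)
  qed
  then have "card {m \<in> {..<sum_list la}. col_index la m = j} = card {i. i < length la \<and> j < la ! i}"
    by (rule bij_betw_same_card)
  also have "\<dots> = length (filter (\<lambda>x. j < x) la)" by (simp add: length_filter_conv_card)
  finally show ?thesis by (metis mset_filter size_mset)
qed

lemma partitions_mset_inj:
  assumes "la \<in> partitions" "mu \<in> partitions" "mset la = mset mu" shows "la = mu"
proof -
  have "sorted (rev xs)" if "xs \<in> partitions" for xs
    using that by (simp add: partitions_def sorted_wrt_rev)
  then have "rev la = rev mu"
    using assms properties_for_sort[of "rev la" "rev la"] properties_for_sort[of "rev mu" "rev la"] by (metis mset_rev)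
  then show ?thesis by simp
qed

text \<open>Column \<open>j\<close> has as many boxes as there are parts exceeding \<open>j\<close>,
  so differences of consecutive column lengths are the multiplicities of the positive parts; 0 is
  not a part.\<close>

lemma partition_eqI:
  assumes "la \<in> partitions" "mu \<in> partitions"
    and eq: "\<And>j. card {m \<in> {..<sum_list la}. col_index la m = j} = card {m \<in> {..<sum_list mu}. col_index mu m = j}"
  shows "la = mu"
proof (rule partitions_mset_inj[OF assms(1,2)], rule multiset_eqI)
  fix x
  have gr: "size (filter_mset (\<lambda>y. j < y) (mset la)) = size (filter_mset (\<lambda>y. j < y) (mset mu))" for j
    using eq[of j] unfolding card_column .
  have cnt: "count M (Suc j) + size (filter_mset (\<lambda>y. Suc j < y) M) = size (filter_mset (\<lambda>y. j < y) M)"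
    for M :: "nat multiset" and j
    by (induction M) auto
  show "count (mset la) x = count (mset mu) x"
  proof (cases x)
    case 0
    then have "x \<notin># mset la" "x \<notin># mset mu" using assms(1,2) by (auto simp: partitions_def)
    then show ?thesis by (simp only: not_in_iff)
  next
    case (Suc j)
    then show ?thesis using cnt[of "mset la" j] cnt[of "mset mu" j] gr[of j] gr[of "Suc j"] by simp
  qed
qed

text \<open>Young's condition on two tableaux: in the filling of \<open>mu\<close> relabelled by
  \<open>g\<close>, the letter \<open>m\<close> sits in the box of \<open>inv g m\<close>, and some
  two letters share a row of \<open>la\<close> and a column of that relabelled filling.\<close>

definition separated :: "nat list \<Rightarrow> nat list \<Rightarrow> (nat \<Rightarrow> nat) \<Rightarrow> bool" where
  "separated la mu g \<longleftrightarrow> (\<exists>a b. a < sum_list la \<and> b < sum_list la \<and> a \<noteq> b \<and>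
     row_index la a = row_index la b \<and> col_index mu (inv g a) = col_index mu (inv g b))"

text \<open>In the absence of such a pair, \<open>col_index mu (inv g m)\<close> numbers the letters
  injectively on each row of \<open>la\<close>, so \<open>column_sum_le\<close> applies. Its total
  is the column sum of \<open>mu\<close>, as \<open>g\<close> only permutes the letters.\<close>

lemma not_separated:
  assumes s: "sum_list mu = sum_list la" and g: "g \<in> Sy (sum_list la)" and ns: "\<not> separated la mu g"
  shows "sum (col_index la) {..<sum_list la} \<le> sum (col_index mu) {..<sum_list la}"
    "sum (col_index la) {..<sum_list la} = sum (col_index mu) {..<sum_list la} \<Longrightarrow>
      (\<lambda>m. (row_index la m, col_index mu (inv g m))) ` {..<sum_list la}
        = (\<lambda>m. (row_index la m, col_index la m)) ` {..<sum_list la}"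
    "inj_on (\<lambda>m. (row_index la m, col_index mu (inv g m))) {..<sum_list la}"
proof -
  let ?D = "{..<sum_list la}"
  show inj: "inj_on (\<lambda>m. (row_index la m, col_index mu (inv g m))) ?D"
    using ns by (auto simp: separated_def inj_on_def)
  have inj2: "inj_on (\<lambda>m. (row_index la m, col_index la m)) ?D"
    using box_bij bij_betw_def by blast
  have "inv g permutes ?D" using g by (simp add: Sy_def permutes_inv)
  then have e: "(\<Sum>m\<in>?D. col_index mu (inv g m)) = sum (col_index mu) ?D"
    using sum.permute[of "inv g" ?D "col_index mu"] by (simp add: o_def)
  show "sum (col_index la) ?D \<le> sum (col_index mu) ?D"
    using column_sum_le(1)[OF _ inj inj2 row_cells] e by simp
  show "sum (col_index la) ?D = sum (col_index mu) ?D \<Longrightarrow>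
      (\<lambda>m. (row_index la m, col_index mu (inv g m))) ` ?D = (\<lambda>m. (row_index la m, col_index la m)) ` ?D"
    using column_sum_le(2)[OF _ inj inj2 row_cells] e by simp
qed

text \<open>One unseparated element in each direction would make the column sums of the two shapes
  equal. The equality case of the comparison then identifies the cells, so the column lengths agree
  and the shapes coincide.\<close>

lemma separated_or_separated:
  assumes la: "la \<in> partitions" and mu: "mu \<in> partitions" and s: "sum_list mu = sum_list la" and ne: "la \<noteq> mu"
  shows "(\<forall>g\<in>Sy (sum_list la). separated la mu g) \<or> (\<forall>g\<in>Sy (sum_list la). separated mu la g)"
proof (rule ccontr)
  let ?D = "{..<sum_list la}"
  assume "\<not> ?thesis"
  then obtain g h where g: "g \<in> Sy (sum_list la)" "\<not> separated la mu g"
    and h: "h \<in> Sy (sum_list la)" "\<not> separated mu la h" by blast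
  have eq: "sum (col_index la) ?D = sum (col_index mu) ?D"
    using not_separated(1)[OF s g] not_separated(1)[OF s[symmetric] _ h(2)] h(1) s by simp
  have im: "(\<lambda>m. (row_index la m, col_index mu (inv g m))) ` ?D = (\<lambda>m. (row_index la m, col_index la m)) ` ?D"
    using not_separated(2)[OF s g] eq by simp
  have inj: "inj_on (\<lambda>m. (row_index la m, col_index mu (inv g m))) ?D"
    by (rule not_separated(3)[OF s g])
  have inj2: "inj_on (\<lambda>m. (row_index la m, col_index la m)) ?D"
    using box_bij bij_betw_def by blast
  have "la = mu"
  proof (rule partition_eqI[OF la mu])
    fix j
    \<comment> \<open>A column length can be read off from the set of cells alone, as long as
      distinct letters occupy distinct cells.\<close>
    have *: "card {m \<in> ?D. f m = j} = card {y \<in> (\<lambda>m. (r m, f m)) ` ?D. snd y = j}"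
      if "inj_on (\<lambda>m. (r m, f m)) ?D" for r f :: "nat \<Rightarrow> nat"
    proof -
      have "{y \<in> (\<lambda>m. (r m, f m)) ` ?D. snd y = j} = (\<lambda>m. (r m, f m)) ` {m \<in> ?D. f m = j}" by auto
      then show ?thesis using that by (metis (no_types, lifting) card_image inj_on_subset mem_Collect_eq subsetI)
    qed
    have "card {m \<in> ?D. col_index la m = j} = card {m \<in> ?D. col_index mu (inv g m) = j}"
      using *[OF inj] *[OF inj2] im by simp
    also have "\<dots> = card {m \<in> ?D. col_index mu m = j}"
      by (rule bij_betw_same_card[of "inv g"], rule bij_betwI[where g = g])
         (use g Sy_bij[OF g(1)] Sy_bij[OF Sy_inv[OF g(1)]] in \<open>auto simp: bij_is_surj bij_is_inj surj_f_inv_f\<close>)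
    finally show "card {m \<in> ?D. col_index la m = j} = card {m \<in> {..<sum_list mu}. col_index mu m = j}"
      using s by simp
  qed
  with ne show False by simp
qed

section \<open>Young symmetrizers\<close>

lemma row_group_Sy: "p \<in> row_group la \<Longrightarrow> p \<in> Sy (sum_list la)"
  and col_group_Sy: "q \<in> col_group la \<Longrightarrow> q \<in> Sy (sum_list la)"
  by (auto simp: row_group_def col_group_def Sy_def)

lemma finite_row_group [simp]: "finite (row_group la)" and finite_col_group [simp]: "finite (col_group la)"
  using finite_subset[OF _ finite_Sy] row_group_Sy col_group_Sy by (metis subsetI)+

lemma row_group_simps [simp]:
  "id \<in> row_group la"
  "p \<in> row_group la \<Longrightarrow> p' \<in> row_group la \<Longrightarrow> p \<circ> p' \<in> row_group la"
  "p \<in> row_group la \<Longrightarrow> inv p \<in> row_group la"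
proof -
  show "id \<in> row_group la" using permutes_id by (simp add: row_group_def)
  show "p \<circ> p' \<in> row_group la" if "p \<in> row_group la" "p' \<in> row_group la"
    using that Sy_lt_iff[OF row_group_Sy[OF that(2)]] by (auto simp: row_group_def intro: permutes_compose)
  assume p: "p \<in> row_group la"
  have "row_index la (inv p m) = row_index la m" if "m < sum_list la" for m
  proof -
    have "inv p m < sum_list la" using Sy_lt_iff[OF Sy_inv[OF row_group_Sy[OF p]]] that by simp
    then have "row_index la (p (inv p m)) = row_index la (inv p m)" using p by (simp add: row_group_def)
    then show ?thesis using Sy_bij[OF row_group_Sy[OF p]] by (simp add: bij_is_surj surj_f_inv_f)
  qed
  then show "inv p \<in> row_group la" using p by (simp add: row_group_def permutes_inv)
qed

lemma col_group_simps [simp]: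
  "id \<in> col_group la"
  "p \<in> col_group la \<Longrightarrow> p' \<in> col_group la \<Longrightarrow> p \<circ> p' \<in> col_group la"
  "p \<in> col_group la \<Longrightarrow> inv p \<in> col_group la"
proof -
  show "id \<in> col_group la" using permutes_id by (simp add: col_group_def)
  show "p \<circ> p' \<in> col_group la" if "p \<in> col_group la" "p' \<in> col_group la"
    using that Sy_lt_iff[OF col_group_Sy[OF that(2)]] by (auto simp: col_group_def intro: permutes_compose)
  assume p: "p \<in> col_group la"
  have "col_index la (inv p m) = col_index la m" if "m < sum_list la" for m
  proof -
    have "inv p m < sum_list la" using Sy_lt_iff[OF Sy_inv[OF col_group_Sy[OF p]]] that by simp
    then have "col_index la (p (inv p m)) = col_index la (inv p m)" using p by (simp add: col_group_def)
    then show ?thesis using Sy_bij[OF col_group_Sy[OF p]] by (simp add: bij_is_surj surj_f_inv_f)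
  qed
  then show "inv p \<in> col_group la" using p by (simp add: col_group_def permutes_inv)
qed

lemma row_group_transpose:
  "a < sum_list la \<Longrightarrow> b < sum_list la \<Longrightarrow> row_index la a = row_index la b \<Longrightarrow> Transposition.transpose a b \<in> row_group la"
  using permutes_swap_id[of a "{..<sum_list la}" b] by (auto simp: row_group_def Transposition.transpose_def)

lemma col_group_transpose:
  "a < sum_list la \<Longrightarrow> b < sum_list la \<Longrightarrow> col_index la a = col_index la b \<Longrightarrow> Transposition.transpose a b \<in> col_group la"
  using permutes_swap_id[of a "{..<sum_list la}" b] by (auto simp: col_group_def Transposition.transpose_def)

lemma row_col_disjoint: "x \<in> row_group la \<Longrightarrow> x \<in> col_group la \<Longrightarrow> x = id"
proof (rule ext)
  fix m assume x: "x \<in> row_group la" "x \<in> col_group la"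
  show "x m = id m"
  proof (cases "m < sum_list la")
    case True
    then show ?thesis using x box_inj[of "x m" la m] Sy_lt_iff[OF row_group_Sy[OF x(1)]]
      by (auto simp: row_group_def col_group_def)
  next
    case False
    then show ?thesis using x by (auto simp: row_group_def permutes_not_in)
  qed
qed

text \<open>For equal shapes the equality case of the column comparison is automatic, so the row of
  \<open>m\<close> and the column of \<open>inv g m\<close> always meet in a box. Moving every
  letter within its row to that box is a row permutation \<open>p\<close>, after which only a column
  permutation is left.\<close>

lemma not_separated_product:
  assumes g: "g \<in> Sy (sum_list la)" and ns: "\<not> separated la la g"
  shows "\<exists>p\<in>row_group la. \<exists>q\<in>col_group la. g = p \<circ> q"
proof -
  let ?d = "sum_list la" let ?D = "{..<sum_list la}"
  note S = not_separated[OF refl g ns]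
  define p where "p m = (if m < ?d then (SOME m'. m' < ?d \<and> row_index la m' = row_index la m
      \<and> col_index la m' = col_index la (inv g m)) else m)" for m
  have p: "p m < ?d \<and> row_index la (p m) = row_index la m \<and> col_index la (p m) = col_index la (inv g m)"
    if m: "m < ?d" for m
  proof -
    have "(row_index la m, col_index la (inv g m)) \<in> (\<lambda>m. (row_index la m, col_index la m)) ` ?D"
      using S(2) m by blast
    then have "\<exists>m'. m' < ?d \<and> row_index la m' = row_index la m \<and> col_index la m' = col_index la (inv g m)"
      by auto
    from someI_ex[OF this] show ?thesis unfolding p_def using m by simp
  qed
  have "inj_on p ?D"
  proof (rule inj_onI)
    fix x y assume xy: "x \<in> ?D" "y \<in> ?D" "p x = p y"
    then have "(row_index la x, col_index la (inv g x)) = (row_index la y, col_index la (inv g y))"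
      using p[of x] p[of y] by auto
    then show "x = y" using S(3) xy by (auto dest: inj_onD)
  qed
  moreover have "p ` ?D \<subseteq> ?D" using p by auto
  ultimately have "bij_betw p ?D ?D" by (simp add: bij_betw_def endo_inj_surj)
  then have pp: "p permutes ?D" by (rule bij_imp_permutes) (simp add: p_def)
  then have pR: "p \<in> row_group la" using p by (simp add: row_group_def)
  have pS: "p \<in> Sy ?d" by (rule row_group_Sy[OF pR])
  \<comment> \<open>Since \<open>p m\<close> and \<open>inv g m\<close> lie in the same column,
    \<open>?q\<close> preserves columns; \<open>g\<close> is then the product of the inverses of
    \<open>p\<close> and \<open>?q\<close>.\<close>
  let ?q = "inv g \<circ> inv p"
  have "?q \<in> col_group la" unfolding col_group_def mem_Collect_eq
  proof (intro conjI allI impI)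
    show "?q permutes ?D" using g pS Sy_comp[OF Sy_inv Sy_inv] by (simp add: Sy_def)
    fix m assume m: "m < ?d"
    let ?m = "inv p m"
    have "?m < ?d" using m pS by simp
    moreover have "p ?m = m" using Sy_bij[OF pS] by (simp add: bij_is_surj surj_f_inv_f)
    ultimately show "col_index la (?q m) = col_index la m" using p[of ?m] by simp
  qed
  then have "inv ?q \<in> col_group la" by simp
  moreover have "g = inv p \<circ> inv ?q"
    using Sy_inv_comp[OF Sy_inv[OF g] Sy_inv[OF pS]] Sy_cancel(3)[OF g] Sy_cancel(3,4)[OF pS] by metis
  ultimately show ?thesis using pR by (metis row_group_simps(3))
qed

definition row_sym :: "nat list \<Rightarrow> (nat \<Rightarrow> nat) \<Rightarrow> complex" where
  "row_sym la x = (if x \<in> row_group la then 1 else 0)"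

definition col_sym :: "nat list \<Rightarrow> (nat \<Rightarrow> nat) \<Rightarrow> complex" where
  "col_sym la x = (if x \<in> col_group la then of_int (sign x) else 0)"

lemma Sy_permutation: "g \<in> Sy d \<Longrightarrow> permutation g"
  by (auto simp: Sy_def permutation_permutes)

lemma sign_Sy_comp: "g \<in> Sy d \<Longrightarrow> h \<in> Sy d \<Longrightarrow> sign (g \<circ> h) = sign g * sign h"
  by (simp add: Sy_permutation sign_compose)

lemma sign_Sy_inv: "g \<in> Sy d \<Longrightarrow> sign (inv g) = sign g"
  by (simp add: Sy_permutation sign_inverse)

lemma young_symmetrizer_conv: "young_symmetrizer la = conv (sum_list la) (row_sym la) (col_sym la)"
proof
  fix x
  have inner: "(\<Sum>q\<in>col_group la. if p \<circ> q = x then complex_of_int (sign q) else 0) =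
      (if x \<in> Sy (sum_list la) then col_sym la (inv p \<circ> x) else 0)" if p: "p \<in> row_group la" for p
  proof -
    note pS = row_group_Sy[OF p]
    have eq: "p \<circ> q = x \<longleftrightarrow> q = inv p \<circ> x" for q using pS by (metis Sy_cancel(4,5))
    have "x \<in> Sy (sum_list la)" if "inv p \<circ> x \<in> col_group la"
      using Sy_comp[OF pS col_group_Sy[OF that]] pS by simp
    then show ?thesis by (auto simp: eq col_sym_def)
  qed
  have "young_symmetrizer la x = (\<Sum>p\<in>row_group la. if x \<in> Sy (sum_list la) then col_sym la (inv p \<circ> x) else 0)"
    unfolding young_symmetrizer_def by (rule sum.cong[OF refl inner])
  also have "\<dots> = (\<Sum>p\<in>Sy (sum_list la). if x \<in> Sy (sum_list la) then row_sym la p * col_sym la (inv p \<circ> x) else 0)"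
    by (rule sum.mono_neutral_cong_left) (auto simp: row_sym_def row_group_Sy)
  also have "\<dots> = conv (sum_list la) (row_sym la) (col_sym la) x"
    by (simp add: conv_def)
  finally show "young_symmetrizer la x = conv (sum_list la) (row_sym la) (col_sym la) x" .
qed

lemma supp_young [simp]: "supp (sum_list la) (young_symmetrizer la)"
  by (simp add: young_symmetrizer_conv)

definition row_inv :: "nat list \<Rightarrow> ((nat \<Rightarrow> nat) \<Rightarrow> complex) \<Rightarrow> bool" where
  "row_inv la f \<longleftrightarrow> (\<forall>p\<in>row_group la. \<forall>x\<in>Sy (sum_list la). f (p \<circ> x) = f x)"

definition col_alt :: "nat list \<Rightarrow> ((nat \<Rightarrow> nat) \<Rightarrow> complex) \<Rightarrow> bool" where
  "col_alt la f \<longleftrightarrow> (\<forall>q\<in>col_group la. \<forall>x\<in>Sy (sum_list la). f (x \<circ> q) = of_int (sign q) * f x)"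

lemma row_group_comp_iff:
  "p \<in> row_group la \<Longrightarrow> x \<in> Sy (sum_list la) \<Longrightarrow> p \<circ> x \<in> row_group la \<longleftrightarrow> x \<in> row_group la"
  by (metis Sy_cancel(4) row_group_Sy row_group_simps(2,3))

lemma col_group_comp_iff:
  assumes "q \<in> col_group la" "x \<in> Sy (sum_list la)"
  shows "x \<circ> q \<in> col_group la \<longleftrightarrow> x \<in> col_group la"
proof
  assume "x \<circ> q \<in> col_group la"
  then have "(x \<circ> q) \<circ> inv q \<in> col_group la" using assms by simp
  then show "x \<in> col_group la" using col_group_Sy[OF assms(1)] by (simp add: comp_assoc)
qed (use assms in auto)

lemma row_inv_row_sym: "row_inv la (row_sym la)"
  by (auto simp: row_inv_def row_sym_def row_group_comp_iff)

lemma col_alt_col_sym: "col_alt la (col_sym la)"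
  by (auto simp: col_alt_def col_sym_def col_group_comp_iff sign_Sy_comp[OF col_group_Sy col_group_Sy])

lemma row_inv_conv: assumes "row_inv la f" shows "row_inv la (conv (sum_list la) f h)"
  unfolding row_inv_def
proof (intro ballI)
  fix p x assume p: "p \<in> row_group la" and x: "x \<in> Sy (sum_list la)"
  note pS = row_group_Sy[OF p]
  show "conv (sum_list la) f h (p \<circ> x) = conv (sum_list la) f h x"
    using assms p x pS by (simp add: conv_altdef row_inv_def comp_assoc)
qed

lemma col_alt_conv: assumes "col_alt la f" shows "col_alt la (conv (sum_list la) h f)"
  unfolding col_alt_def
proof (intro ballI)
  fix q x assume q: "q \<in> col_group la" and x: "x \<in> Sy (sum_list la)"
  note qS = col_group_Sy[OF q]
  have "f (inv y \<circ> (x \<circ> q)) = of_int (sign q) * f (inv y \<circ> x)" if "y \<in> Sy (sum_list la)" for y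
    using assms q x that unfolding col_alt_def by (metis Sy_comp Sy_inv comp_assoc)
  then show "conv (sum_list la) h f (x \<circ> q) = of_int (sign q) * conv (sum_list la) h f x"
    using x qS by (simp add: conv_def sum_distrib_left mult.left_commute)
qed

lemma row_inv_young: "row_inv la (young_symmetrizer la)"
  by (simp add: young_symmetrizer_conv row_inv_conv row_inv_row_sym)

lemma col_alt_young: "col_alt la (young_symmetrizer la)"
  by (simp add: young_symmetrizer_conv col_alt_conv col_alt_col_sym)

text \<open>Let t transpose the two letters. It lies in the row group of \<open>la\<close>, and its
  conjugate t' by \<open>g\<close> lies in the column group of \<open>mu\<close>, so that f g = f (t
  g) = f (g t') = - f g.\<close>

lemma separated_eq_0:
  assumes "row_inv la f" "col_alt mu f" and s: "sum_list mu = sum_list la"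
    and g: "g \<in> Sy (sum_list la)" and sep: "separated la mu g"
  shows "f g = 0"
proof -
  let ?d = "sum_list la"
  from sep obtain a b where ab: "a < ?d" "b < ?d" "a \<noteq> b" "row_index la a = row_index la b"
    "col_index mu (inv g a) = col_index mu (inv g b)" by (auto simp: separated_def)
  let ?a = "inv g a" and ?b = "inv g b"
  have b: "bij g" by (rule Sy_bij[OF g])
  have neq: "?a \<noteq> ?b" using b ab(3) by (metis bij_inv_eq_iff)
  have t: "Transposition.transpose a b \<in> row_group la" using ab by (intro row_group_transpose) auto
  have t': "Transposition.transpose ?a ?b \<in> col_group mu"
    using ab s Sy_inv[OF g] by (intro col_group_transpose) (simp_all add: Sy_lt_iff[OF Sy_inv[OF g]])
  have "Transposition.transpose a b \<circ> g = g \<circ> Transposition.transpose ?a ?b"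
    using b by (auto simp: fun_eq_iff Transposition.transpose_def bij_inv_eq_iff bij_is_surj surj_f_inv_f)
  then have "f (g \<circ> Transposition.transpose ?a ?b) = f g"
    using assms(1) t g unfolding row_inv_def by metis
  moreover have "f (g \<circ> Transposition.transpose ?a ?b) = - f g"
    using assms(2) t' g s neq by (auto simp: col_alt_def sign_swap_id)
  ultimately show ?thesis by simp
qed

text \<open>Row and column group meet only in the identity, so a single pair contributes. Due to
  this normalization, factors of proportionality to the symmetrizer are values at
  \<open>id\<close>.\<close>

lemma young_symmetrizer_id: "young_symmetrizer la id = 1"
proof -
  have "(if p \<circ> q = id then complex_of_int (sign q) else 0) = (if p = id then if q = id then 1 else 0 else 0)"
    if "p \<in> row_group la" "q \<in> col_group la" for p q
  proof (cases "p \<circ> q = id")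
    case True
    then have "q = inv p" using row_group_Sy[OF that(1)] by (metis Sy_cancel(4) comp_id)
    then have "q = id" using that row_col_disjoint[of q la] by simp
    then show ?thesis using True by (simp add: sign_id)
  qed auto
  then have "young_symmetrizer la id = (\<Sum>p\<in>row_group la. \<Sum>q\<in>col_group la. if p = id then if q = id then 1 else 0 else 0)"
    unfolding young_symmetrizer_def by (intro sum.cong refl) blast
  also have "\<dots> = (\<Sum>p\<in>row_group la. if p = id then 1 else 0)"
    by (intro sum.cong refl) auto
  also have "\<dots> = 1" by simp
  finally show ?thesis .
qed

text \<open>A group element is either separated, where both sides vanish, or a product p q, where
  both sides are fixed by their value at \<open>id\<close>. This one-dimensionality does the work of
  Schur's lemma.\<close>

lemma young_unique:
  assumes f: "supp (sum_list la) f" "row_inv la f" "col_alt la f"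
  shows "f = (\<lambda>x. f id * young_symmetrizer la x)"
proof (rule supp_eqI[of "sum_list la"])
  fix x assume x: "x \<in> Sy (sum_list la)"
  show "f x = f id * young_symmetrizer la x"
  proof (cases "separated la la x")
    case True
    then show ?thesis
      using separated_eq_0[OF f(2,3) refl x] separated_eq_0[OF row_inv_young col_alt_young refl x] by simp
  next
    case False
    from not_separated_product[OF x this] obtain p q
      where pq: "p \<in> row_group la" "q \<in> col_group la" "x = p \<circ> q" by blast
    have "h x = of_int (sign q) * h id" if "row_inv la h" "col_alt la h" for h
      using that pq col_group_Sy[OF pq(2)] unfolding row_inv_def col_alt_def
      by (metis Sy_id(1) id_comp)
    from this[OF f(2,3)] this[OF row_inv_young col_alt_young] show ?thesis
      by (simp add: young_symmetrizer_id)
  qed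
qed (use f in \<open>auto simp: supp_def young_symmetrizer_conv conv_def\<close>)

section \<open>Irreducible characters\<close>

lemma sum_fun_apply: "sum f A x = (\<Sum>a\<in>A. f a x)"
  for f :: "'b \<Rightarrow> 'a \<Rightarrow> 'c::comm_monoid_add"
  by (induction A rule: infinite_finite_induct) auto

text \<open>The vectors \<open>e x\<close>, possibly dependent, are the images of the point masses
  under a projection onto \<open>V\<close>. The trace on \<open>V\<close> equals the trace of the
  projection followed by the operator, whose diagonal entries are \<open>e x (tau x)\<close>; the
  basis chosen in \<open>trace_on\<close> thereby disappears.\<close>

lemma trace_on_eq_sum:
  fixes e :: "'a \<Rightarrow> 'a \<Rightarrow> complex"
  assumes X: "finite X" and V: "cfun.subspace V"
    and e: "\<And>x. x \<in> X \<Longrightarrow> e x \<in> V"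
    and proj: "\<And>v. v \<in> V \<Longrightarrow> v = (\<lambda>y. \<Sum>x\<in>X. v x * e x y)"
    and T: "\<And>v. v \<in> V \<Longrightarrow> (\<lambda>y. v (tau y)) \<in> V"
  shows "trace_on V (\<lambda>v y. v (tau y)) = (\<Sum>x\<in>X. e x (tau x))"
proof -
  let ?P = "\<lambda>B. B \<subseteq> V \<and> cfun.independent B \<and> cfun.span B = V"
  obtain B0 where "B0 \<subseteq> V" "cfun.independent B0" "V \<subseteq> cfun.span B0"
    using cfun.maximal_independent_subset[of V] by blast
  then have "?P B0" using V cfun.span_minimal by blast
  then have "?P (SOME B. ?P B)" by (rule someI)
  define B where "B = (SOME B. ?P B)"
  have B: "B \<subseteq> V" "cfun.independent B" "cfun.span B = V"
    using \<open>?P (SOME B. ?P B)\<close> unfolding B_def by blast+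
  have expand: "v = (\<Sum>x\<in>X. fun_scale (v x) (e x))" if "v \<in> V" for v
  proof -
    have "(\<Sum>x\<in>X. fun_scale (v x) (e x)) = (\<lambda>y. \<Sum>x\<in>X. v x * e x y)"
      by (simp add: sum_fun_apply fun_scale_def fun_eq_iff)
    with proj[OF that] show ?thesis by (rule trans[OF _ sym])
  qed
  have "V \<subseteq> cfun.span (e ` X)"
  proof
    fix v assume "v \<in> V"
    have "(\<Sum>x\<in>X. fun_scale (v x) (e x)) \<in> cfun.span (e ` X)"
      by (intro cfun.span_sum cfun.span_scale cfun.span_base) auto
    then show "v \<in> cfun.span (e ` X)" using expand[OF \<open>v \<in> V\<close>] by (simp only: flip: expand[OF \<open>v \<in> V\<close>])
  qed
  then have finB: "finite B"
    using cfun.independent_span_bound[of "e ` X" B] X B by auto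
  have rep: "cfun.representation B v b = (\<Sum>x\<in>X. v x * cfun.representation B (e x) b)" if "v \<in> V" for v b
  proof -
    have "cfun.representation B (\<Sum>x\<in>X. fun_scale (v x) (e x)) b
        = (\<Sum>x\<in>X. cfun.representation B (fun_scale (v x) (e x)) b)"
      using B e by (subst cfun.representation_sum) (auto intro!: cfun.span_scale)
    also have "\<dots> = (\<Sum>x\<in>X. v x * cfun.representation B (e x) b)"
      using B e by (intro sum.cong refl) (simp add: cfun.representation_scale)
    finally show ?thesis by (simp only: flip: expand[OF that])
  qed
  have ex: "e x y = (\<Sum>b\<in>B. cfun.representation B (e x) b * b y)" if "x \<in> X" for x y
  proof -
    have "e x \<in> cfun.span B" using e[OF that] B by simp
    from cfun.sum_representation_eq[OF B(2) this finB order_refl]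
    have "(\<Sum>b\<in>B. fun_scale (cfun.representation B (e x) b) b) y = e x y" by (rule fun_cong)
    then show ?thesis by (simp add: sum_fun_apply fun_scale_def)
  qed
  have "trace_on V (\<lambda>v y. v (tau y)) = (\<Sum>b\<in>B. cfun.representation B (\<lambda>y. b (tau y)) b)"
    by (simp add: trace_on_def B_def Let_def)
  \<comment> \<open>The coordinate of the transformed basis vector is expanded through the
    \<open>e x\<close>; summing over \<open>b\<close> afterwards reassembles \<open>e x\<close> at
    \<open>tau x\<close>.\<close>
  also have "\<dots> = (\<Sum>b\<in>B. \<Sum>x\<in>X. b (tau x) * cfun.representation B (e x) b)"
    using B by (intro sum.cong refl rep T) auto
  also have "\<dots> = (\<Sum>x\<in>X. \<Sum>b\<in>B. cfun.representation B (e x) b * b (tau x))"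
    by (subst sum.swap) (simp add: mult.commute)
  also have "\<dots> = (\<Sum>x\<in>X. e x (tau x))"
    by (intro sum.cong refl) (simp add: ex)
  finally show ?thesis .
qed

text \<open>As the symmetrizer is 1 at \<open>id\<close>, this is the scalar k with c c = k c.
  Classically, it is d! divided by the dimension of the irreducible module.\<close>

definition young_scale :: "nat list \<Rightarrow> complex" where
  "young_scale la = conv (sum_list la) (young_symmetrizer la) (young_symmetrizer la) id"

lemma young_idem:
  "conv (sum_list la) (young_symmetrizer la) (young_symmetrizer la) = (\<lambda>x. young_scale la * young_symmetrizer la x)"
  unfolding young_scale_def
  by (rule young_unique) (simp_all add: row_inv_conv row_inv_young col_alt_conv col_alt_young)

lemma young_real: "young_symmetrizer la x \<in> \<real>"
  unfolding young_symmetrizer_def by (intro sum_in_Reals) (auto simp: Reals_of_int)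

lemma young_scale_real: "young_scale la \<in> \<real>"
  unfolding young_scale_def conv_at_id by (intro sum_in_Reals Reals_mult young_real)

lemma row_sym_idem: "conv (sum_list la) (row_sym la) (row_sym la) = (\<lambda>x. of_nat (card (row_group la)) * row_sym la x)"
proof (rule supp_eqI[of "sum_list la"])
  fix x assume x: "x \<in> Sy (sum_list la)"
  have "row_sym la y * row_sym la (inv y \<circ> x) = row_sym la y * row_sym la x" for y
  proof (cases "y \<in> row_group la")
    case True
    then show ?thesis using x row_inv_row_sym[of la] row_group_simps(3) unfolding row_inv_def by metis
  qed (simp add: row_sym_def)
  then have "conv (sum_list la) (row_sym la) (row_sym la) x = (\<Sum>y\<in>Sy (sum_list la). row_sym la y * row_sym la x)"
    using x by (simp only: conv_def if_True)
  also have "\<dots> = (\<Sum>y\<in>row_group la. row_sym la x)"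
    by (rule sum.mono_neutral_cong_right) (auto simp: row_sym_def row_group_Sy)
  finally show "conv (sum_list la) (row_sym la) (row_sym la) x = of_nat (card (row_group la)) * row_sym la x"
    by simp
qed (auto simp: supp_def conv_def row_sym_def dest: row_group_Sy)

lemma conv_inv:
  assumes "x \<in> Sy d"
  shows "conv d f g (inv x) = conv d (\<lambda>y. g (inv y)) (\<lambda>y. f (inv y)) x"
proof -
  have "conv d f g (inv x) = (\<Sum>y\<in>Sy d. f (inv x \<circ> inv y) * g y)"
    using assms by (simp add: conv_altdef)
  also have "\<dots> = (\<Sum>y\<in>Sy d. f (inv x \<circ> y) * g (inv y))"
    using sum_Sy_inv[of "\<lambda>y. f (inv x \<circ> y) * g (inv y)" d] by (simp cong: sum.cong)
  also have "\<dots> = (\<Sum>y\<in>Sy d. g (inv y) * f (inv (inv y \<circ> x)))"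
    using assms by (intro sum.cong refl) (simp add: Sy_inv_comp[OF Sy_inv assms] mult.commute)
  finally show ?thesis using assms by (simp add: conv_def)
qed

text \<open>With \<open>a\<close>, \<open>b\<close> the row symmetrizer and column antisymmetrizer, \<open>y = a b a\<close> is real and
  self-adjoint, so \<open>y y\<close> has the positive coefficient \<open>\<Sum> (y g)\<^sup>2\<close> at the identity; but
  \<open>y y\<close> is a multiple of \<open>(a b a b) a\<close>.\<close>

lemma young_scale_nonzero: "young_scale la \<noteq> 0"
proof
  let ?d = "sum_list la" let ?a = "row_sym la" let ?b = "col_sym la" let ?c = "young_symmetrizer la"
  let ?y = "conv ?d ?c ?a"
  assume "young_scale la = 0"
  then have cc: "conv ?d ?c ?c = (\<lambda>x. 0)" by (simp add: young_idem)
  have z: "conv ?d (\<lambda>x. 0) f = (\<lambda>x. 0)" for f by (auto simp: conv_def)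
  have "conv ?d ?y ?y = conv ?d (conv ?d ?c (conv ?d ?a ?a)) (conv ?d ?b ?a)"
    by (simp add: young_symmetrizer_conv conv_assoc)
  also have "\<dots> = (\<lambda>x. of_nat (card (row_group la)) * conv ?d (conv ?d ?c ?c) ?a x)"
    by (simp add: row_sym_idem conv_scale_right conv_scale_left young_symmetrizer_conv conv_assoc)
  finally have "conv ?d ?y ?y id = 0" by (simp add: cc z)
  moreover have ainv: "?a (inv x) = ?a x" "?b (inv x) = ?b x" if "x \<in> Sy ?d" for x
  proof -
    show "?a (inv x) = ?a x" unfolding row_sym_def by (metis row_group_simps(3) Sy_cancel(3) that)
    show "?b (inv x) = ?b x" unfolding col_sym_def by (metis col_group_simps(3) Sy_cancel(3) that sign_Sy_inv)
  qed
  have cong: "conv ?d f g = conv ?d f' g'" if "\<And>x. x \<in> Sy ?d \<Longrightarrow> f x = f' x" "\<And>x. x \<in> Sy ?d \<Longrightarrow> g x = g' x" for f g f' g'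
    using that by (auto simp: conv_def fun_eq_iff intro!: sum.cong)
  have yinv: "?y (inv x) = ?y x" if x: "x \<in> Sy ?d" for x
  proof -
    have "?y (inv x) = conv ?d (\<lambda>y. ?a (inv y)) (\<lambda>y. ?c (inv y)) x" by (rule conv_inv[OF x])
    also have "conv ?d (\<lambda>y. ?a (inv y)) (\<lambda>y. ?c (inv y)) = conv ?d ?a (conv ?d ?b ?a)"
    proof (rule cong)
      fix y assume y: "y \<in> Sy ?d"
      have "conv ?d ?a ?b (inv y) = conv ?d (\<lambda>y. ?b (inv y)) (\<lambda>y. ?a (inv y)) y" by (rule conv_inv[OF y])
      also have "conv ?d (\<lambda>y. ?b (inv y)) (\<lambda>y. ?a (inv y)) = conv ?d ?b ?a" by (rule cong) (simp_all add: ainv)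
      finally show "?c (inv y) = conv ?d ?b ?a y" by (simp add: young_symmetrizer_conv)
    qed (simp add: ainv)
    also have "\<dots> = ?y" by (simp add: young_symmetrizer_conv conv_assoc)
    finally show ?thesis .
  qed
  ultimately have "(\<Sum>x\<in>Sy ?d. ?y x * ?y x) = 0" by (simp add: conv_at_id yinv cong: sum.cong)
  moreover have real: "?y x \<in> \<real>" for x
    unfolding conv_def by (auto intro!: sum_in_Reals Reals_mult young_real simp: row_sym_def)
  define r where "r x = Re (?y x)" for x
  have r: "?y x = of_real (r x)" for x using real[of x] by (simp add: r_def of_real_Re)
  ultimately have "complex_of_real (\<Sum>x\<in>Sy ?d. r x * r x) = 0" by (simp add: r)
  then have "(\<Sum>x\<in>Sy ?d. r x * r x) = 0" by (simp only: of_real_eq_0_iff)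
  then have "r id * r id = 0"
    by (subst (asm) sum_nonneg_eq_0_iff) auto
  then have "?y id = 0" using r by simp
  \<comment> \<open>Row invariance makes every summand 1, so that \<open>?y id\<close> is the order
    of the row group, against the vanishing just derived.\<close>
  moreover have "?y id = (\<Sum>p\<in>row_group la. ?c p * ?a (inv p))"
    unfolding conv_at_id
    by (rule sum.mono_neutral_cong_right) (auto simp: row_group_Sy row_sym_def, metis Sy_cancel(3) row_group_simps(3))
  moreover have "\<dots> = (\<Sum>p\<in>row_group la. 1)"
  proof (intro sum.cong refl)
    fix p assume p: "p \<in> row_group la"
    have "?c (p \<circ> id) = ?c id" using row_inv_young[of la] p unfolding row_inv_def by (metis Sy_id(1))
    then show "?c p * ?a (inv p) = 1" using p by (simp add: young_symmetrizer_id row_sym_def)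
  qed
  moreover have "card (row_group la) \<noteq> 0"
    using row_group_simps(1)[of la] by (metis card_0_eq empty_iff finite_row_group)
  ultimately show False by simp
qed

text \<open>The diagonal sum given by \<open>trace_on_eq_sum\<close> for right multiplication by c /
  k. The inverse of \<open>x\<close> is there because left translation composes with the
  inverse.\<close>

definition irrep_char :: "nat list \<Rightarrow> (nat \<Rightarrow> nat) \<Rightarrow> complex" where
  "irrep_char la x = (\<Sum>h\<in>Sy (sum_list la). young_symmetrizer la (inv h \<circ> (inv x \<circ> h))) / young_scale la"

lemma irrep_char_real: "irrep_char la x \<in> \<real>"
  unfolding irrep_char_def by (intro Reals_divide sum_in_Reals young_real young_scale_real)

lemma left_translate_comp:
  "g \<in> Sy d \<Longrightarrow> h \<in> Sy d \<Longrightarrow> left_translate g (left_translate h f) = left_translate (g \<circ> h) f"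
  by (simp add: left_translate_def fun_eq_iff comp_assoc)

lemma conv_left_translate:
  assumes "g \<in> Sy d" shows "conv d (left_translate g f) h = left_translate g (conv d f h)"
proof
  fix x
  have "inv g \<circ> x \<in> Sy d \<longleftrightarrow> x \<in> Sy d" using assms by (metis Sy_cancel(5) Sy_comp Sy_inv)
  moreover have "(\<Sum>y\<in>Sy d. f (inv g \<circ> y) * h (inv y \<circ> x)) = (\<Sum>y\<in>Sy d. f y * h (inv y \<circ> (inv g \<circ> x)))"
    using sum_Sy_left[OF assms, of "\<lambda>y. f (inv g \<circ> y) * h (inv y \<circ> x)"] assms
    by (simp add: Sy_inv_comp[OF assms] comp_assoc cong: sum.cong)
  ultimately show "conv d (left_translate g f) h x = left_translate g (conv d f h) x"
    by (simp add: conv_def left_translate_def)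
qed

text \<open>Right multiplication by c commutes with left translation, so by c c = k c it acts on the
  whole left ideal as the scalar k. Hence v = v c / k, which is the reproducing formula for
  \<open>trace_on_eq_sum\<close>, with \<open>e h\<close> the translate of c / k by
  \<open>h\<close>.\<close>

lemma trace_irrep:
  assumes x: "x \<in> Sy (sum_list la)"
  shows "trace_on (irrep la) (left_translate x) = irrep_char la x"
proof -
  let ?d = "sum_list la" let ?c = "young_symmetrizer la" let ?k = "young_scale la"
  define e where "e h = fun_scale (1 / ?k) (left_translate h ?c)" for h
  let ?G = "{left_translate g ?c | g. g permutes {..<?d}}"
  have fold: "irrep la = cfun.span ?G" by (simp add: irrep_def)
  have proj: "v = (\<lambda>y. \<Sum>h\<in>Sy ?d. v h * e h y)" if "v \<in> irrep la" for v
  proof -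
    have "supp ?d v \<and> conv ?d v ?c = fun_scale ?k v"
      using that unfolding fold
    proof (induction rule: cfun.span_induct_alt)
      case base show ?case by (auto simp: supp_def conv_def fun_scale_def)
    next
      case (step c g v)
      then obtain h where h: "h \<in> Sy ?d" "g = left_translate h ?c" by (auto simp: Sy_def)
      have g: "supp ?d g"
      proof -
        have "inv h \<circ> x \<notin> Sy ?d" if "x \<notin> Sy ?d" for x using that h by (metis Sy_cancel(5) Sy_comp)
        then show ?thesis using supp_young[of la] h by (auto simp: supp_def left_translate_def)
      qed
      have "conv ?d g ?c = fun_scale ?k g"
        by (simp add: h conv_left_translate young_idem) (simp add: left_translate_def fun_scale_def)
      then show ?case using step g
        by (auto simp: supp_def plus_fun_def fun_scale_def conv_add_left conv_scale_left algebra_simps fun_eq_iff)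
    qed
    then have s: "supp ?d v" and cv: "conv ?d v ?c = fun_scale ?k v" by auto
    have "v y = (\<Sum>h\<in>Sy ?d. v h * e h y)" for y
    proof -
      have "(\<Sum>h\<in>Sy ?d. v h * e h y) = conv ?d v ?c y / ?k"
      proof (cases "y \<in> Sy ?d")
        case True
        then show ?thesis by (simp add: e_def conv_def fun_scale_def left_translate_def sum_divide_distrib)
      next
        case False
        then have "inv h \<circ> y \<notin> Sy ?d" if "h \<in> Sy ?d" for h using that by (metis Sy_cancel(5) Sy_comp)
        then have "e h y = 0" if "h \<in> Sy ?d" for h
          using that supp_young[of la] by (simp add: supp_def e_def fun_scale_def left_translate_def)
        then show ?thesis using False by (simp add: conv_def)
      qed
      then show ?thesis using young_scale_nonzero[of la] by (simp add: cv fun_scale_def)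
    qed
    then show ?thesis by blast
  qed
  have T: "(\<lambda>y. v (inv x \<circ> y)) \<in> irrep la" if "v \<in> irrep la" for v
    using that unfolding fold
  proof (induction rule: cfun.span_induct_alt)
    case base show ?case using cfun.span_zero by (simp add: zero_fun_def)
  next
    case (step c g v)
    then obtain h where h: "h \<in> Sy ?d" "g = left_translate h ?c" by (auto simp: Sy_def)
    have "left_translate x g = left_translate (x \<circ> h) ?c" using h x left_translate_comp by simp
    moreover have "(x \<circ> h) permutes {..<?d}" using Sy_comp[OF x h(1)] by (simp add: Sy_def)
    ultimately have "left_translate x g \<in> cfun.span ?G" by (auto intro!: cfun.span_base)
    then have "fun_scale c (left_translate x g) + (\<lambda>y. v (inv x \<circ> y)) \<in> cfun.span ?G"
      using step by (intro cfun.span_add cfun.span_scale)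
    moreover have "fun_scale c (left_translate x g) + (\<lambda>y. v (inv x \<circ> y)) = (\<lambda>y. (fun_scale c g + v) (inv x \<circ> y))"
      by (simp add: fun_eq_iff left_translate_def fun_scale_def)
    ultimately show ?case by (simp only:)
  qed
  have "trace_on (irrep la) (\<lambda>v y. v (inv x \<circ> y)) = (\<Sum>h\<in>Sy ?d. e h (inv x \<circ> h))"
  proof (rule trace_on_eq_sum)
    show "cfun.subspace (irrep la)" by (simp add: fold)
    show "e h \<in> irrep la" if "h \<in> Sy ?d" for h
      unfolding fold e_def using that by (intro cfun.span_scale cfun.span_base) (auto simp: Sy_def)
    show "finite (Sy ?d)" by simp
    show "v = (\<lambda>y. \<Sum>h\<in>Sy ?d. v h * e h y)" if "v \<in> irrep la" for v by (rule proj[OF that])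
    show "(\<lambda>y. v (inv x \<circ> y)) \<in> irrep la" if "v \<in> irrep la" for v by (rule T[OF that])
  qed
  then show ?thesis
    by (simp add: irrep_char_def e_def left_translate_def[abs_def] fun_scale_def sum_divide_distrib)
qed

section \<open>Orthogonality relations of the characters\<close>

definition class_fun :: "nat \<Rightarrow> ((nat \<Rightarrow> nat) \<Rightarrow> complex) \<Rightarrow> bool" where
  "class_fun d f \<longleftrightarrow> (\<forall>x\<in>Sy d. \<forall>h\<in>Sy d. f (inv h \<circ> (x \<circ> h)) = f x)"

lemma class_fun_irrep_char: "class_fun (sum_list la) (irrep_char la)"
  unfolding class_fun_def
proof (intro ballI)
  let ?d = "sum_list la" let ?c = "young_symmetrizer la"
  fix x u assume x: "x \<in> Sy ?d" and u: "u \<in> Sy ?d"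
  have i: "inv (inv u \<circ> (x \<circ> u)) = inv u \<circ> (inv x \<circ> u)"
    using Sy_inv_comp[OF Sy_inv[OF u] Sy_comp[OF x u]] Sy_inv_comp[OF x u] Sy_cancel(3)[OF u]
    by (simp add: comp_assoc)
  have "(\<Sum>h\<in>Sy ?d. ?c (inv h \<circ> (inv (inv u \<circ> (x \<circ> u)) \<circ> h)))
      = (\<Sum>h\<in>Sy ?d. ?c (inv (u \<circ> h) \<circ> (inv x \<circ> (u \<circ> h))))"
    by (intro sum.cong refl) (simp add: i comp_assoc Sy_inv_comp[OF u])
  also have "\<dots> = (\<Sum>h\<in>Sy ?d. ?c (inv h \<circ> (inv x \<circ> h)))"
    by (rule sum_Sy_left[OF u, of "\<lambda>h. ?c (inv h \<circ> (inv x \<circ> h))"])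
  finally show "irrep_char la (inv u \<circ> (x \<circ> u)) = irrep_char la x" by (simp add: irrep_char_def)
qed

lemma sum_Sy_conj:
  assumes h: "h \<in> Sy d"
  shows "(\<Sum>x\<in>Sy d. f (inv h \<circ> (x \<circ> h))) = (\<Sum>x\<in>Sy d. f x)"
proof -
  have "(\<Sum>x\<in>Sy d. f (inv h \<circ> (x \<circ> h))) = (\<Sum>x\<in>Sy d. f (inv h \<circ> x))"
    by (rule sum_Sy_right[OF h, of "\<lambda>x. f (inv h \<circ> x)"])
  also have "\<dots> = (\<Sum>x\<in>Sy d. f x)" by (rule sum_Sy_left[OF Sy_inv[OF h]])
  finally show ?thesis .
qed

text \<open>The character sums the symmetrizer over all conjugates of an element. A class function
  does not notice the conjugation, so each of the d! summands contributes the same pairing.\<close>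

lemma sum_irrep_char_class_fun:
  assumes f: "class_fun (sum_list la) f"
  shows "(\<Sum>x\<in>Sy (sum_list la). irrep_char la x * f (inv x)) =
     fact (sum_list la) / young_scale la * (\<Sum>y\<in>Sy (sum_list la). young_symmetrizer la y * f y)"
proof -
  let ?d = "sum_list la" let ?c = "young_symmetrizer la" let ?k = "young_scale la"
  have "(\<Sum>x\<in>Sy ?d. irrep_char la x * f (inv x)) = (\<Sum>x\<in>Sy ?d. irrep_char la (inv x) * f x)"
    using sum_Sy_inv[of "\<lambda>x. irrep_char la (inv x) * f x" ?d] by (simp cong: sum.cong)
  also have "\<dots> = (\<Sum>x\<in>Sy ?d. \<Sum>h\<in>Sy ?d. ?c (inv h \<circ> (x \<circ> h)) * f x) / ?k"
    by (simp add: irrep_char_def sum_distrib_right sum_divide_distrib cong: sum.cong)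
  also have "(\<Sum>x\<in>Sy ?d. \<Sum>h\<in>Sy ?d. ?c (inv h \<circ> (x \<circ> h)) * f x)
      = (\<Sum>h\<in>Sy ?d. \<Sum>x\<in>Sy ?d. ?c (inv h \<circ> (x \<circ> h)) * f (inv h \<circ> (x \<circ> h)))"
    using f by (subst sum.swap) (simp add: class_fun_def cong: sum.cong)
  also have "\<dots> = (\<Sum>h\<in>Sy ?d. \<Sum>x\<in>Sy ?d. ?c x * f x)"
    by (intro sum.cong refl sum_Sy_conj[where f = "\<lambda>x. ?c x * f x"])
  finally show ?thesis by (simp add: card_Sy)
qed

lemma young_twisted:
  assumes u: "u \<in> Sy d"
  shows "(\<Sum>y\<in>Sy d. f y * g (inv u \<circ> (inv y \<circ> u))) = conv d f (conv d (unit_vec u) g) u"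
  using u by (simp add: conv_def[of d f]) (simp add: conv_unit_left cong: sum.cong)

text \<open>The pairing turns into values of the products c_la u c_mu at \<open>u\<close>. Such a
  product is row invariant for \<open>la\<close> by its left factor and column alternating for
  \<open>mu\<close> by its right factor.\<close>

lemma sum_young_irrep_char:
  assumes s: "sum_list mu = sum_list la"
  shows "(\<Sum>y\<in>Sy (sum_list la). young_symmetrizer la y * irrep_char mu y) =
    (\<Sum>u\<in>Sy (sum_list la). conv (sum_list la) (young_symmetrizer la)
        (conv (sum_list la) (unit_vec u) (young_symmetrizer mu)) u) / young_scale mu"
proof -
  let ?d = "sum_list la"
  have "(\<Sum>y\<in>Sy ?d. young_symmetrizer la y * irrep_char mu y) =
     (\<Sum>y\<in>Sy ?d. \<Sum>u\<in>Sy ?d. young_symmetrizer la y * young_symmetrizer mu (inv u \<circ> (inv y \<circ> u))) / young_scale mu"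
    by (simp add: irrep_char_def s sum_distrib_left sum_divide_distrib)
  also have "\<dots> = (\<Sum>u\<in>Sy ?d. \<Sum>y\<in>Sy ?d. young_symmetrizer la y * young_symmetrizer mu (inv u \<circ> (inv y \<circ> u))) / young_scale mu"
    by (subst sum.swap) simp
  finally show ?thesis by (simp add: young_twisted cong: sum.cong)
qed

lemma irrep_char_orthogonal_aux:
  assumes s: "sum_list mu = sum_list la" and sep: "\<And>g. g \<in> Sy (sum_list la) \<Longrightarrow> separated la mu g"
  shows "(\<Sum>x\<in>Sy (sum_list la). irrep_char la x * irrep_char mu (inv x)) = 0"
proof -
  let ?d = "sum_list la"
  have "conv ?d (young_symmetrizer la) (conv ?d (unit_vec u) (young_symmetrizer mu)) u = 0" if u: "u \<in> Sy ?d" for u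
  proof (rule separated_eq_0[where f = "conv ?d (young_symmetrizer la) (conv ?d (unit_vec u) (young_symmetrizer mu))", OF _ _ s u sep[OF u]])
    show "row_inv la (conv ?d (young_symmetrizer la) (conv ?d (unit_vec u) (young_symmetrizer mu)))"
      by (intro row_inv_conv row_inv_young)
    show "col_alt mu (conv ?d (young_symmetrizer la) (conv ?d (unit_vec u) (young_symmetrizer mu)))"
      unfolding s[symmetric] by (intro col_alt_conv col_alt_young)
  qed
  then have "(\<Sum>y\<in>Sy ?d. young_symmetrizer la y * irrep_char mu y) = 0"
    by (simp add: sum_young_irrep_char[OF s])
  moreover have "class_fun ?d (irrep_char mu)" using class_fun_irrep_char[of mu] s by simp
  ultimately show ?thesis by (simp add: sum_irrep_char_class_fun)
qed

text \<open>Separation is guaranteed for one of the two orders of the shapes, with no control over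
  which. Inverting the summation variable exchanges the two characters, so either order
  suffices.\<close>

lemma irrep_char_orthogonal:
  assumes "la \<in> partitions" "mu \<in> partitions" and s: "sum_list mu = sum_list la" and ne: "la \<noteq> mu"
  shows "(\<Sum>x\<in>Sy (sum_list la). irrep_char la x * irrep_char mu (inv x)) = 0"
  using separated_or_separated[OF assms]
proof
  assume "\<forall>g\<in>Sy (sum_list la). separated la mu g"
  then show ?thesis using irrep_char_orthogonal_aux[OF s] by blast
next
  let ?d = "sum_list la"
  assume "\<forall>g\<in>Sy (sum_list la). separated mu la g"
  then have "(\<Sum>x\<in>Sy ?d. irrep_char mu x * irrep_char la (inv x)) = 0"
    using irrep_char_orthogonal_aux[OF s[symmetric]] s by simp
  then have "(\<Sum>x\<in>Sy ?d. irrep_char mu (inv x) * irrep_char la x) = 0"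
    using sum_Sy_inv[of "\<lambda>x. irrep_char mu (inv x) * irrep_char la x" ?d] by (simp cong: sum.cong)
  then show ?thesis by (simp add: mult.commute)
qed

text \<open>By \<open>young_unique\<close>, c u c is a multiple of c, and cycling factors in the
  identity coefficient gives the factor k c(inv u). The sum of c(u) c(inv u) over u is k once more,
  which cancels the k in \<open>sum_irrep_char_class_fun\<close>.\<close>

lemma irrep_char_norm:
  "(\<Sum>x\<in>Sy (sum_list la). irrep_char la x * irrep_char la (inv x)) = fact (sum_list la)"
proof -
  let ?d = "sum_list la" let ?c = "young_symmetrizer la" let ?k = "young_scale la"
  have G: "conv ?d ?c (conv ?d (unit_vec u) ?c) u = ?k * (?c u * ?c (inv u))" if u: "u \<in> Sy ?d" for u
  proof -
    let ?G = "conv ?d ?c (conv ?d (unit_vec u) ?c)"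
    have "?G id = conv ?d (conv ?d ?c (unit_vec u)) ?c id" by (simp add: conv_assoc)
    also have "\<dots> = conv ?d ?c (conv ?d ?c (unit_vec u)) id" by (rule conv_at_id_commute)
    also have "\<dots> = conv ?d (\<lambda>x. ?k * ?c x) (unit_vec u) id" by (simp add: conv_assoc[symmetric] young_idem)
    also have "\<dots> = ?k * ?c (inv u)" using u by (simp add: conv_unit_right)
    finally have "?G id = ?k * ?c (inv u)" .
    moreover have "?G = (\<lambda>x. ?G id * ?c x)"
      by (rule young_unique) (simp_all add: row_inv_conv row_inv_young col_alt_conv col_alt_young)
    ultimately have "?G = (\<lambda>x. (?k * ?c (inv u)) * ?c x)" by metis
    from fun_cong[OF this, of u] show ?thesis by (simp add: mult_ac)
  qed
  have "(\<Sum>y\<in>Sy ?d. ?c y * irrep_char la y) = ?k * (\<Sum>u\<in>Sy ?d. ?c u * ?c (inv u)) / ?k"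
    by (simp add: sum_young_irrep_char G sum_distrib_left cong: sum.cong)
  also have "\<dots> = ?k" unfolding conv_at_id[symmetric] young_scale_def[symmetric] by simp
  finally show ?thesis
    using young_scale_nonzero[of la] by (simp add: sum_irrep_char_class_fun class_fun_irrep_char)
qed

text \<open>The scalar by which a class function acts on the irreducible module, read off at
  \<open>id\<close>, where the symmetrizer is 1.\<close>

definition central_char :: "nat list \<Rightarrow> ((nat \<Rightarrow> nat) \<Rightarrow> complex) \<Rightarrow> complex" where
  "central_char la w = conv (sum_list la) (young_symmetrizer la) w id"

lemma conv_class_fun_commute:
  assumes "class_fun d w" shows "conv d f w = conv d w f"
proof (rule supp_eqI[of d])
  fix x assume x: "x \<in> Sy d"
  have "w (inv y \<circ> x) = w (x \<circ> inv y)" if y: "y \<in> Sy d" for y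
  proof -
    have "w (inv y \<circ> ((x \<circ> inv y) \<circ> y)) = w (x \<circ> inv y)"
      using assms Sy_comp[OF x Sy_inv[OF y]] y unfolding class_fun_def by blast
    then show ?thesis using y by (simp add: comp_assoc)
  qed
  then show "conv d f w x = conv d w f x"
    using x by (simp add: conv_altdef[of _ _ w]) (simp add: conv_def mult.commute cong: sum.cong)
qed auto

text \<open>A class function is central and may stand on either side of c. Written on the right it
  leaves the row invariance of c visible, written on the left the column alternation.\<close>

lemma young_conv_class_fun:
  assumes w: "class_fun (sum_list la) w"
  shows "conv (sum_list la) (young_symmetrizer la) w = (\<lambda>x. central_char la w * young_symmetrizer la x)"
  unfolding central_char_def
proof (rule young_unique[where f = "conv (sum_list la) (young_symmetrizer la) w"])
  show "row_inv la (conv (sum_list la) (young_symmetrizer la) w)"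
    by (intro row_inv_conv row_inv_young)
  show "col_alt la (conv (sum_list la) (young_symmetrizer la) w)"
    unfolding conv_class_fun_commute[OF w] by (intro col_alt_conv col_alt_young)
qed simp

text \<open>Reindexing by \<open>g \<circ> z\<close> transposes the convolution from
  \<open>F\<close> onto the symmetrizer, where it is a scalar.\<close>

lemma young_pairing_conv:
  assumes w: "class_fun (sum_list la) w"
  shows "(\<Sum>g\<in>Sy (sum_list la). young_symmetrizer la g * (\<Sum>z\<in>Sy (sum_list la). w z * F (g \<circ> z)))
     = central_char la w * (\<Sum>g\<in>Sy (sum_list la). young_symmetrizer la g * F g)"
proof -
  let ?d = "sum_list la" let ?c = "young_symmetrizer la"
  have "(\<Sum>g\<in>Sy ?d. ?c g * (\<Sum>z\<in>Sy ?d. w z * F (g \<circ> z))) = (\<Sum>z\<in>Sy ?d. \<Sum>g\<in>Sy ?d. ?c g * w z * F (g \<circ> z))"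
    by (subst sum.swap) (simp add: sum_distrib_left mult_ac)
  also have "\<dots> = (\<Sum>z\<in>Sy ?d. \<Sum>y\<in>Sy ?d. ?c (y \<circ> inv z) * w z * F y)"
  proof (rule sum.cong[OF refl])
    fix z assume z: "z \<in> Sy ?d"
    show "(\<Sum>g\<in>Sy ?d. ?c g * w z * F (g \<circ> z)) = (\<Sum>y\<in>Sy ?d. ?c (y \<circ> inv z) * w z * F y)"
      using sum_Sy_right[OF z, of "\<lambda>y. ?c (y \<circ> inv z) * w z * F y"] z
      by (simp add: comp_assoc)
  qed
  also have "\<dots> = (\<Sum>y\<in>Sy ?d. conv ?d ?c w y * F y)"
    by (subst sum.swap) (simp add: conv_altdef sum_distrib_right)
  also have "\<dots> = central_char la w * (\<Sum>g\<in>Sy ?d. ?c g * F g)"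
    by (simp add: young_conv_class_fun[OF w] sum_distrib_left mult_ac)
  finally show ?thesis .
qed

text \<open>A function \<open>f\<close> with fewer values than the first column has rows takes equal values at two
  boxes of that column, whose transposition reverses the sign.\<close>

lemma young_sum_invariant_eq_0:
  assumes la: "la \<in> partitions" and f: "f ` {..<sum_list la} \<subseteq> E" "finite E" "card E < length la"
  shows "(\<Sum>y\<in>Sy (sum_list la). young_symmetrizer la y * (if \<forall>m<sum_list la. f (y m) = f m then 1 else 0)) = 0"
proof -
  let ?d = "sum_list la" let ?c = "young_symmetrizer la"
  let ?I = "\<lambda>y. if \<forall>m<?d. f (y m) = f m then 1 else 0 :: complex"
  let ?C = "{m \<in> {..<?d}. col_index la m = 0}"
  have "filter_mset (\<lambda>x. 0 < x) (mset la) = mset la"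
    using la by (auto simp: partitions_def filter_mset_eq_conv intro: gr0I)
  then have "card ?C = length la" unfolding card_column by simp
  moreover have "card (f ` ?C) \<le> card E" using f by (intro card_mono) auto
  ultimately have "\<not> inj_on f ?C" using f(3) by (auto dest: card_image)
  then obtain a b where ab: "a < ?d" "b < ?d" "a \<noteq> b" "f a = f b" "col_index la a = col_index la b"
    by (auto simp: inj_on_def)
  let ?t = "Transposition.transpose a b"
  have t: "?t \<in> col_group la" using ab by (intro col_group_transpose) auto
  have tS: "?t \<in> Sy ?d" by (rule col_group_Sy[OF t])
  have ft: "f (?t m) = f m" for m using ab by (auto simp: Transposition.transpose_def)
  have I: "?I (y \<circ> ?t) = ?I y" for y
  proof -
    have "(\<forall>m<?d. f (y (?t m)) = f m) \<longleftrightarrow> (\<forall>m<?d. f (y m) = f m)"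
    proof safe
      fix m assume *: "\<forall>m<?d. f (y (?t m)) = f m" and "m < ?d"
      then have "?t m < ?d" using tS by simp
      with * have "f (y (?t (?t m))) = f (?t m)" by blast
      then show "f (y m) = f m" by (simp add: ft)
    next
      fix m assume *: "\<forall>m<?d. f (y m) = f m" and "m < ?d"
      then have "?t m < ?d" using tS by simp
      with * have "f (y (?t m)) = f (?t m)" by blast
      then show "f (y (?t m)) = f m" by (simp add: ft)
    qed
    then show ?thesis by simp
  qed
  have "?c (y \<circ> ?t) = - ?c y" if "y \<in> Sy ?d" for y
    using col_alt_young[of la] t that ab(3) by (auto simp: col_alt_def sign_swap_id)
  then have "(\<Sum>y\<in>Sy ?d. ?c y * ?I y) = - (\<Sum>y\<in>Sy ?d. ?c y * ?I y)"
    using sum_Sy_right[OF tS, of "\<lambda>y. ?c y * ?I y"] by (simp add: I sum_negf cong: sum.cong del: o_apply)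
  then show ?thesis by simp
qed

text \<open>A square matrix with orthonormal rows has orthonormal columns: the defect \<open>R\<close> of the columns
  satisfies \<open>tr R\<^sup>2 = 0\<close>.\<close>

lemma orthogonal_columns:
  fixes X :: "'i \<Rightarrow> 'j \<Rightarrow> real"
  assumes fin: "finite I" "finite J" and card: "card I = card J" and w: "\<And>j. j \<in> J \<Longrightarrow> w j > 0"
    and orth: "\<And>i i'. i \<in> I \<Longrightarrow> i' \<in> I \<Longrightarrow> (\<Sum>j\<in>J. w j * X i j * X i' j) = (if i = i' then 1 else 0)"
    and j: "j \<in> J" "j' \<in> J"
  shows "w j * (\<Sum>i\<in>I. X i j * X i j') = (if j = j' then 1 else 0)"
proof -
  define Q where "Q j j' = w j * (\<Sum>i\<in>I. X i j * X i j')" for j j'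
  define R where "R j j' = (if j = j' then 1 else 0) - Q j j'" for j j'
  have sym: "R j' j * w j = R j j' * w j'" for j j'
    by (auto simp: R_def Q_def algebra_simps)
  have trQ: "(\<Sum>j\<in>J. Q j j) = card I"
  proof -
    have "(\<Sum>j\<in>J. Q j j) = (\<Sum>i\<in>I. \<Sum>j\<in>J. w j * X i j * X i j)"
      unfolding Q_def by (subst sum.swap) (simp add: sum_distrib_left mult.assoc)
    then show ?thesis by (simp add: orth)
  qed
  have trQ2: "(\<Sum>j\<in>J. \<Sum>j'\<in>J. Q j j' * Q j' j) = card I"
  proof -
    have "(\<Sum>j\<in>J. \<Sum>j'\<in>J. Q j j' * Q j' j)
        = (\<Sum>j\<in>J. \<Sum>j'\<in>J. \<Sum>i\<in>I. \<Sum>i'\<in>I. (w j * X i j * X i' j) * (w j' * X i j' * X i' j'))"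
      unfolding Q_def by (intro sum.cong refl) (simp add: sum_product sum_distrib_left sum_distrib_right mult_ac)
    also have "\<dots> = (\<Sum>i\<in>I. \<Sum>i'\<in>I. \<Sum>j\<in>J. \<Sum>j'\<in>J. (w j * X i j * X i' j) * (w j' * X i j' * X i' j'))"
    proof -
      have sw: "(\<Sum>j\<in>J. \<Sum>j'\<in>J. \<Sum>i\<in>I. \<Sum>i'\<in>I. F j j' i i') = (\<Sum>i\<in>I. \<Sum>i'\<in>I. \<Sum>j\<in>J. \<Sum>j'\<in>J. F j j' i i')"
        for F :: "'j \<Rightarrow> 'j \<Rightarrow> 'i \<Rightarrow> 'i \<Rightarrow> real"
        unfolding sum.cartesian_product
        by (rule sum.reindex_bij_witness[where i = "\<lambda>(i, i', j, j'). (j, j', i, i')" and j = "\<lambda>(j, j', i, i'). (i, i', j, j')"]) auto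
      show ?thesis by (rule sw)
    qed
    also have "\<dots> = (\<Sum>i\<in>I. \<Sum>i'\<in>I. (\<Sum>j\<in>J. w j * X i j * X i' j) * (\<Sum>j'\<in>J. w j' * X i j' * X i' j'))"
      by (simp add: sum_product)
    also have "\<dots> = (\<Sum>i\<in>I. \<Sum>i'\<in>I. if i = i' then 1 else 0)"
      by (intro sum.cong refl) (simp add: orth)
    finally show ?thesis using fin by simp
  qed
  have "(\<Sum>j\<in>J. \<Sum>j'\<in>J. R j j' * R j' j)
      = (\<Sum>j\<in>J. \<Sum>j'\<in>J. (if j = j' then 1 - 2 * Q j j else 0) + Q j j' * Q j' j)"
    by (intro sum.cong refl) (auto simp: R_def algebra_simps)
  \<comment> \<open>The value is card J - 2 card I + card I, so it is here that the matrix has to be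
    square.\<close>
  also have "\<dots> = 0"
    using fin trQ trQ2 card by (simp add: sum.distrib sum_subtractf flip: sum_distrib_left)
  finally have tr: "(\<Sum>j\<in>J. \<Sum>j'\<in>J. R j j' * R j' j) = 0" .
  \<comment> \<open>By \<open>sym\<close>, \<open>R\<close> is self-adjoint for the weights
    \<open>w\<close>. Every summand of the trace is thus a square with a positive weight, and a zero
    trace kills all entries.\<close>
  have pos: "R j j' * R j' j = (R j j')\<^sup>2 * w j' / w j" if "j \<in> J" for j j'
  proof -
    have "R j' j = R j j' * w j' / w j" using sym[of j' j] w[OF that] by (simp add: field_simps)
    then show ?thesis by (simp add: power2_eq_square)
  qed
  have nn: "R j j' * R j' j \<ge> 0" if "j \<in> J" "j' \<in> J" for j j'
    unfolding pos[OF that(1)] using w that by (simp add: less_imp_le)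
  have "(\<Sum>j'\<in>J. R j j' * R j' j) = 0"
    using tr j fin nn by (subst (asm) sum_nonneg_eq_0_iff) (auto intro!: sum_nonneg)
  then have "R j j' * R j' j = 0"
    using j fin nn by (subst (asm) sum_nonneg_eq_0_iff) auto
  then have "R j j' = 0" using pos[OF j(1), of j'] w[OF j(1)] w[OF j(2)] by simp
  then show ?thesis by (simp add: R_def Q_def)
qed

section \<open>Cycle types and conjugacy\<close>

lemma Sy_orbit_self: "g \<in> Sy d \<Longrightarrow> x \<in> orbit g x"
  by (simp add: Sy_permutation permutation_self_in_orbit)

lemma Sy_orbit_eq: "g \<in> Sy d \<Longrightarrow> y \<in> orbit g x \<Longrightarrow> orbit g y = orbit g x"
  by (rule orbit_cyclic_eq3[OF cyclic_on_orbit'[OF Sy_permutation]])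

lemma Sy_orbit_subset: "g \<in> Sy d \<Longrightarrow> x < d \<Longrightarrow> orbit g x \<subseteq> {..<d}"
  using permutes_orbit_subset[of g "{..<d}" x] by (simp add: Sy_def)

lemma Sy_finite_orbit: "g \<in> Sy d \<Longrightarrow> x < d \<Longrightarrow> finite (orbit g x)"
  by (rule finite_subset[OF Sy_orbit_subset]) auto

lemma orbit_subset_closed:
  assumes "x \<in> C" "\<And>y. y \<in> C \<Longrightarrow> f y \<in> C" shows "orbit f x \<subseteq> C"
proof
  fix y assume "y \<in> orbit f x" then show "y \<in> C" by induct (use assms in auto)
qed

lemma cycle_type_inv: "g \<in> Sy d \<Longrightarrow> cycle_type d (inv g) = cycle_type d g"
  by (simp add: cycle_type_def orbit_inv_eq[OF Sy_permutation])

lemma orbit_conj: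
  assumes h: "h \<in> Sy d"
  shows "orbit (inv h \<circ> (g \<circ> h)) x = inv h ` orbit g (h x)"
proof -
  have "((inv h \<circ> (g \<circ> h)) ^^ n) = inv h \<circ> ((g ^^ n) \<circ> h)" for n
    using h by (induction n) (simp_all add: comp_assoc)
  then show ?thesis by (auto simp: orbit_altdef)
qed

lemma cycle_type_conj:
  assumes g: "g \<in> Sy d" and h: "h \<in> Sy d"
  shows "cycle_type d (inv h \<circ> (g \<circ> h)) = cycle_type d g"
proof -
  have "orbit (inv h \<circ> (g \<circ> h)) ` {..<d} = (\<lambda>x. inv h ` orbit g (h x)) ` {..<d}"
    by (simp add: orbit_conj[OF h])
  also have "\<dots> = (`) (inv h) ` orbit g ` h ` {..<d}" by (simp add: image_image)
  also have "h ` {..<d} = {..<d}" using h by (auto simp: Sy_def permutes_image)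
  finally have im: "orbit (inv h \<circ> (g \<circ> h)) ` {..<d} = (`) (inv h) ` orbit g ` {..<d}" .
  have inj: "inj ((`) (inv h))" using Sy_bij[OF Sy_inv[OF h]] by (simp add: bij_is_inj inj_def[of "(`) (inv h)"] inj_image_eq_iff)
  have ms: "mset_set ((`) (inv h) ` orbit g ` {..<d}) = image_mset ((`) (inv h)) (mset_set (orbit g ` {..<d}))"
    by (rule image_mset_mset_set[symmetric], rule inj_on_subset[OF inj]) simp
  have "card (inv h ` A) = card A" for A
    using Sy_bij[OF Sy_inv[OF h]] by (metis bij_is_inj card_image inj_on_subset subset_UNIV)
  then show ?thesis
    unfolding cycle_type_def im ms by (simp add: image_mset.compositionality o_def)
qed

text \<open>Both cycles are parametrized by powers up to the common period, and the m-th iterates of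
  \<open>x\<close> and \<open>y\<close> are matched. Equivariance is formal except at the last
  index, where both cycles close up.\<close>

lemma orbit_conjugation:
  assumes g: "permutation g" and g': "permutation g'" and c: "card (orbit g x) = card (orbit g' y)"
  shows "\<exists>h. bij_betw h (orbit g x) (orbit g' y) \<and> (\<forall>z\<in>orbit g x. h (g z) = g' (h z))"
proof -
  have s: "x \<in> orbit g x" and s': "y \<in> orbit g' y"
    using g g' by (simp_all add: permutation_self_in_orbit)
  let ?n = "funpow_dist1 g x x"
  have bij: "bij_betw (\<lambda>n. (f ^^ n) u) {0..<funpow_dist1 f u u} (orbit f u)" if "u \<in> orbit f u" for f :: "'c \<Rightarrow> 'c" and u
    unfolding bij_betw_def using inj_on_funpow_dist1[OF that] orbit_conv_funpow_dist1[OF that] by simp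
  have n': "funpow_dist1 g' y y = ?n"
    using bij_betw_same_card[OF bij[OF s]] bij_betw_same_card[OF bij[OF s']] c by simp
  have b: "bij_betw (\<lambda>n. (g ^^ n) x) {0..<?n} (orbit g x)" by (rule bij[OF s])
  have b': "bij_betw (\<lambda>n. (g' ^^ n) y) {0..<?n} (orbit g' y)" using bij[OF s'] n' by simp
  have per: "(g ^^ ?n) x = x" "(g' ^^ ?n) y = y"
    using funpow_dist1_prop[OF s] funpow_dist1_prop[OF s'] n' by simp_all
  define i where "i = inv_into {0..<?n} (\<lambda>n. (g ^^ n) x)"
  define h where "h = (\<lambda>n. (g' ^^ n) y) \<circ> i"
  have hn: "h ((g ^^ m) x) = (g' ^^ m) y" if "m < ?n" for m
    using bij_betw_inv_into_left[OF b, of m] that by (simp add: h_def i_def)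
  have "bij_betw h (orbit g x) (orbit g' y)"
    unfolding h_def i_def by (rule bij_betw_trans[OF bij_betw_inv_into[OF b] b'])
  moreover have "h (g z) = g' (h z)" if z: "z \<in> orbit g x" for z
  proof -
    obtain m where m: "m < ?n" "z = (g ^^ m) x"
      using z unfolding bij_betw_imp_surj_on[OF b, symmetric] by auto
    show ?thesis
    proof (cases "Suc m < ?n")
      case True
      then show ?thesis using hn[OF True] hn[OF m(1)] m(2) by simp
    next
      case False
      then have "Suc m = ?n" using m(1) by simp
      moreover have "h x = y" using hn[of 0] by simp
      ultimately have "h (g z) = y" "g' (h z) = y"
        using per hn[OF m(1)] m(2) by (metis funpow.simps(2) o_apply)+
      then show ?thesis by simp
    qed
  qed
  ultimately show ?thesis by blast
qed

lemma conjugate_if_same_orbit_sizes: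
  fixes g :: "'a \<Rightarrow> 'a" and g' :: "'b \<Rightarrow> 'b"
  assumes g: "permutation g" and g': "permutation g'"
  shows "finite S \<Longrightarrow> finite S' \<Longrightarrow> g ` S \<subseteq> S \<Longrightarrow> g' ` S' \<subseteq> S' \<Longrightarrow>
    image_mset card (mset_set (orbit g ` S)) = image_mset card (mset_set (orbit g' ` S')) \<Longrightarrow>
    \<exists>h. bij_betw h S S' \<and> (\<forall>x\<in>S. h (g x) = g' (h x))"
proof (induction "card S" arbitrary: S S' rule: less_induct)
  case less
  have eqv: "orbit f z = orbit f u" if "permutation f" "z \<in> orbit f u" for f :: "'c \<Rightarrow> 'c" and z u
    using orbit_cyclic_eq3[OF cyclic_on_orbit'[OF that(1)] that(2)] .
  show ?case
  proof (cases "S = {}")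
    case True
    then have "S' = {}" using less.prems(2,5) by (auto simp: mset_set_empty_iff)
    then show ?thesis using True by (auto simp: bij_betw_def)
  next
    case False
    then obtain x where x: "x \<in> S" by auto
    let ?O = "orbit g x"
    have "card ?O \<in># image_mset card (mset_set (orbit g' ` S'))"
      using x less.prems(1) unfolding less.prems(5)[symmetric] by auto
    then obtain y where y: "y \<in> S'" "card ?O = card (orbit g' y)" using less.prems(2) by auto
    let ?O' = "orbit g' y"
    obtain h1 where h1: "bij_betw h1 ?O ?O'" "\<forall>z\<in>?O. h1 (g z) = g' (h1 z)"
      using orbit_conjugation[OF g g' y(2)] by blast
    have sub: "?O \<subseteq> S"
      by (rule orbit_subset_closed[OF x]) (use less.prems in auto)
    have sub': "?O' \<subseteq> S'"
      by (rule orbit_subset_closed[OF y(1)]) (use less.prems in auto)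
    have self: "x \<in> ?O" "y \<in> ?O'" using g g' by (simp_all add: permutation_self_in_orbit)
    have closed: "f ` (T - orbit f u) \<subseteq> T - orbit f u"
      and im: "orbit f ` (T - orbit f u) = orbit f ` T - {orbit f u}"
      if f: "permutation f" and T: "f ` T \<subseteq> T" for f :: "'c \<Rightarrow> 'c" and T u
    proof -
      have *: "z \<in> orbit f u" if "orbit f z = orbit f u" for z
        using that f by (metis permutation_self_in_orbit)
      have "z \<in> orbit f u" if "f z \<in> orbit f u" for z
      proof -
        have "f z \<in> orbit f z" by (rule orbit.base)
        then have "orbit f z = orbit f u" using eqv[OF f] that by metis
        then show ?thesis by (rule *)
      qed
      then show "f ` (T - orbit f u) \<subseteq> T - orbit f u" using T by auto
      show "orbit f ` (T - orbit f u) = orbit f ` T - {orbit f u}"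
        using * eqv[OF f] by auto
    qed
    have ms: "image_mset card (mset_set (orbit f ` (T - orbit f u)))
       = image_mset card (mset_set (orbit f ` T)) - {#card (orbit f u)#}"
      if f: "permutation f" and T: "f ` T \<subseteq> T" "finite T" "u \<in> T" for f :: "'c \<Rightarrow> 'c" and T u
      unfolding im[OF f T(1)] using T(2,3) by (simp add: mset_set_Diff image_mset_Diff)
    have "card (S - ?O) < card S"
      using less.prems(1) sub self by (intro psubset_card_mono) auto
    from less.hyps[OF this _ _ closed[OF g less.prems(3)] closed[OF g' less.prems(4)]]
    have "\<exists>h. bij_betw h (S - ?O) (S' - ?O') \<and> (\<forall>z\<in>S - ?O. h (g z) = g' (h z))"
      using less.prems ms[OF g less.prems(3) less.prems(1) x] ms[OF g' less.prems(4) less.prems(2) y(1)] y(2)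
      by simp
    then obtain h2 where h2: "bij_betw h2 (S - ?O) (S' - ?O')" "\<forall>z\<in>S - ?O. h2 (g z) = g' (h2 z)" by blast
    define h where "h z = (if z \<in> ?O then h1 z else h2 z)" for z
    have "bij_betw h ?O ?O'" using h1(1) by (rule bij_betw_cong[THEN iffD1, rotated]) (simp add: h_def)
    moreover have "bij_betw h (S - ?O) (S' - ?O')"
      using h2(1) by (rule bij_betw_cong[THEN iffD1, rotated]) (simp add: h_def)
    ultimately have "bij_betw h (?O \<union> (S - ?O)) (?O' \<union> (S' - ?O'))"
      by (rule bij_betw_combine) auto
    then have "bij_betw h S S'" using sub sub' by (simp add: Un_absorb1)
    moreover have "h (g z) = g' (h z)" if z: "z \<in> S" for z
    proof (cases "z \<in> ?O")
      case True
      then have "g z \<in> ?O" by (rule orbit.step)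
      then show ?thesis using True h1(2) by (simp add: h_def)
    next
      case False
      then have "g z \<notin> ?O" using closed[OF g less.prems(3), of x] z by auto
      then show ?thesis using False h2(2) z by (simp add: h_def)
    qed
    ultimately show ?thesis by blast
  qed
qed

lemma conjugate_if_cycle_type_eq:
  assumes g: "g \<in> Sy d" and g': "g' \<in> Sy d" and ct: "cycle_type d g = cycle_type d g'"
  shows "\<exists>h\<in>Sy d. g = inv h \<circ> (g' \<circ> h)"
proof -
  have "g ` {..<d} \<subseteq> {..<d}" "g' ` {..<d} \<subseteq> {..<d}" using g g' by auto
  then obtain h0 where h0: "bij_betw h0 {..<d} {..<d}" "\<forall>x\<in>{..<d}. h0 (g x) = g' (h0 x)"
    using conjugate_if_same_orbit_sizes[OF Sy_permutation[OF g] Sy_permutation[OF g'], of "{..<d}" "{..<d}"] ct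
    by (auto simp: cycle_type_def)
  define h where "h x = (if x < d then h0 x else x)" for x
  have "bij_betw h {..<d} {..<d}" using h0(1) by (rule bij_betw_cong[THEN iffD1, rotated]) (simp add: h_def)
  then have "h permutes {..<d}" by (rule bij_imp_permutes) (simp add: h_def)
  then have h: "h \<in> Sy d" by (simp add: Sy_def)
  have "h \<circ> g = g' \<circ> h"
  proof
    fix x
    show "(h \<circ> g) x = (g' \<circ> h) x"
    proof (cases "x < d")
      case True
      then show ?thesis using h0(2) g by (simp add: h_def)
    next
      case False
      then show ?thesis using g g' by (simp add: h_def Sy_def permutes_not_in)
    qed
  qed
  then have "g = inv h \<circ> (g' \<circ> h)" using h by (metis Sy_cancel(4))
  then show ?thesis using h by blast
qed

lemma class_fun_cycle_type:
  assumes "class_fun d f" "g \<in> Sy d" "g' \<in> Sy d" "cycle_type d g = cycle_type d g'"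
  shows "f g = f g'"
  using conjugate_if_cycle_type_eq[OF assms(2-4)] assms(1,3) unfolding class_fun_def by auto

lemma class_fun_of_cycle_type: "class_fun d (\<lambda>g. F (cycle_type d g))"
  by (simp add: class_fun_def cycle_type_conj)

section \<open>Inserting a point into a cycle\<close>

text \<open>Puts the new letter \<open>d\<close> just before \<open>k\<close> in its cycle, or makes
  it a fixed point if \<open>k = d\<close>. These are coset representatives: each permutation of d +
  1 letters arises exactly once, which permits induction over \<open>d\<close>.\<close>

definition insert_pt :: "nat \<Rightarrow> nat \<Rightarrow> (nat \<Rightarrow> nat) \<Rightarrow> nat \<Rightarrow> nat" where
  "insert_pt d k g = Transposition.transpose d k \<circ> g"

lemma insert_pt_Sy: "g \<in> Sy d \<Longrightarrow> k \<le> d \<Longrightarrow> insert_pt d k g \<in> Sy (Suc d)"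
proof -
  assume "g \<in> Sy d" "k \<le> d"
  then have "g permutes {..<Suc d}" by (auto simp: Sy_def intro: permutes_subset)
  moreover have "Transposition.transpose d k permutes {..<Suc d}" using \<open>k \<le> d\<close> by (intro permutes_swap_id) auto
  ultimately show ?thesis unfolding Sy_def mem_Collect_eq insert_pt_def by (rule permutes_compose)
qed

lemma sum_Sy_Suc:
  "(\<Sum>x\<in>Sy (Suc d). f x) = (\<Sum>g\<in>Sy d. \<Sum>k\<le>d. f (insert_pt d k g))"
proof -
  let ?T = "\<lambda>k g. Transposition.transpose d k \<circ> g"
  have fix_d: "g d = d" if "g \<in> Sy d" for g using that by (simp add: Sy_def permutes_not_in)
  have mem: "?T k g \<in> Sy (Suc d)" if "g \<in> Sy d" "k \<le> d" for k g
    using insert_pt_Sy[OF that] by (simp add: insert_pt_def)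
  have ins: "insert d {..<d} = {..<Suc d}" by auto
  have tt: "Transposition.transpose d k \<circ> (Transposition.transpose d k \<circ> p) = p" for k p
    by (simp add: fun_eq_iff)
  have low: "?T (x d) x \<in> Sy d" if "x \<in> Sy (Suc d)" for x
    using permutes_insert_lemma[of x d "{..<d}"] that unfolding ins by (simp add: Sy_def)
  have le: "x d \<le> d" if "x \<in> Sy (Suc d)" for x
    using Sy_lt_iff[OF that, of d] by simp
  have "(\<Sum>x\<in>Sy (Suc d). f x) = (\<Sum>(g, k)\<in>Sy d \<times> {..d}. f (insert_pt d k g))"
    unfolding insert_pt_def
    by (rule sum.reindex_bij_witness[where i = "\<lambda>(g, k). ?T k g" and j = "\<lambda>x. (?T (x d) x, x d)"])
       (use mem low le in \<open>auto simp: tt fix_d\<close>)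
  then show ?thesis by (simp add: sum.cartesian_product)
qed

lemma insert_pt_apply:
  assumes "g \<in> Sy d" "k < d"
  shows "insert_pt d k g d = k" "g x = k \<Longrightarrow> insert_pt d k g x = d"
    "g x \<noteq> k \<Longrightarrow> x \<noteq> d \<Longrightarrow> insert_pt d k g x = g x"
proof -
  have d: "g d = d" using assms by (simp add: Sy_def permutes_not_in)
  have inj: "g x = g d \<Longrightarrow> x = d" for x using Sy_bij[OF assms(1)] by (simp add: bij_is_inj inj_eq)
  show "insert_pt d k g d = k" by (simp add: insert_pt_def d)
  show "g x = k \<Longrightarrow> insert_pt d k g x = d" by (simp add: insert_pt_def)
  show "g x \<noteq> k \<Longrightarrow> x \<noteq> d \<Longrightarrow> insert_pt d k g x = g x"
    using inj[of x] d by (auto simp: insert_pt_def Transposition.transpose_def)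
qed

lemma insert_pt_same: "insert_pt d d g = g"
  by (simp add: insert_pt_def)

lemma orbit_insert_pt:
  assumes g: "g \<in> Sy d" and k: "k < d"
  shows "orbit (insert_pt d k g) d = insert d (orbit g k)"
    and "x \<in> orbit g k \<Longrightarrow> orbit (insert_pt d k g) x = insert d (orbit g k)"
    and "x < d \<Longrightarrow> x \<notin> orbit g k \<Longrightarrow> orbit (insert_pt d k g) x = orbit g x"
proof -
  let ?g = "insert_pt d k g"
  note app = insert_pt_apply[OF g k]
  have gS: "?g \<in> Sy (Suc d)" using insert_pt_Sy[OF g] k by simp
  have d: "g d = d" using g by (simp add: Sy_def permutes_not_in)
  have kk: "k \<in> orbit g k" by (rule Sy_orbit_self[OF g])
  have sub: "orbit g k \<subseteq> {..<d}" by (rule Sy_orbit_subset[OF g k])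
  have 1: "orbit ?g d \<subseteq> insert d (orbit g k)"
  proof (rule orbit_subset_closed)
    fix y assume y: "y \<in> insert d (orbit g k)"
    show "?g y \<in> insert d (orbit g k)"
    proof (cases "y = d \<or> g y = k")
      case False
      then show ?thesis using y app(3) by (auto intro: orbit.step)
    qed (use app kk in auto)
  qed simp
  have dd: "d \<in> orbit ?g d" by (rule Sy_orbit_self[OF gS])
  have kin: "k \<in> orbit ?g d" using orbit.base[of ?g d] app(1) by simp
  have "orbit g k \<subseteq> {y \<in> orbit ?g d. y < d}"
  proof (rule orbit_subset_closed)
    fix y assume y: "y \<in> {y \<in> orbit ?g d. y < d}"
    have "g y \<in> orbit ?g d"
    proof (cases "g y = k")
      case False
      then have "?g y = g y" using app(3) y by simp
      moreover have "?g y \<in> orbit ?g d" using y by (simp add: orbit.step)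
      ultimately show ?thesis by simp
    qed (use kin in simp)
    then show "g y \<in> {y \<in> orbit ?g d. y < d}" using y g by simp
  qed (use kin k in simp)
  then show 2: "orbit ?g d = insert d (orbit g k)" using 1 dd by auto
  show "orbit ?g x = insert d (orbit g k)" if "x \<in> orbit g k"
    using Sy_orbit_eq[OF gS, of x d] 2 that by simp
  assume x: "x < d" "x \<notin> orbit g k"
  show "orbit ?g x = orbit g x"
  proof (rule orbit_cong[OF Sy_orbit_self[OF g]])
    fix s assume s: "s \<in> orbit g x"
    have "g s \<noteq> k"
    proof
      assume "g s = k"
      then have "k \<in> orbit g x" using orbit.step[OF s] by simp
      then have "orbit g k = orbit g x" by (rule Sy_orbit_eq[OF g])
      then show False using x Sy_orbit_self[OF g, of x] by simp
    qed
    moreover have "s \<noteq> d" using Sy_orbit_subset[OF g x(1)] s by auto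
    ultimately show "?g s = g s" by (rule app(3))
  qed
qed

lemma orbits_insert_pt:
  assumes g: "g \<in> Sy d" and k: "k < d"
  shows "orbit (insert_pt d k g) ` {..<Suc d} = insert (insert d (orbit g k)) (orbit g ` {..<d} - {orbit g k})"
proof -
  let ?g = "insert_pt d k g"
  have sub: "orbit g k \<subseteq> {..<d}" by (rule Sy_orbit_subset[OF g k])
  have "{..<Suc d} = insert d (orbit g k) \<union> ({..<d} - orbit g k)" using sub by auto
  then have "orbit ?g ` {..<Suc d} = orbit ?g ` insert d (orbit g k) \<union> orbit ?g ` ({..<d} - orbit g k)"
    by (simp only: image_Un)
  also have "orbit ?g ` insert d (orbit g k) = {insert d (orbit g k)}"
    using orbit_insert_pt[OF g k] by auto
  also have "orbit ?g ` ({..<d} - orbit g k) = orbit g ` ({..<d} - orbit g k)"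
    using orbit_insert_pt(3)[OF g k] by (intro image_cong) auto
  also have "\<dots> = orbit g ` {..<d} - {orbit g k}"
    using Sy_orbit_eq[OF g] Sy_orbit_self[OF g] by blast
  finally show ?thesis by simp
qed

lemma orbits_insert_pt_same:
  assumes g: "g \<in> Sy d"
  shows "orbit g ` {..<Suc d} = insert {d} (orbit g ` {..<d})"
proof -
  have "orbit g d = {d}" using g by (simp add: orbit_eq_singleton_iff Sy_def permutes_not_in)
  then show ?thesis by (simp add: lessThan_Suc)
qed

lemma not_in_orbit: "g \<in> Sy d \<Longrightarrow> A \<in> orbit g ` {..<d} \<Longrightarrow> d \<notin> A"
  using Sy_orbit_subset by fastforce

lemma cycle_type_insert_pt:
  assumes g: "g \<in> Sy d" and k: "k < d"
  shows "cycle_type (Suc d) (insert_pt d k g) =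
    cycle_type d g - {#card (orbit g k)#} + {#Suc (card (orbit g k))#}"
proof -
  have "insert d (orbit g k) \<notin> orbit g ` {..<d} - {orbit g k}" using not_in_orbit[OF g] by auto
  moreover have "d \<notin> orbit g k" using not_in_orbit[OF g, of "orbit g k"] k by auto
  ultimately show ?thesis
    unfolding cycle_type_def orbits_insert_pt[OF g k] using Sy_finite_orbit[OF g k] k
    by (simp add: mset_set_Diff image_mset_Diff)
qed

lemma cycle_type_insert_pt_same:
  assumes g: "g \<in> Sy d" shows "cycle_type (Suc d) g = cycle_type d g + {#1#}"
proof -
  have "{d} \<notin> orbit g ` {..<d}" using not_in_orbit[OF g] by auto
  then show ?thesis unfolding cycle_type_def orbits_insert_pt_same[OF g] by simp
qed

section \<open>Class sizes by means of partitions with a marked part\<close>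

lemma sum_mset_eq_sum_count:
  "(\<Sum>x\<in>#M. f x) = (\<Sum>x\<in>set_mset M. of_nat (count M x) * f x)" for f :: "'a \<Rightarrow> 'b::comm_semiring_1"
proof -
  have "(\<Sum>x\<in>#M. f x) = (\<Sum>x\<in>A. of_nat (count M x) * f x)" if "finite A" "set_mset M \<subseteq> A" for A
    using that(2)
  proof (induction M)
    case (add y M)
    then have y: "y \<in> A" by simp
    have "(\<Sum>x\<in>A. of_nat (count (add_mset y M) x) * f x)
        = (\<Sum>x\<in>A. of_nat (count M x) * f x + (if x = y then f y else 0))"
      by (intro sum.cong refl) (auto simp: algebra_simps)
    then show ?case using add y that(1) by (simp add: sum.distrib add.commute)
  qed simp
  then show ?thesis by blast
qed

definition mparts :: "nat \<Rightarrow> nat multiset set" where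
  "mparts d = {M. 0 \<notin># M \<and> sum_mset M = d}"

definition z_mset :: "nat multiset \<Rightarrow> nat" where
  "z_mset M = (\<Prod>i\<in>set_mset M. fact (count M i) * i ^ count M i)"

lemma z_part_eq: "z_part mu = z_mset (mset mu)"
  by (simp add: z_part_def z_mset_def count_mset)

lemma z_mset_superset:
  assumes "finite A" "set_mset M \<subseteq> A"
  shows "z_mset M = (\<Prod>i\<in>A. fact (count M i) * i ^ count M i)"
  unfolding z_mset_def using assms by (intro prod.mono_neutral_left) (auto simp: not_in_iff)

lemma z_mset_add: "z_mset (add_mset t M) = z_mset M * (t * Suc (count M t))"
proof -
  let ?A = "insert t (set_mset M)" let ?B = "?A - {t}"
  have "z_mset (add_mset t M) = (\<Prod>i\<in>?A. fact (count (add_mset t M) i) * i ^ count (add_mset t M) i)"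
    by (rule z_mset_superset) auto
  also have "\<dots> = (fact (Suc (count M t)) * t ^ Suc (count M t)) * (\<Prod>i\<in>?B. fact (count M i) * i ^ count M i)"
    by (subst prod.remove[of ?A t]) auto
  also have "\<dots> = (t * Suc (count M t)) * ((fact (count M t) * t ^ count M t) * (\<Prod>i\<in>?B. fact (count M i) * i ^ count M i))"
    by (simp add: algebra_simps)
  also have "(fact (count M t) * t ^ count M t) * (\<Prod>i\<in>?B. fact (count M i) * i ^ count M i)
      = (\<Prod>i\<in>?A. fact (count M i) * i ^ count M i)"
    by (subst prod.remove[of ?A t]) auto
  also have "\<dots> = z_mset M" by (rule z_mset_superset[symmetric]) auto
  finally show ?thesis by simp
qed

lemma z_mset_pos: "0 \<notin># M \<Longrightarrow> z_mset M > 0"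
  unfolding z_mset_def by (intro prod_pos) (auto intro: gr0I)

lemma bij_mset_partitions: "bij_betw mset (partitions_of d) (mparts d)"
proof (rule bij_betwI[where g = "\<lambda>M. rev (sorted_list_of_multiset M)"])
  show "mset \<in> partitions_of d \<rightarrow> mparts d"
    by (auto simp: partitions_of_def partitions_def mparts_def sum_mset_sum_list)
  show "(\<lambda>M. rev (sorted_list_of_multiset M)) \<in> mparts d \<rightarrow> partitions_of d"
  proof
    fix M assume M: "M \<in> mparts d"
    let ?l = "sorted_list_of_multiset M"
    have "sum_list ?l = sum_mset (mset ?l)" by (rule sum_mset_sum_list[symmetric])
    then have "sum_list (rev ?l) = d" using M by (simp add: mparts_def)
    moreover have "0 \<notin> set ?l" using M by (simp add: mparts_def)
    ultimately show "rev ?l \<in> partitions_of d"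
      by (simp add: partitions_of_def partitions_def sorted_wrt_rev)
  qed
  show "rev (sorted_list_of_multiset (mset x)) = x" if "x \<in> partitions_of d" for x
  proof -
    have "sorted (rev x)" using that by (simp add: partitions_of_def partitions_def sorted_wrt_rev)
    then have "sort x = rev x" using properties_for_sort[of "rev x" x] by simp
    then show ?thesis by simp
  qed
qed simp

lemma finite_mparts [simp]: "finite (mparts d)"
proof -
  have "mparts d \<subseteq> mset ` {xs. set xs \<subseteq> {..d} \<and> length xs \<le> d}"
  proof
    fix M assume M: "M \<in> mparts d"
    obtain xs where xs: "M = mset xs" by (metis ex_mset)
    with M have s: "sum_list xs = d" "0 \<notin> set xs" by (auto simp: mparts_def sum_mset_sum_list)
    have "length ys \<le> sum_list ys" if "0 \<notin> set ys" for ys :: "nat list"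
      using that by (induction ys) auto
    then have "length xs \<le> d" using s by metis
    moreover have "set xs \<subseteq> {..d}" using member_le_sum_list[of _ xs] s(1) by auto
    ultimately show "M \<in> mset ` {xs. set xs \<subseteq> {..d} \<and> length xs \<le> d}" using xs by blast
  qed
  then show ?thesis using finite_lists_length_le[of "{..d}" d] by (meson finite_atMost finite_imageI finite_subset)
qed

lemma finite_partitions_of [simp]: "finite (partitions_of d)"
  using bij_betw_finite[OF bij_mset_partitions] by simp

definition marked_parts :: "nat \<Rightarrow> (nat multiset \<times> nat) set" where
  "marked_parts d = {(B, s). 0 \<notin># B \<and> 0 < s \<and> sum_mset B + s = d}"

text \<open>By \<open>z_mset_add\<close>, restoring a part \<open>s\<close> multiplies
  \<open>z_mset\<close> by \<open>s\<close> times its new multiplicity, which is exactly the weight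
  on the left. In the marked form, sums over partitions of \<open>d\<close> and of
  \<open>Suc d\<close> become comparable.\<close>

lemma sum_marked_parts:
  fixes H :: "nat multiset \<Rightarrow> nat \<Rightarrow> complex"
  shows "(\<Sum>M\<in>mparts d. (\<Sum>s\<in>set_mset M. of_nat (s * count M s) * H (M - {#s#}) s) / of_nat (z_mset M))
    = (\<Sum>(B, s)\<in>marked_parts d. H B s / of_nat (z_mset B))"
proof -
  have "(\<Sum>M\<in>mparts d. (\<Sum>s\<in>set_mset M. of_nat (s * count M s) * H (M - {#s#}) s) / of_nat (z_mset M))
      = (\<Sum>(M, s)\<in>(SIGMA M:mparts d. set_mset M). of_nat (s * count M s) * H (M - {#s#}) s / of_nat (z_mset M))"
    by (simp add: sum.Sigma sum_divide_distrib)
  also have "\<dots> = (\<Sum>(B, s)\<in>marked_parts d. H B s / of_nat (z_mset B))"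
  proof (rule sum.reindex_bij_witness[where i = "\<lambda>(B, s). (add_mset s B, s)" and j = "\<lambda>(M, s). (M - {#s#}, s)"], goal_cases)
    case (2 a)
    then obtain M s where a: "a = (M, s)" "M \<in> mparts d" "s \<in># M" by auto
    then obtain B where M: "M = add_mset s B" by (metis insert_DiffM)
    then have "s \<noteq> 0" "0 \<notin># B" "sum_mset B + s = d" using a(2) by (auto simp: mparts_def)
    then show ?case using a(1) M by (simp add: marked_parts_def)
  next
    case (5 a)
    then obtain M s where a: "a = (M, s)" "M \<in> mparts d" "s \<in># M" by auto
    define B where "B = M - {#s#}"
    have M: "M = add_mset s B" using a by (simp add: B_def)
    have "s \<noteq> 0" "0 \<notin># B" using a(2) M by (auto simp: mparts_def)
    then have "of_nat (s * count M s) / complex_of_nat (z_mset M) = 1 / of_nat (z_mset B)"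
    proof -
      have "of_nat q / complex_of_nat (z_mset B * q) = 1 / of_nat (z_mset B)" if "q \<noteq> 0" for q
        using that by simp
      from this[of "s * Suc (count B s)"] \<open>s \<noteq> 0\<close> show ?thesis unfolding M z_mset_add by simp
    qed
    moreover have "M - {#s#} = B" by (simp add: B_def)
    ultimately have "of_nat (s * count M s) * H (M - {#s#}) s / of_nat (z_mset M) = H B s / of_nat (z_mset B)"
      by (metis (no_types, lifting) mult_1 times_divide_eq_left)
    then show ?case using a(1) \<open>M - {#s#} = B\<close> by simp
  qed (auto simp: marked_parts_def mparts_def)
  finally show ?thesis .
qed

lemma Sy_orbit_fibre:
  assumes g: "g \<in> Sy d" and O: "C \<in> orbit g ` {..<d}"
  shows "{k \<in> {..<d}. orbit g k = C} = C"
proof -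
  obtain x where x: "x < d" "C = orbit g x" using O by auto
  show ?thesis
    using Sy_orbit_subset[OF g x(1)] Sy_orbit_eq[OF g, of _ x] Sy_orbit_self[OF g] unfolding x(2) by blast
qed

lemma sum_orbit_card:
  fixes phi :: "nat \<Rightarrow> 'b::comm_semiring_1"
  assumes g: "g \<in> Sy d"
  shows "(\<Sum>k<d. phi (card (orbit g k))) = (\<Sum>s\<in>set_mset (cycle_type d g). of_nat (s * count (cycle_type d g) s) * phi s)"
proof -
  have "(\<Sum>k<d. phi (card (orbit g k))) = (\<Sum>C\<in>orbit g ` {..<d}. \<Sum>k\<in>{k \<in> {..<d}. orbit g k = C}. phi (card (orbit g k)))"
    by (rule sum.image_gen) simp
  also have "\<dots> = (\<Sum>C\<in>orbit g ` {..<d}. of_nat (card C) * phi (card C))"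
  proof (rule sum.cong[OF refl])
    fix C assume C: "C \<in> orbit g ` {..<d}"
    have "(\<Sum>k\<in>{k \<in> {..<d}. orbit g k = C}. phi (card (orbit g k))) = (\<Sum>k\<in>{k \<in> {..<d}. orbit g k = C}. phi (card C))"
      by (rule sum.cong) auto
    then show "(\<Sum>k\<in>{k \<in> {..<d}. orbit g k = C}. phi (card (orbit g k))) = of_nat (card C) * phi (card C)"
      unfolding Sy_orbit_fibre[OF g C] by simp
  qed
  also have "\<dots> = (\<Sum>s\<in>#cycle_type d g. of_nat s * phi s)"
    by (simp add: cycle_type_def sum_unfold_sum_mset image_mset.compositionality o_def)
  finally show ?thesis by (simp add: sum_mset_eq_sum_count mult_ac)
qed

lemma cycle_type_mparts:
  assumes g: "g \<in> Sy d" shows "cycle_type d g \<in> mparts d"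
proof -
  have "0 \<notin># cycle_type d g"
    using Sy_finite_orbit[OF g] orbit_nonempty[of g] by (auto simp: cycle_type_def)
  moreover have "sum_mset (cycle_type d g) = d"
    using sum_orbit_card[OF g, of "\<lambda>_. 1 :: nat"] sum_mset_eq_sum_count[of "\<lambda>x. x" "cycle_type d g"]
    by (simp add: mult.commute)
  ultimately show ?thesis by (simp add: mparts_def)
qed

text \<open>The class size d!/z_M in averaged form. Both sides obey the same recursion in
  \<open>d\<close>: inserting a letter into a permutation corresponds to enlarging a marked part by
  one or adding a marked part 1.\<close>

lemma sum_mparts_eq_sum_Sy:
  fixes F :: "nat multiset \<Rightarrow> complex"
  shows "(\<Sum>M\<in>mparts d. F M / of_nat (z_mset M)) = (\<Sum>g\<in>Sy d. F (cycle_type d g)) / fact d"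
proof (induction d arbitrary: F)
  case 0
  have "mparts 0 = {{#}}" by (auto simp: mparts_def) (metis bot_nat_0.not_eq_extremum multiset_nonemptyE)
  moreover have "Sy 0 = {id}" by (simp add: Sy_def)
  ultimately show ?case by (simp add: cycle_type_def z_mset_def)
next
  case (Suc d)
  \<comment> \<open>Collects the \<open>Suc d\<close> ways to insert a letter into a permutation of
    type \<open>M\<close>: a new fixed point, or one of \<open>s * count M s\<close> places that
    lengthen a cycle of length \<open>s\<close>.\<close>
  define F' where "F' M = F (add_mset 1 M) + (\<Sum>s\<in>set_mset M. of_nat (s * count M s) * F (add_mset (Suc s) (M - {#s#})))" for M
  have "(\<Sum>g\<in>Sy (Suc d). F (cycle_type (Suc d) g)) = (\<Sum>g\<in>Sy d. F' (cycle_type d g))"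
  proof (unfold sum_Sy_Suc, rule sum.cong[OF refl])
    fix g assume g: "g \<in> Sy d"
    have "(\<Sum>k\<le>d. F (cycle_type (Suc d) (insert_pt d k g)))
        = F (cycle_type (Suc d) g) + (\<Sum>k<d. F (cycle_type (Suc d) (insert_pt d k g)))"
      by (simp add: insert_pt_same add.commute flip: lessThan_Suc_atMost)
    also have "(\<Sum>k<d. F (cycle_type (Suc d) (insert_pt d k g)))
        = (\<Sum>k<d. F (add_mset (Suc (card (orbit g k))) (cycle_type d g - {#card (orbit g k)#})))"
      by (rule sum.cong) (simp_all add: cycle_type_insert_pt[OF g])
    also have "\<dots> = (\<Sum>s\<in>set_mset (cycle_type d g). of_nat (s * count (cycle_type d g) s)
         * F (add_mset (Suc s) (cycle_type d g - {#s#})))"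
      by (rule sum_orbit_card[OF g])
    finally show "(\<Sum>k\<le>d. F (cycle_type (Suc d) (insert_pt d k g))) = F' (cycle_type d g)"
      by (simp add: F'_def cycle_type_insert_pt_same[OF g])
  qed
  then have "(\<Sum>g\<in>Sy (Suc d). F (cycle_type (Suc d) g)) / fact d = (\<Sum>M\<in>mparts d. F' M / of_nat (z_mset M))"
    using Suc.IH[of F'] by simp
  also have "\<dots> = (\<Sum>M\<in>mparts d. F (add_mset 1 M) / of_nat (z_mset M))
      + (\<Sum>(B, s)\<in>marked_parts d. F (add_mset (Suc s) B) / of_nat (z_mset B))"
    unfolding F'_def add_divide_distrib sum.distrib
    by (simp only: sum_marked_parts[where H = "\<lambda>B s. F (add_mset (Suc s) B)"])
  also have "\<dots> = (\<Sum>(B, t)\<in>marked_parts (Suc d). F (add_mset t B) / of_nat (z_mset B))"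
  proof -
    \<comment> \<open>The two kinds of insertion are the marked parts equal to 1 and those greater
      than 1.\<close>
    let ?X = "(\<lambda>M. (M, 1)) ` mparts d" and ?Y = "(\<lambda>(B, s). (B, Suc s)) ` marked_parts d"
    have "finite (marked_parts d)"
    proof (rule finite_surj)
      show "finite (SIGMA M:mparts d. set_mset M)" by auto
      show "marked_parts d \<subseteq> (\<lambda>(M, s). (M - {#s#}, s)) ` (SIGMA M:mparts d. set_mset M)"
      proof
        fix p assume "p \<in> marked_parts d"
        then show "p \<in> (\<lambda>(M, s). (M - {#s#}, s)) ` (SIGMA M:mparts d. set_mset M)"
          by (intro image_eqI[where x = "(add_mset (snd p) (fst p), snd p)"]) (auto simp: marked_parts_def mparts_def)
      qed
    qed
    moreover have "marked_parts (Suc d) = ?X \<union> ?Y"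
    proof (intro set_eqI iffI)
      fix p assume p: "p \<in> marked_parts (Suc d)"
      then obtain B t where bt: "p = (B, t)" "0 \<notin># B" "0 < t" "sum_mset B + t = Suc d"
        by (auto simp: marked_parts_def)
      show "p \<in> ?X \<union> ?Y"
      proof (cases "t = 1")
        case True
        then show ?thesis using bt by (auto simp: mparts_def)
      next
        case False
        then have "(B, t - 1) \<in> marked_parts d" using bt by (auto simp: marked_parts_def)
        then have "(case (B, t - 1) of (B, s) \<Rightarrow> (B, Suc s)) \<in> ?Y" by (rule imageI)
        then show ?thesis using bt by simp
      qed
    qed (auto simp: marked_parts_def mparts_def)
    moreover have "?X \<inter> ?Y = {}" by (auto simp: marked_parts_def)
    ultimately have "(\<Sum>(B, t)\<in>marked_parts (Suc d). F (add_mset t B) / of_nat (z_mset B))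
        = (\<Sum>(B, t)\<in>?X. F (add_mset t B) / of_nat (z_mset B)) + (\<Sum>(B, t)\<in>?Y. F (add_mset t B) / of_nat (z_mset B))"
      by (simp add: sum.union_disjoint)
    also have "(\<Sum>(B, t)\<in>?X. F (add_mset t B) / of_nat (z_mset B)) = (\<Sum>M\<in>mparts d. F (add_mset 1 M) / of_nat (z_mset M))"
      by (subst sum.reindex) (auto simp: inj_on_def)
    also have "(\<Sum>(B, t)\<in>?Y. F (add_mset t B) / of_nat (z_mset B))
        = (\<Sum>(B, s)\<in>marked_parts d. F (add_mset (Suc s) B) / of_nat (z_mset B))"
      by (subst sum.reindex) (auto simp: inj_on_def case_prod_beta)
    finally show ?thesis by simp
  qed
  also have "\<dots> = (\<Sum>M\<in>mparts (Suc d). (\<Sum>s\<in>set_mset M. of_nat (s * count M s) * F M) / of_nat (z_mset M))"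
    unfolding sum_marked_parts[symmetric] by (intro sum.cong refl arg_cong2[of _ _ _ _ "(/)"]) auto
  \<comment> \<open>The weights of the parts of \<open>M\<close> add up to \<open>Suc d\<close>, the
    factor between the two factorials.\<close>
  also have "\<dots> = (\<Sum>M\<in>mparts (Suc d). of_nat (Suc d) * (F M / of_nat (z_mset M)))"
  proof (rule sum.cong[OF refl])
    fix M assume "M \<in> mparts (Suc d)"
    then have "(\<Sum>s\<in>set_mset M. s * count M s) = Suc d"
      using sum_mset_eq_sum_count[of "\<lambda>x. x" M] by (simp add: mparts_def mult.commute)
    then have "(\<Sum>s\<in>set_mset M. of_nat (s * count M s)) = complex_of_nat (Suc d)"
      by (simp only: flip: of_nat_sum)
    then show "(\<Sum>s\<in>set_mset M. of_nat (s * count M s) * F M) / of_nat (z_mset M) = of_nat (Suc d) * (F M / of_nat (z_mset M))"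
      by (simp only: sum_distrib_right[symmetric] times_divide_eq_right)
  qed
  finally have "(\<Sum>g\<in>Sy (Suc d). F (cycle_type (Suc d) g)) / fact d
      = of_nat (Suc d) * (\<Sum>M\<in>mparts (Suc d). F M / of_nat (z_mset M))"
    by (simp only: sum_distrib_left)
  then show ?case by (simp add: field_simps del: of_nat_Suc)
qed

text \<open>Applied to the indicator of \<open>M\<close>, the averaged formula has the nonzero left
  side 1/z_M; the permutation comes from this count and not from a construction.\<close>

lemma exists_cycle_type:
  assumes "M \<in> mparts d" shows "\<exists>g\<in>Sy d. cycle_type d g = M"
proof (rule ccontr)
  assume "\<not> ?thesis"
  then have "(\<Sum>g\<in>Sy d. if cycle_type d g = M then 1 else 0) = (0::complex)" by (intro sum.neutral) auto
  then have "(\<Sum>M'\<in>mparts d. (if M' = M then 1 else 0) / complex_of_nat (z_mset M')) = 0"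
    using sum_mparts_eq_sum_Sy[of "\<lambda>M'. if M' = M then 1 else 0" d] by simp
  then have "1 / complex_of_nat (z_mset M) = 0"
    using assms by (simp add: if_distrib[of "\<lambda>t. t / _"] cong: if_cong)
  then show False using z_mset_pos[of M] assms by (simp add: mparts_def)
qed

section \<open>Products of power sums as sums over index maps\<close>

lemma mat_pow_0 [simp]: "mat_pow A 0 = mat 1" and mat_pow_Suc: "mat_pow A (Suc n) = A ** mat_pow A n"
  by (simp_all add: mat_pow_def)

lemma mat_pow_1 [simp]: "mat_pow A (Suc 0) = A"
  by (simp add: mat_pow_Suc)

lemma mat_pow_add: "mat_pow A (m + n) = mat_pow A m ** mat_pow A n"
  by (induction m) (simp_all add: mat_pow_Suc matrix_mul_assoc)

lemma sum_PiE_insert: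
  fixes F :: "('k \<Rightarrow> 'a::finite) \<Rightarrow> 'b::comm_monoid_add"
  assumes k: "k \<notin> K"
  shows "(\<Sum>f\<in>insert k K \<rightarrow>\<^sub>E UNIV. F f) = (\<Sum>f\<in>K \<rightarrow>\<^sub>E UNIV. \<Sum>c\<in>UNIV. F (f(k := c)))"
proof -
  have mem: "f \<in> L \<rightarrow>\<^sub>E (UNIV :: 'a set) \<longleftrightarrow> (\<forall>x. x \<notin> L \<longrightarrow> f x = undefined)" for f and L :: "'k set"
    by (simp add: PiE_iff extensional_def)
  have "(\<Sum>f\<in>insert k K \<rightarrow>\<^sub>E UNIV. F f) = (\<Sum>(f, c)\<in>(K \<rightarrow>\<^sub>E UNIV) \<times> UNIV. F (f(k := c)))"
  proof (rule sum.reindex_bij_witness[where i = "\<lambda>(f, c). f(k := c)" and j = "\<lambda>f. (f(k := undefined), f k)"], goal_cases)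
    case (2 f)
    then have "\<forall>x. x \<notin> insert k K \<longrightarrow> f x = undefined" unfolding mem .
    then show ?case unfolding mem_Times_iff mem by simp
  next
    case (3 b)
    then have "\<forall>x. x \<notin> K \<longrightarrow> fst b x = undefined" unfolding mem_Times_iff mem by simp
    then have "(fst b)(k := undefined) = fst b" using k by (intro fun_upd_idem) simp
    then show ?case by (cases b) simp
  next
    case (4 b)
    then have "\<forall>x. x \<notin> K \<longrightarrow> fst b x = undefined" unfolding mem_Times_iff mem by simp
    then show ?case unfolding mem by (cases b) simp
  qed simp_all
  then show ?thesis by (simp add: sum.cartesian_product)
qed

lemma sum_PiE_Suc:
  fixes F :: "(nat \<Rightarrow> 'a::finite) \<Rightarrow> 'b::comm_monoid_add"
  shows "(\<Sum>f\<in>{..<Suc d} \<rightarrow>\<^sub>E UNIV. F f) = (\<Sum>f\<in>{..<d} \<rightarrow>\<^sub>E UNIV. \<Sum>c\<in>UNIV. F (f(d := c)))"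
  unfolding lessThan_Suc by (rule sum_PiE_insert) simp

text \<open>Summing over the index at \<open>d\<close> multiplies the matrix leading into
  \<open>d\<close> by the one leaving it. With a power \<open>e k\<close> at each place the
  expression keeps its shape: the exponent at \<open>d\<close> is absorbed by its predecessor, and
  the total exponent along each cycle is unchanged.\<close>

lemma prod_trace_orbits:
  fixes A :: "'n::finite cmat"
  shows "g \<in> Sy d \<Longrightarrow> (\<Sum>f\<in>{..<d} \<rightarrow>\<^sub>E UNIV. \<Prod>k<d. mat_pow A (e k) $ f k $ f (g k))
    = (\<Prod>C\<in>orbit g ` {..<d}. trace (mat_pow A (sum e C)))"
proof (induction d arbitrary: g e)
  case 0
  then show ?case by simp
next
  case (Suc d g' e)
  let ?P = "\<lambda>m. mat_pow A m"
  define k where "k = g' d"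
  define g where "g = Transposition.transpose d k \<circ> g'"
  have ins: "insert d {..<d} = {..<Suc d}" by auto
  have g: "g \<in> Sy d" using permutes_insert_lemma[of g' d "{..<d}"] Suc.prems unfolding ins
    by (simp add: Sy_def g_def k_def)
  have g': "g' = insert_pt d k g" by (simp add: insert_pt_def g_def fun_eq_iff)
  have kd: "k \<le> d" using Sy_lt_iff[OF Suc.prems, of d] by (simp add: k_def)
  have gd: "g d = d" using g by (simp add: Sy_def permutes_not_in)
  have glt: "g m < d" if "m < d" for m using g that by simp
  show ?case
  proof (cases "k = d")
    case True
    then have gg: "g' = g" using g' insert_pt_same by simp
    have "{d} \<notin> orbit g ` {..<d}" using not_in_orbit[OF g] by auto
    then have R: "(\<Prod>C\<in>orbit g' ` {..<Suc d}. trace (?P (sum e C)))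
        = trace (?P (e d)) * (\<Prod>C\<in>orbit g ` {..<d}. trace (?P (sum e C)))"
      unfolding gg orbits_insert_pt_same[OF g] by simp
    have "(\<Prod>m<Suc d. ?P (e m) $ (f(d := c)) m $ (f(d := c)) (g' m)) = (\<Prod>m<d. ?P (e m) $ f m $ f (g m)) * ?P (e d) $ c $ c" for f c
    proof -
      have "(\<Prod>m<d. ?P (e m) $ (f(d := c)) m $ (f(d := c)) (g m)) = (\<Prod>m<d. ?P (e m) $ f m $ f (g m))"
        by (rule prod.cong) (use glt in \<open>auto simp: less_imp_neq\<close>)
      then show ?thesis by (simp add: gg gd)
    qed
    then have "(\<Sum>f\<in>{..<Suc d} \<rightarrow>\<^sub>E UNIV. \<Prod>m<Suc d. ?P (e m) $ f m $ f (g' m))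
        = (\<Sum>f\<in>{..<d} \<rightarrow>\<^sub>E UNIV. (\<Prod>m<d. ?P (e m) $ f m $ f (g m)) * trace (?P (e d)))"
      unfolding sum_PiE_Suc trace_def sum_distrib_left by simp
    also have "\<dots> = (\<Prod>C\<in>orbit g ` {..<d}. trace (?P (sum e C))) * trace (?P (e d))"
      unfolding Suc.IH[OF g, of e, symmetric] sum_distrib_right ..
    finally show ?thesis unfolding R by (simp only: mult.commute)
  next
    case False
    with kd have k: "k < d" by simp
    define j where "j = inv g k"
    have j: "j < d" "g j = k" using g k Sy_bij[OF g] by (simp_all add: j_def bij_is_surj surj_f_inv_f)
    have inj: "g m = k \<Longrightarrow> m = j" for m using Sy_bij[OF g] j by (metis bij_is_inj inj_eq)
    note app = insert_pt_apply[OF g k]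
    define e' where "e' = e(j := e j + e d)"
    have step: "(\<Sum>c\<in>UNIV. \<Prod>m<Suc d. ?P (e m) $ (f(d := c)) m $ (f(d := c)) (g' m)) = (\<Prod>m<d. ?P (e' m) $ f m $ f (g m))" for f
    proof -
      let ?R = "\<Prod>m\<in>{..<d} - {j}. ?P (e m) $ f m $ f (g m)"
      have "(\<Prod>m<Suc d. ?P (e m) $ (f(d := c)) m $ (f(d := c)) (g' m)) = ?R * (?P (e j) $ f j $ c * ?P (e d) $ c $ f k)" for c
      proof -
        let ?h = "\<lambda>m. ?P (e m) $ (f(d := c)) m $ (f(d := c)) (g' m)"
        have "(\<Prod>m<Suc d. ?h m) = (?h j * (\<Prod>m\<in>{..<d} - {j}. ?h m)) * ?h d"
          using j by (simp add: prod.remove[of "{..<d}" j])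
        also have "?h j = ?P (e j) $ f j $ c" using j app(2)[of j] unfolding g' by simp
        also have "?h d = ?P (e d) $ c $ f k" using k app(1) unfolding g' by simp
        also have "(\<Prod>m\<in>{..<d} - {j}. ?h m) = ?R"
        proof (rule prod.cong[OF refl])
          fix m assume m: "m \<in> {..<d} - {j}"
          then have "g' m = g m" using app(3)[of m] inj unfolding g' by auto
          then show "?h m = ?P (e m) $ f m $ f (g m)" using m glt[of m] by simp
        qed
        finally show ?thesis by (simp add: mult_ac)
      qed
      then have "(\<Sum>c\<in>UNIV. \<Prod>m<Suc d. ?P (e m) $ (f(d := c)) m $ (f(d := c)) (g' m))
          = ?R * ?P (e' j) $ f j $ f (g j)"
        by (simp add: sum_distrib_left[symmetric] e'_def mat_pow_add matrix_matrix_mult_def j(2))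
      also have "\<dots> = (\<Prod>m<d. ?P (e' m) $ f m $ f (g m))"
      proof -
        have "?R = (\<Prod>m\<in>{..<d} - {j}. ?P (e' m) $ f m $ f (g m))"
          by (rule prod.cong) (auto simp: e'_def)
        then show ?thesis using j(1) by (simp add: prod.remove[of "{..<d}" j] mult.commute)
      qed
      finally show ?thesis .
    qed
    let ?K = "orbit g k"
    have jK: "j \<in> ?K"
    proof -
      have "k \<in> orbit g j" using orbit.base[of g j] j by simp
      then show ?thesis using Sy_orbit_eq[OF g] Sy_orbit_self[OF g, of j] by metis
    qed
    have finK: "finite ?K" by (rule Sy_finite_orbit[OF g k])
    have dK: "d \<notin> ?K" using not_in_orbit[OF g, of ?K] k by auto
    have Kmem: "?K \<in> orbit g ` {..<d}" using k by auto
    have eK: "sum e' ?K = sum e (insert d ?K)"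
    proof -
      have "sum e' ?K = (e j + e d) + sum e (?K - {j})"
        using jK finK by (simp add: sum.remove[of ?K j] e'_def)
      then show ?thesis using jK finK dK by (simp add: sum.remove[of ?K j])
    qed
    have eC: "sum e' C = sum e C" if C: "C \<in> orbit g ` {..<d} - {?K}" for C
    proof -
      have "j \<notin> C"
      proof
        assume "j \<in> C"
        then have "orbit g j = C" using Sy_orbit_eq[OF g] C by auto
        moreover have "orbit g j = ?K" by (rule Sy_orbit_eq[OF g jK])
        ultimately show False using C by simp
      qed
      then show ?thesis by (intro sum.cong) (auto simp: e'_def)
    qed
    have "insert d ?K \<notin> orbit g ` {..<d} - {?K}" using not_in_orbit[OF g] by auto
    then have "(\<Prod>C\<in>orbit g' ` {..<Suc d}. trace (?P (sum e C)))
        = trace (?P (sum e (insert d ?K))) * (\<Prod>C\<in>orbit g ` {..<d} - {?K}. trace (?P (sum e C)))"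
      unfolding g' orbits_insert_pt[OF g k] by simp
    also have "(\<Prod>C\<in>orbit g ` {..<d} - {?K}. trace (?P (sum e C))) = (\<Prod>C\<in>orbit g ` {..<d} - {?K}. trace (?P (sum e' C)))"
      by (rule prod.cong) (simp_all add: eC)
    also have "trace (?P (sum e (insert d ?K))) * \<dots> = (\<Prod>C\<in>orbit g ` {..<d}. trace (?P (sum e' C)))"
      using Kmem by (simp add: prod.remove[of "orbit g ` {..<d}" ?K] eK)
    finally show ?thesis
      unfolding sum_PiE_Suc step Suc.IH[OF g, of e'] by (rule sym)
  qed
qed

lemma prod_trace_cycle_type:
  fixes A :: "'n::finite cmat"
  assumes g: "g \<in> Sy d"
  shows "(\<Prod>m\<in>#cycle_type d g. trace (mat_pow A m)) = (\<Sum>f\<in>{..<d} \<rightarrow>\<^sub>E UNIV. \<Prod>k<d. A $ f k $ f (g k))"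
proof -
  have "(\<Prod>m\<in>#cycle_type d g. trace (mat_pow A m)) = (\<Prod>C\<in>orbit g ` {..<d}. trace (mat_pow A (sum (\<lambda>_. Suc 0) C)))"
    by (simp add: cycle_type_def prod_unfold_prod_mset image_mset.compositionality o_def)
  also have "\<dots> = (\<Sum>f\<in>{..<d} \<rightarrow>\<^sub>E UNIV. \<Prod>k<d. A $ f k $ f (g k))"
    using prod_trace_orbits[OF g, of A "\<lambda>_. Suc 0"] by simp
  finally show ?thesis .
qed

section \<open>Wick's formula\<close>

text \<open>What is used of Gaussian variables: one-dimensional moments, with integration by parts
  on monomials as \<open>moment_Suc_Suc\<close>. The number \<open>s a\<close> is the variance, as m
  = 0 shows.\<close>

locale moment_family =
  fixes M :: "'a::finite \<Rightarrow> real measure" and s :: "'a \<Rightarrow> real"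
  assumes prob: "prob_space (M a)"
    and moment_integrable: "integrable (M a) (\<lambda>x. x ^ m)"
    and moment_1: "(\<integral>x. x \<partial>M a) = 0"
    and moment_Suc_Suc: "(\<integral>x. x ^ Suc (Suc m) \<partial>M a) = real (Suc m) * s a * (\<integral>x. x ^ m \<partial>M a)"
begin

sublocale product_sigma_finite M
  by (rule product_sigma_finite.intro) (rule prob_space_imp_sigma_finite[OF prob])

abbreviation G :: "('a \<Rightarrow> real) measure" where "G \<equiv> Pi\<^sub>M UNIV M"

definition mom :: "'a \<Rightarrow> nat \<Rightarrow> real" where "mom a m = (\<integral>x. x ^ m \<partial>M a)"

text \<open>For m = 0 the factor \<open>real m\<close> vanishes, which makes the truncated
  \<open>m - 1\<close> harmless and merges the zero mean with the recursion.\<close>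

lemma mom_Suc: "mom a (Suc m) = real m * s a * mom a (m - 1)"
  by (cases m) (simp_all add: mom_def moment_1 moment_Suc_Suc del: power_Suc)

definition mult :: "('k \<Rightarrow> 'a) \<Rightarrow> 'k set \<Rightarrow> 'a \<Rightarrow> nat" where
  "mult al K a = card {k \<in> K. al k = a}"

lemma monomial_eq:
  fixes x :: "'a \<Rightarrow> real"
  assumes "finite K"
  shows "(\<Prod>k\<in>K. x (al k)) = (\<Prod>a\<in>UNIV. x a ^ mult al K a)"
proof -
  have "(\<Prod>k\<in>K. x (al k)) = (\<Prod>a\<in>UNIV. \<Prod>k | k \<in> K \<and> al k = a. x (al k))"
    using prod.group[of K UNIV al "\<lambda>k. x (al k)"] assms by simp
  also have "\<dots> = (\<Prod>a\<in>UNIV. x a ^ mult al K a)"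
    by (rule prod.cong) (simp_all add: mult_def)
  finally show ?thesis .
qed

lemma monomial_integrable:
  assumes "finite K" shows "integrable G (\<lambda>x. \<Prod>k\<in>K. x (al k))"
  unfolding monomial_eq[OF assms]
  by (rule product_integrable_prod) (simp_all add: moment_integrable)

definition EM :: "('k \<Rightarrow> 'a) \<Rightarrow> 'k set \<Rightarrow> real" where
  "EM al K = (\<integral>x. (\<Prod>k\<in>K. x (al k)) \<partial>G)"

lemma EM_eq:
  assumes "finite K" shows "EM al K = (\<Prod>a\<in>UNIV. mom a (mult al K a))"
  unfolding EM_def monomial_eq[OF assms] mom_def
  by (rule product_integral_prod) (simp_all add: moment_integrable)

text \<open>Integration by parts in the variable of index \<open>a\<close>: the exponent brought
  down by the derivative counts the places \<open>k\<close> that carry this variable, and each of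
  them is deleted once.\<close>

lemma EM_stein:
  assumes K: "finite K" "k0 \<notin> K"
  shows "EM (al(k0 := a)) (insert k0 K) = (\<Sum>k\<in>K. if al k = a then s a * EM al (K - {k}) else 0)"
proof -
  let ?n = "mult al K a" and ?R = "\<Prod>b\<in>UNIV - {a}. mom b (mult al K b)"
  have m: "mult (al(k0 := a)) (insert k0 K) b = (if b = a then Suc (mult al K b) else mult al K b)" for b
  proof -
    have "{k \<in> insert k0 K. (al(k0 := a)) k = b} = (if b = a then insert k0 {k \<in> K. al k = b} else {k \<in> K. al k = b})"
      using K by auto
    then show ?thesis using K by (simp add: mult_def)
  qed
  have "EM (al(k0 := a)) (insert k0 K) = mom a (Suc ?n) * (\<Prod>b\<in>UNIV - {a}. mom b (mult (al(k0 := a)) (insert k0 K) b))"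
    using K by (simp add: EM_eq prod.remove[of UNIV a] m)
  also have "(\<Prod>b\<in>UNIV - {a}. mom b (mult (al(k0 := a)) (insert k0 K) b)) = ?R"
    by (rule prod.cong) (simp_all add: m)
  also have "mom a (Suc ?n) * ?R = real ?n * (s a * (mom a (?n - 1) * ?R))" by (simp add: mom_Suc)
  also have "\<dots> = (\<Sum>k | k \<in> K \<and> al k = a. s a * (mom a (?n - 1) * ?R))" by (simp add: mult_def)
  also have "\<dots> = (\<Sum>k | k \<in> K \<and> al k = a. s a * EM al (K - {k}))"
  proof (rule sum.cong[OF refl])
    fix k assume k: "k \<in> {k. k \<in> K \<and> al k = a}"
    have m': "mult al (K - {k}) b = (if b = a then mult al K b - 1 else mult al K b)" for b
    proof -
      have "{k' \<in> K - {k}. al k' = b} = (if b = a then {k' \<in> K. al k' = b} - {k} else {k' \<in> K. al k' = b})"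
        using k by auto
      then show ?thesis using k K by (simp add: mult_def)
    qed
    have "?R = (\<Prod>b\<in>UNIV - {a}. mom b (mult al (K - {k}) b))"
      by (rule prod.cong) (simp_all add: m')
    then show "s a * (mom a (?n - 1) * ?R) = s a * EM al (K - {k})"
      using K by (simp add: EM_eq prod.remove[of UNIV a] m'[of a])
  qed
  also have "\<dots> = (\<Sum>k\<in>K. if al k = a then s a * EM al (K - {k}) else 0)"
    using K by (simp add: sum.inter_filter[symmetric])
  finally show ?thesis .
qed

definition lin :: "('a \<Rightarrow> complex) \<Rightarrow> ('a \<Rightarrow> real) \<Rightarrow> complex" where
  "lin c x = (\<Sum>a\<in>UNIV. c a * of_real (x a))"

lemma prod_lin:
  assumes "finite K"
  shows "(\<Prod>k\<in>K. lin (c k) x) = (\<Sum>al\<in>K \<rightarrow>\<^sub>E UNIV. (\<Prod>k\<in>K. c k (al k)) * of_real (\<Prod>k\<in>K. x (al k)))"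
  using prod_sum_PiE[of K "\<lambda>_. UNIV" "\<lambda>k a. c k a * of_real (x a)"] assms
  by (simp add: lin_def prod.distrib)

lemma prod_lin_integrable:
  assumes "finite K" shows "integrable G (\<lambda>x. \<Prod>k\<in>K. lin (c k) x)"
  unfolding prod_lin[OF assms]
  by (intro Bochner_Integration.integrable_sum integrable_mult_right integrable_of_real monomial_integrable[OF assms])

definition EL :: "('k \<Rightarrow> 'a \<Rightarrow> complex) \<Rightarrow> 'k set \<Rightarrow> complex" where
  "EL c K = (\<integral>x. (\<Prod>k\<in>K. lin (c k) x) \<partial>G)"

lemma EL_eq:
  assumes "finite K"
  shows "EL c K = (\<Sum>al\<in>K \<rightarrow>\<^sub>E UNIV. (\<Prod>k\<in>K. c k (al k)) * of_real (EM al K))"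
proof -
  have "EL c K = (\<Sum>al\<in>K \<rightarrow>\<^sub>E UNIV. \<integral>x. (\<Prod>k\<in>K. c k (al k)) * of_real (\<Prod>k\<in>K. x (al k)) \<partial>G)"
    unfolding EL_def prod_lin[OF assms]
    by (intro Bochner_Integration.integral_sum integrable_mult_right integrable_of_real monomial_integrable[OF assms])
  also have "\<dots> = (\<Sum>al\<in>K \<rightarrow>\<^sub>E UNIV. (\<Prod>k\<in>K. c k (al k)) * of_real (EM al K))"
    unfolding EM_def
    by (intro sum.cong refl, subst integral_mult_right_zero, subst integral_complex_of_real[symmetric]) simp
  finally show ?thesis .
qed

text \<open>Multilinearity carries the recursion from coordinates over to complex linear forms. The
  inner sum is the covariance of two forms, bilinear and without conjugation.\<close>

lemma EL_stein:
  fixes K :: "'k set"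
  assumes K: "finite K" "k0 \<notin> K"
  shows "EL c (insert k0 K) = (\<Sum>k\<in>K. (\<Sum>a\<in>UNIV. of_real (s a) * c k0 a * c k a) * EL c (K - {k}))"
proof -
  let ?p = "\<lambda>L al. \<Prod>k\<in>L. c k (al k)"
  have EMc: "EM al L = EM al' L" if "\<And>k. k \<in> L \<Longrightarrow> al k = al' k" for al al' and L :: "'k set"
    unfolding EM_def using that by (simp cong: prod.cong)
  have "EL c (insert k0 K) = (\<Sum>al\<in>insert k0 K \<rightarrow>\<^sub>E UNIV. ?p (insert k0 K) al * of_real (EM al (insert k0 K)))"
    using K by (simp only: EL_eq finite_insert)
  also have "\<dots> = (\<Sum>al\<in>K \<rightarrow>\<^sub>E UNIV. \<Sum>a\<in>UNIV. c k0 a * ?p K al *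
      of_real (\<Sum>k\<in>K. if al k = a then s a * EM al (K - {k}) else 0))"
  proof -
    have "?p (insert k0 K) (al(k0 := a)) = c k0 a * ?p K al" for al a
    proof -
      have "?p K (al(k0 := a)) = ?p K al" using K by (intro prod.cong) auto
      then show ?thesis using K by simp
    qed
    then show ?thesis unfolding sum_PiE_insert[OF K(2)] EM_stein[OF K] by simp
  qed
  also have "\<dots> = (\<Sum>al\<in>K \<rightarrow>\<^sub>E UNIV. \<Sum>k\<in>K. \<Sum>a\<in>UNIV. if al k = a then of_real (s a) * c k0 a * ?p K al * of_real (EM al (K - {k})) else 0)"
    by (simp add: sum_distrib_left of_real_sum if_distrib[of complex_of_real] if_distrib[of "\<lambda>t. _ * t"] mult_ac cong: if_cong)
       (subst sum.swap, simp)
  also have "\<dots> = (\<Sum>k\<in>K. \<Sum>al\<in>K \<rightarrow>\<^sub>E UNIV. of_real (s (al k)) * c k0 (al k) * ?p K al * of_real (EM al (K - {k})))"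
    by (subst sum.swap) simp
  also have "\<dots> = (\<Sum>k\<in>K. (\<Sum>a\<in>UNIV. of_real (s a) * c k0 a * c k a) * EL c (K - {k}))"
  proof (rule sum.cong[OF refl])
    fix k assume k: "k \<in> K"
    let ?L = "K - {k}"
    have ins: "insert k ?L = K" using k by auto
    have "?p K (al(k := b)) = c k b * ?p ?L al" for al b
    proof -
      have "?p ?L (al(k := b)) = ?p ?L al" by (intro prod.cong) auto
      then show ?thesis using K k by (simp add: prod.remove[of K k])
    qed
    moreover have "EM (al(k := b)) ?L = EM al ?L" for al b by (rule EMc) auto
    ultimately have "(\<Sum>al\<in>insert k ?L \<rightarrow>\<^sub>E UNIV. of_real (s (al k)) * c k0 (al k) * ?p K al * of_real (EM al ?L))
        = (\<Sum>al\<in>?L \<rightarrow>\<^sub>E UNIV. \<Sum>b\<in>UNIV. (of_real (s b) * c k0 b * c k b) * (?p ?L al * of_real (EM al ?L)))"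
      by (subst sum_PiE_insert) (simp_all add: mult_ac)
    also have "\<dots> = (\<Sum>a\<in>UNIV. of_real (s a) * c k0 a * c k a) * EL c ?L"
      using K by (simp add: EL_eq sum_distrib_left sum_distrib_right)
    finally show "(\<Sum>al\<in>K \<rightarrow>\<^sub>E UNIV. of_real (s (al k)) * c k0 (al k) * ?p K al * of_real (EM al ?L))
        = (\<Sum>a\<in>UNIV. of_real (s a) * c k0 a * c k a) * EL c ?L"
      unfolding ins .
  qed
  finally show ?thesis .
qed

lemma EL_empty: "EL c {} = 1"
proof -
  have "prob_space G" using prob by (intro prob_space_PiM) 
  then show ?thesis by (simp add: EL_def prob_space.prob_space)
qed

end

definition pairings :: "'k set \<Rightarrow> ('k \<Rightarrow> 'k) set" where
  "pairings K = {z. z permutes K \<and> (\<forall>k\<in>K. z k \<noteq> k \<and> z (z k) = k)}"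

lemma pairings_empty [simp]: "pairings {} = {id}"
  by (auto simp: pairings_def)

lemma finite_pairings [simp]: "finite K \<Longrightarrow> finite (pairings K)"
  by (rule finite_subset[OF _ finite_permutations[of K]]) (auto simp: pairings_def)

text \<open>A pairing amounts to the partner \<open>k\<close> of \<open>k0\<close> and a pairing of
  the rest. In the inverse direction \<open>k0\<close> and its partner are reset to fixed points,
  since a permutation of \<open>K - {k}\<close> has to fix them.\<close>

lemma sum_pairings_insert:
  fixes F :: "('k \<Rightarrow> 'k) \<Rightarrow> 'b::comm_monoid_add"
  assumes K: "finite K" "k0 \<notin> K"
  shows "(\<Sum>z\<in>pairings (insert k0 K). F z) = (\<Sum>k\<in>K. \<Sum>z\<in>pairings (K - {k}). F (z(k0 := k, k := k0)))"
proof -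
  have "(\<Sum>k\<in>K. \<Sum>z\<in>pairings (K - {k}). F (z(k0 := k, k := k0)))
      = (\<Sum>(k, z)\<in>(SIGMA k:K. pairings (K - {k})). F (z(k0 := k, k := k0)))"
    using K by (intro sum.Sigma) auto
  also have "\<dots> = (\<Sum>z\<in>pairings (insert k0 K). F z)"
  proof (rule sum.reindex_bij_witness[where j = "\<lambda>(k, z). z(k0 := k, k := k0)"
        and i = "\<lambda>z. (z k0, z(k0 := k0, z k0 := z k0))"], goal_cases)
    case (1 a)
    then obtain k z where a: "a = (k, z)" "k \<in> K" "z permutes (K - {k})" by (auto simp: pairings_def)
    then have "z k0 = k0" "z k = k" "k \<noteq> k0" using K by (auto simp: permutes_not_in)
    then show ?case using a(1) by (auto simp: fun_eq_iff)
  next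
    case (2 a)
    then obtain k z where a: "a = (k, z)" "k \<in> K" "z permutes (K - {k})" "\<And>m. m \<in> K - {k} \<Longrightarrow> z m \<noteq> m \<and> z (z m) = m"
      by (auto simp: pairings_def)
    let ?z = "z(k0 := k, k := k0)"
    have z0: "z k0 = k0" "z k = k" "k \<noteq> k0" using K a by (auto simp: permutes_not_in)
    have zi: "z m \<in> K - {k}" if "m \<in> K - {k}" for m using permutes_in_image[OF a(3)] that by simp
    have inv: "?z (?z m) = m" for m
    proof (cases "m \<in> K - {k}")
      case True
      then show ?thesis using zi[OF True] a(4)[OF True] K by auto
    next
      case False
      then have "z m = m" using a(3) by (auto simp: permutes_not_in)
      then show ?thesis using z0 by auto
    qed
    have "bij ?z" by (rule o_bij[of ?z]) (use inv in \<open>auto simp: fun_eq_iff\<close>)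
    moreover have "?z m = m" if "m \<notin> insert k0 K" for m
      using that a(2) permutes_not_in[OF a(3), of m] by auto
    ultimately have "?z permutes insert k0 K"
      unfolding permutes_def by (metis (no_types, lifting) bij_pointE)
    moreover have "?z m \<noteq> m" if "m \<in> insert k0 K" for m
      using that z0 a(4)[of m] by auto
    ultimately show ?case using inv a(1) by (simp add: pairings_def)
  next
    case (3 z)
    then have z: "z permutes insert k0 K" "\<And>m. m \<in> insert k0 K \<Longrightarrow> z m \<noteq> m \<and> z (z m) = m"
      by (auto simp: pairings_def)
    then have "z (z k0) = k0" "z k0 \<noteq> k0" by auto
    then show ?case by (auto simp: fun_eq_iff)
  next
    case (4 z)
    then have z: "z permutes insert k0 K" "\<And>m. m \<in> insert k0 K \<Longrightarrow> z m \<noteq> m \<and> z (z m) = m"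
      by (auto simp: pairings_def)
    let ?k = "z k0" let ?z = "z(k0 := k0, ?k := ?k)"
    have k: "z ?k = k0" "?k \<noteq> k0" using z by auto
    then have kK: "?k \<in> K" using permutes_in_image[OF z(1), of k0] by auto
    have inj: "z a = z b \<longleftrightarrow> a = b" for a b using permutes_inj[OF z(1)] by (auto simp: inj_def)
    have zz: "z (z m) = m" for m using z by (cases "m \<in> insert k0 K") (auto simp: permutes_not_in)
    have inv: "?z (?z m) = m" for m using k inj zz by auto
    have "bij ?z" by (rule o_bij[of ?z]) (use inv in \<open>auto simp: fun_eq_iff\<close>)
    moreover have "?z m = m" if "m \<notin> K - {?k}" for m
      using that permutes_not_in[OF z(1), of m] by auto
    ultimately have "?z permutes K - {?k}"
      unfolding permutes_def by (metis (no_types, lifting) bij_pointE)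
    moreover have "?z m \<noteq> m" if "m \<in> K - {?k}" for m
      using that z(2)[of m] K by auto
    ultimately have "?z \<in> pairings (K - {?k})" unfolding pairings_def mem_Collect_eq using inv by blast
    with kK show ?case by (rule SigmaI)
  qed (simp add: case_prod_beta)
  finally show ?thesis by simp
qed

text \<open>The hypothesis \<open>W_insert\<close> is the recursion satisfied by the mixed moments of centered jointly
  Gaussian entries with covariance \<open>v [i = j'] [j = i']\<close>.\<close>

lemma wick_pairings:
  fixes W :: "'k set \<Rightarrow> complex" and i j :: "'k \<Rightarrow> 'n"
  assumes W0: "W {} = 1"
    and W_insert: "\<And>K k0. finite K \<Longrightarrow> k0 \<notin> K \<Longrightarrow>
      W (insert k0 K) = (\<Sum>k\<in>K. (if i k0 = j k \<and> j k0 = i k then v\<^sup>2 else 0) * W (K - {k}))"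
  shows "finite K \<Longrightarrow> W K = v ^ card K * (\<Sum>z\<in>pairings K. if \<forall>k\<in>K. i k = j (z k) then 1 else 0)"
proof (induction "card K" arbitrary: K rule: less_induct)
  case less
  show ?case
  proof (cases "K = {}")
    case True
    then show ?thesis using W0 by simp
  next
    case False
    then obtain k0 L where L: "K = insert k0 L" "k0 \<notin> L" by (metis Set.set_insert ex_in_conv)
    have fin: "finite L" using L less.prems by simp
    let ?I = "\<lambda>K z. if \<forall>k\<in>K. i k = j (z k) then 1 else 0 :: complex"
    have IH: "W (L - {k}) = v ^ card (L - {k}) * (\<Sum>z\<in>pairings (L - {k}). ?I (L - {k}) z)" for k
    proof (rule less.hyps)
      have "card (L - {k}) \<le> card L" using fin by (simp add: card_mono)
      then show "card (L - {k}) < card K" using L fin by simp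
    qed (use fin in simp)
    have I: "?I K (z(k0 := k, k := k0)) = (if i k0 = j k \<and> j k0 = i k then ?I (L - {k}) z else 0)"
      if k: "k \<in> L" for k z
    proof -
      have "K = insert k0 (insert k (L - {k}))" using L k by auto
      then have "(\<forall>m\<in>K. i m = j ((z(k0 := k, k := k0)) m)) \<longleftrightarrow>
         i k0 = j k \<and> i k = j k0 \<and> (\<forall>m\<in>L - {k}. i m = j (z m))"
        using L k by auto
      then show ?thesis by auto
    qed
    have c: "v\<^sup>2 * v ^ card (L - {k}) = v ^ card K" if "k \<in> L" for k
    proof -
      have "card K = Suc (Suc (card (L - {k})))" using L that fin
        by (metis card.insert card_Suc_Diff1)
      then show ?thesis by (simp add: power2_eq_square)
    qed
    have "W K = (\<Sum>k\<in>L. (if i k0 = j k \<and> j k0 = i k then v\<^sup>2 else 0) * W (L - {k}))"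
      using W_insert[OF fin L(2)] L(1) by simp
    also have "\<dots> = (\<Sum>k\<in>L. v ^ card K * (\<Sum>z\<in>pairings (L - {k}). ?I K (z(k0 := k, k := k0))))"
    proof (rule sum.cong[OF refl])
      fix k assume k: "k \<in> L"
      show "(if i k0 = j k \<and> j k0 = i k then v\<^sup>2 else 0) * W (L - {k})
         = v ^ card K * (\<Sum>z\<in>pairings (L - {k}). ?I K (z(k0 := k, k := k0)))"
      proof (cases "i k0 = j k \<and> j k0 = i k")
        case True
        then show ?thesis unfolding I[OF k] by (simp add: IH c[OF k, symmetric] mult.assoc del: One_nat_def)
      next
        case False
        have "(\<Sum>z\<in>pairings (L - {k}). ?I K (z(k0 := k, k := k0))) = 0"
          unfolding I[OF k] using False by (intro sum.neutral ballI if_not_P)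
        then show ?thesis using False by (simp only: if_False mult_zero_left mult_zero_right)
      qed
    qed
    also have "\<dots> = v ^ card K * (\<Sum>z\<in>pairings K. ?I K z)"
      unfolding L(1) sum_pairings_insert[OF fin L(2)] by (simp only: sum_distrib_left)
    finally show ?thesis .
  qed
qed

section \<open>Moments of the Gaussian unitary ensemble\<close>

definition normal_measure :: "real \<Rightarrow> real measure" where
  "normal_measure sg = density lborel (\<lambda>x. ennreal (normal_density 0 sg x))"

lemma sets_normal_measure [simp, measurable_cong]: "sets (normal_measure sg) = sets borel"
  and space_normal_measure [simp]: "space (normal_measure sg) = UNIV"
  by (simp_all add: normal_measure_def)

lemma prob_space_normal_measure: "0 < sg \<Longrightarrow> prob_space (normal_measure sg)"
  unfolding normal_measure_def by (rule prob_space_normal_density)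

lemma normal_measure_moment:
  assumes sg: "0 < sg"
  shows "integrable (normal_measure sg) (\<lambda>x. x ^ m)"
    and "(\<integral>x. x ^ (2 * k) \<partial>normal_measure sg) = fact (2 * k) / ((2 / sg\<^sup>2) ^ k * fact k)"
    and "(\<integral>x. x ^ (2 * k + 1) \<partial>normal_measure sg) = 0"
proof -
  show "integrable (normal_measure sg) (\<lambda>x. x ^ m)"
    unfolding normal_measure_def
    using integrable_normal_moment[OF sg, of 0 m] by (subst integrable_density) (simp_all add: normal_density_nonneg)
  have eq: "(\<integral>x. x ^ m \<partial>normal_measure sg) = (\<integral>x. normal_density 0 sg x * (x - 0) ^ m \<partial>lborel)" for m
    unfolding normal_measure_def by (subst integral_density) (simp_all add: normal_density_nonneg)
  show "(\<integral>x. x ^ (2 * k) \<partial>normal_measure sg) = fact (2 * k) / ((2 / sg\<^sup>2) ^ k * fact k)"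
    unfolding eq by (rule integral_normal_moment_even[OF sg])
  show "(\<integral>x. x ^ (2 * k + 1) \<partial>normal_measure sg) = 0"
    unfolding eq by (rule integral_normal_moment_odd[OF sg])
qed

lemma moment_family_normal:
  fixes sg :: "'a::finite \<Rightarrow> real"
  assumes sg: "\<And>a. 0 < sg a"
  shows "moment_family (\<lambda>a. normal_measure (sg a)) (\<lambda>a. (sg a)\<^sup>2)"
proof (unfold moment_family_def, intro conjI allI)
  fix a :: 'a and m :: nat
  show "prob_space (normal_measure (sg a))" by (rule prob_space_normal_measure[OF sg])
  show "integrable (normal_measure (sg a)) (\<lambda>x. x ^ m)" by (rule normal_measure_moment(1)[OF sg])
  show "(\<integral>x. x \<partial>normal_measure (sg a)) = 0" using normal_measure_moment(3)[OF sg, of a 0] by simp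
  show "(\<integral>x. x ^ Suc (Suc m) \<partial>normal_measure (sg a)) = real (Suc m) * (sg a)\<^sup>2 * (\<integral>x. x ^ m \<partial>normal_measure (sg a))"
  proof (cases "even m")
    case True
    then obtain k where k: "m = 2 * k" by (auto elim: evenE)
    have e: "Suc (Suc m) = 2 * Suc k" using k by simp
    have f1: "fact (2 * Suc k) = (2 * real (Suc k)) * (real (Suc (2 * k)) * fact (2 * k))" by (simp add: algebra_simps)
    have f2: "(2 / (sg a)\<^sup>2) ^ Suc k * fact (Suc k) = (2 * real (Suc k)) / (sg a)\<^sup>2 * ((2 / (sg a)\<^sup>2) ^ k * fact k)"
      by simp
    have f3: "(x * (y * z)) / (x / w * t) = y * w * (z / t)" if "x \<noteq> 0" for x y z w t :: real
      using that by simp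
    have "fact (2 * Suc k) / ((2 / (sg a)\<^sup>2) ^ Suc k * fact (Suc k))
        = real (Suc (2 * k)) * (sg a)\<^sup>2 * (fact (2 * k) / ((2 / (sg a)\<^sup>2) ^ k * fact k))"
      unfolding f1 f2 by (rule f3) simp
    then show ?thesis unfolding e normal_measure_moment(2)[OF sg, of a] by (simp only: k normal_measure_moment(2)[OF sg])
  next
    case False
    then obtain k where k: "m = 2 * k + 1" by (auto elim: oddE)
    have e: "Suc (Suc m) = 2 * Suc k + 1" using k by simp
    show ?thesis unfolding e normal_measure_moment(3)[OF sg] by (simp only: k normal_measure_moment(3)[OF sg] mult_zero_right)
  qed
qed

lemma density_PiM_prod:
  fixes f :: "'a::finite \<Rightarrow> real \<Rightarrow> ennreal"
  assumes f [measurable]: "\<And>a. f a \<in> borel_measurable borel"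
    and sf: "\<And>a. sigma_finite_measure (density lborel (f a))"
  shows "density (Pi\<^sub>M UNIV (\<lambda>_. lborel)) (\<lambda>x. \<Prod>a\<in>UNIV. f a (x a)) = Pi\<^sub>M UNIV (\<lambda>a. density lborel (f a))"
proof -
  interpret L: product_sigma_finite "\<lambda>_::'a. lborel :: real measure" by standard
  interpret D: product_sigma_finite "\<lambda>a. density lborel (f a)" by (rule product_sigma_finite.intro) (rule sf)
  show ?thesis
  proof (rule D.PiM_eqI)
    show "sets (density (Pi\<^sub>M UNIV (\<lambda>_. lborel)) (\<lambda>x. \<Prod>a\<in>UNIV. f a (x a))) = sets (Pi\<^sub>M UNIV (\<lambda>a. density lborel (f a)))"
      unfolding sets_density by (rule sets_PiM_cong) simp_all
    fix A :: "'a \<Rightarrow> real set" assume "\<And>a. a \<in> UNIV \<Longrightarrow> A a \<in> sets (density lborel (f a))"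
    then have A [measurable]: "A a \<in> sets borel" for a by simp
    have "Pi\<^sub>E UNIV A \<in> sets (Pi\<^sub>M UNIV (\<lambda>_::'a. lborel :: real measure))"
      by (rule sets_PiM_I_finite) auto
    then have "emeasure (density (Pi\<^sub>M UNIV (\<lambda>_. lborel)) (\<lambda>x. \<Prod>a\<in>UNIV. f a (x a))) (Pi\<^sub>E UNIV A)
        = (\<integral>\<^sup>+x. (\<Prod>a\<in>UNIV. f a (x a)) * indicator (Pi\<^sub>E UNIV A) x \<partial>Pi\<^sub>M UNIV (\<lambda>_. lborel))"
      by (rule emeasure_density[rotated]) measurable
    also have "\<dots> = (\<integral>\<^sup>+x. (\<Prod>a\<in>UNIV. f a (x a) * indicator (A a) (x a)) \<partial>Pi\<^sub>M UNIV (\<lambda>_. lborel))"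
    proof (rule nn_integral_cong)
      fix x
      have "indicator (Pi\<^sub>E UNIV A) x = (\<Prod>a\<in>UNIV. indicator (A a) (x a) :: ennreal)"
        by (auto simp: indicator_def PiE_iff prod_zero_iff)
      then show "(\<Prod>a\<in>UNIV. f a (x a)) * indicator (Pi\<^sub>E UNIV A) x = (\<Prod>a\<in>UNIV. f a (x a) * indicator (A a) (x a))"
        by (simp add: prod.distrib)
    qed
    also have "\<dots> = (\<Prod>a\<in>UNIV. \<integral>\<^sup>+x. f a x * indicator (A a) x \<partial>lborel)"
      by (rule L.product_nn_integral_prod) simp_all
    also have "\<dots> = (\<Prod>a\<in>UNIV. emeasure (density lborel (f a)) (A a))"
      by (intro prod.cong refl emeasure_density[symmetric]) simp_all
    finally show "emeasure (density (Pi\<^sub>M UNIV (\<lambda>_. lborel)) (\<lambda>x. \<Prod>a\<in>UNIV. f a (x a))) (Pi\<^sub>E UNIV A)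
        = (\<Prod>a\<in>UNIV. emeasure (density lborel (f a)) (A a))" .
  qed simp
qed

text \<open>The trace in the weight contains each off-diagonal modulus twice. The density is
  therefore exp(-N x^2 / 2) in a diagonal coordinate and exp(-N x^2) in every other one, with
  variances 1/N and 1/(2N).\<close>

definition herm_sd :: "'n::finite \<times> 'n \<Rightarrow> real" where
  "herm_sd = (\<lambda>(i, j). if i = j then sqrt (1 / real CARD('n)) else sqrt (1 / (2 * real CARD('n))))"

lemma herm_sd_pos: "0 < herm_sd a"
  by (simp add: herm_sd_def case_prod_beta)

lemma herm_sd_sq: "(herm_sd (i, j))\<^sup>2 = (if i = j then 1 / real CARD('n) else 1 / (2 * real CARD('n)))"
  for i j :: "'n::finite"
  by (simp add: herm_sd_def)

text \<open>Presents the entry H_ij as a complex linear form in the independent real coordinates, to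
  which \<open>EL_stein\<close> applies.\<close>

definition herm_coef :: "'n::{finite,linorder} \<Rightarrow> 'n \<Rightarrow> 'n \<times> 'n \<Rightarrow> complex" where
  "herm_coef i j a = (if i = j then of_bool (a = (i, i))
     else if i < j then of_bool (a = (i, j)) + \<i> * of_bool (a = (j, i))
     else of_bool (a = (j, i)) - \<i> * of_bool (a = (i, j)))"

lemma herm_coef_cases: "herm_coef k k a = of_bool (a = (k, k))"
   "k < l \<Longrightarrow> herm_coef k l a = of_bool (a = (k, l)) + \<i> * of_bool (a = (l, k))"
   "l < k \<Longrightarrow> herm_coef k l a = of_bool (a = (l, k)) - \<i> * of_bool (a = (k, l))"
proof -
  show "herm_coef k k a = of_bool (a = (k, k))" unfolding herm_coef_def by (rule if_P) (rule refl)
  show "herm_coef k l a = of_bool (a = (k, l)) + \<i> * of_bool (a = (l, k))" if "k < l"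
    unfolding herm_coef_def if_not_P[OF less_imp_neq[OF that]] if_P[OF that] ..
  assume "l < k"
  then have "k \<noteq> l" "\<not> k < l" by (simp_all only: less_imp_neq[symmetric] less_not_sym not_False_eq_True)
  then show "herm_coef k l a = of_bool (a = (l, k)) - \<i> * of_bool (a = (k, l))"
    unfolding herm_coef_def by (simp only: if_False)
qed
lemma of_bool_pair_sums: "\<not> (i = l \<and> j = k) \<Longrightarrow> of_bool ((i, j) = (k, l)) + \<i> * of_bool ((i, j) = (l, k)) + \<i> * (of_bool ((j, i) = (k, l)) + \<i> * of_bool ((j, i) = (l, k))) = 0"
  "\<not> (i = k \<and> j = l) \<Longrightarrow> of_bool ((i, j) = (l, k)) - \<i> * of_bool ((i, j) = (k, l)) + \<i> * (of_bool ((j, i) = (l, k)) - \<i> * of_bool ((j, i) = (k, l))) = (if i = l \<and> j = k then 2 else 0)"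
  by (cases "i = k"; cases "j = l"; cases "i = l"; cases "j = k"; simp)+
text \<open>This combination is what remains of the covariance with H_ij once the common variance of
  its two coordinates is factored out. Against H_ij itself the terms 1 and \<i>^2 cancel, against
  H_ji they add up to 2.\<close>

lemma herm_coef_less: assumes "i < j" shows "herm_coef k l (i, j) + \<i> * herm_coef k l (j, i) = (if i = l \<and> j = k then 2 else 0)"
proof (cases k l rule: linorder_cases)
  case less
  have "\<not> (i = l \<and> j = k)" using assms less by auto
  from of_bool_pair_sums(1)[OF this] show ?thesis unfolding herm_coef_cases(2)[OF less] if_not_P[OF \<open>\<not> (i = l \<and> j = k)\<close>] .
next
  case equal
  have "i \<noteq> j" using assms by simp
  then show ?thesis unfolding equal herm_coef_cases(1) by auto
next
  case greater
  have "\<not> (i = k \<and> j = l)" using assms greater by auto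
  from of_bool_pair_sums(2)[OF this] show ?thesis unfolding herm_coef_cases(3)[OF greater] .
qed
lemma herm_coef_diag: "herm_coef k l (i, i) = (if i = l \<and> i = k then 1 else 0)"
proof (cases k l rule: linorder_cases)
  case less
  then have "k \<noteq> l" by simp
  then show ?thesis unfolding herm_coef_cases(2)[OF less] by auto
next
  case equal
  then show ?thesis unfolding equal herm_coef_cases(1) by auto
next
  case greater
  then have "k \<noteq> l" by simp
  then show ?thesis unfolding herm_coef_cases(3)[OF greater] by auto
qed

lemma cnj_of_bool: "cnj (of_bool P) = of_bool P"
  by (cases P) simp_all

lemma herm_coef_cnj: "herm_coef j i a = cnj (herm_coef i j a)"
proof (cases i j rule: linorder_cases)
  case less
  show ?thesis unfolding herm_coef_cases(2)[OF less] herm_coef_cases(3)[OF less]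
    by (simp only: complex_cnj_add complex_cnj_mult complex_cnj_i cnj_of_bool diff_conv_add_uminus mult_minus_left)
next
  case equal
  show ?thesis unfolding equal herm_coef_cases(1) by (simp only: cnj_of_bool)
next
  case greater
  show ?thesis unfolding herm_coef_cases(2)[OF greater] herm_coef_cases(3)[OF greater]
    by (simp only: complex_cnj_diff complex_cnj_mult complex_cnj_i cnj_of_bool minus_mult_minus mult_minus_left diff_minus_eq_add)
qed

lemma herm_coef_greater:
  assumes "j < i"
  shows "herm_coef k l (j, i) - \<i> * herm_coef k l (i, j) = (if i = l \<and> j = k then 2 else 0)"
proof -
  have "herm_coef k l (j, i) - \<i> * herm_coef k l (i, j) = cnj (herm_coef l k (j, i) + \<i> * herm_coef l k (i, j))"
    unfolding herm_coef_cnj[of k l] complex_cnj_add complex_cnj_mult complex_cnj_i by (simp only: diff_conv_add_uminus mult_minus_left)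
  also have "\<dots> = (if i = l \<and> j = k then 2 else 0)"
    unfolding herm_coef_less[OF assms] by auto
  finally show ?thesis .
qed

lemma sum_herm_coef:
  "(\<Sum>a\<in>UNIV. herm_coef i j a * F a) = (if i = j then F (i, i)
     else if i < j then F (i, j) + \<i> * F (j, i) else F (j, i) - \<i> * F (i, j))"
proof -
  have "(\<Sum>a\<in>UNIV. of_bool (a = b) * F a) = F b" for b
    by (simp add: of_bool_def if_distrib[of "\<lambda>t. t * _"] cong: if_cong)
  then show ?thesis
    by (simp add: herm_coef_def distrib_right left_diff_distrib sum.distrib sum_subtractf mult.assoc flip: sum_distrib_left)
qed

lemma herm_of_eq: "herm_of x $ i $ j = (\<Sum>a\<in>UNIV. herm_coef i j a * of_real (x a))"
  unfolding sum_herm_coef by (auto simp: herm_of_def complex_eq_iff)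

text \<open>Off the diagonal the 2 from the two coordinates meets the variance 1/(2N), giving the
  same 1/N as on the diagonal. As no conjugate is taken, an entry is correlated with its
  transpose.\<close>

lemma herm_covariance:
  "(\<Sum>a\<in>UNIV. of_real ((herm_sd a)\<^sup>2) * herm_coef i j a * herm_coef k l a)
    = (if i = l \<and> j = k then 1 / of_nat CARD('n) else 0)" for i j :: "'n::{finite,linorder}"
proof -
  have "(\<Sum>a\<in>UNIV. of_real ((herm_sd a)\<^sup>2) * herm_coef i j a * herm_coef k l a)
      = (\<Sum>a\<in>UNIV. herm_coef i j a * (of_real ((herm_sd a)\<^sup>2) * herm_coef k l a))" by (simp add: mult_ac)
  also have "\<dots> = (if i = l \<and> j = k then 1 / of_nat CARD('n) else 0)"
  proof (cases i j rule: linorder_cases)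
    case less
    then have ij: "i \<noteq> j" by simp
    have f: "u * x + \<i> * (u * y) = u * (x + \<i> * y)" for u x y :: complex by (simp add: algebra_simps)
    show ?thesis
      unfolding sum_herm_coef herm_sd_sq if_not_P[OF ij] if_not_P[OF ij[symmetric]] if_P[OF less] f herm_coef_less[OF less]
      by simp
  next
    case equal
    show ?thesis
      unfolding sum_herm_coef herm_sd_sq equal if_P[OF refl] herm_coef_diag by auto
  next
    case greater
    then have ij: "i \<noteq> j" by simp
    have nl: "\<not> i < j" using greater by simp
    have f: "u * x - \<i> * (u * y) = u * (x - \<i> * y)" for u x y :: complex by (simp add: algebra_simps)
    show ?thesis
      unfolding sum_herm_coef herm_sd_sq if_not_P[OF ij] if_not_P[OF ij[symmetric]] if_not_P[OF nl] f herm_coef_greater[OF greater]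
      by simp
  qed
  finally show ?thesis .
qed

lemma measurable_herm_of [measurable]:
  "herm_of \<in> measurable (Pi\<^sub>M UNIV (\<lambda>_. lborel)) borel"
proof -
  have "(\<lambda>x. herm_of x \<bullet> b) \<in> borel_measurable (Pi\<^sub>M UNIV (\<lambda>_. lborel))" if "b \<in> Basis" for b :: "'n::{finite,linorder} cmat"
  proof -
    have "\<exists>i u. b = axis i u \<and> u \<in> Basis" using that by (subst (asm) Basis_vec_def) blast
    then obtain i u where u: "b = axis i u" "u \<in> Basis" by blast
    have "\<exists>j c. u = axis j c" using u(2) by (subst (asm) Basis_vec_def) blast
    then obtain j c where "u = axis j c" by blast
    with u have b: "b = axis i (axis j c)" by simp
    have "(\<lambda>x. herm_of x \<bullet> b) = (\<lambda>x. (\<Sum>a\<in>UNIV. herm_coef i j a * of_real (x a)) \<bullet> c)"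
      by (simp add: b inner_axis herm_of_eq)
    also have "\<dots> \<in> borel_measurable (Pi\<^sub>M UNIV (\<lambda>_. lborel))" by measurable
    finally show ?thesis .
  qed
  then show ?thesis by (subst borel_measurable_euclidean_space) blast
qed

lemma gue_weight_herm_of:
  "gue_weight (herm_of x :: 'n cmat) = (\<Prod>a\<in>UNIV. sqrt (2 * pi * (herm_sd (a :: 'n \<times> 'n))\<^sup>2)) * (\<Prod>a\<in>UNIV. normal_density 0 (herm_sd a) (x a))"
  for x :: "'n::{finite,linorder} \<times> 'n \<Rightarrow> real"
proof -
  let ?H = "herm_of x" and ?N = "real CARD('n)"
  have "Re (trace (?H ** conj_transpose ?H)) = (\<Sum>i\<in>UNIV. \<Sum>j\<in>UNIV. (cmod (?H $ i $ j))\<^sup>2)"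
    by (simp add: trace_def matrix_matrix_mult_def conj_transpose_def transpose_def complex_mult_cnj cmod_power2)
  also have "\<dots> = (\<Sum>i\<in>UNIV. \<Sum>j\<in>UNIV. if i = j then (x (i, i))\<^sup>2 else (x (i, j))\<^sup>2 + (x (j, i))\<^sup>2)"
    by (intro sum.cong refl) (auto simp: herm_of_def cmod_power2)
  \<comment> \<open>With the diagonal squares halved, the two summands are transposes of each other,
    and the sum is twice one in which every coordinate occurs once.\<close>
  also have "\<dots> = (\<Sum>i\<in>UNIV. \<Sum>j\<in>UNIV. (if i = j then (x (i, i))\<^sup>2 / 2 else (x (i, j))\<^sup>2) + (if j = i then (x (i, i))\<^sup>2 / 2 else (x (j, i))\<^sup>2))"
    by (intro sum.cong refl) auto
  also have "\<dots> = (\<Sum>i\<in>UNIV. \<Sum>j\<in>UNIV. if i = j then (x (i, i))\<^sup>2 / 2 else (x (i, j))\<^sup>2)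
      + (\<Sum>i\<in>UNIV. \<Sum>j\<in>UNIV. if j = i then (x (i, i))\<^sup>2 / 2 else (x (j, i))\<^sup>2)"
    by (simp add: sum.distrib)
  also have "(\<Sum>i\<in>UNIV. \<Sum>j\<in>UNIV. if j = i then (x (i, i))\<^sup>2 / 2 else (x (j, i))\<^sup>2)
      = (\<Sum>i\<in>UNIV. \<Sum>j\<in>UNIV. if i = j then (x (i, i))\<^sup>2 / 2 else (x (i, j))\<^sup>2)"
    by (subst sum.swap) (intro sum.cong refl, auto)
  finally have tr: "Re (trace (?H ** conj_transpose ?H)) = 2 * (\<Sum>i\<in>UNIV. \<Sum>j\<in>UNIV. if i = j then (x (i, i))\<^sup>2 / 2 else (x (i, j))\<^sup>2)"
    by simp
  have "- (?N / 2) * Re (trace (?H ** conj_transpose ?H))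
      = (\<Sum>i\<in>UNIV. \<Sum>j\<in>UNIV. - (x (i, j))\<^sup>2 / (2 * (herm_sd (i, j))\<^sup>2))"
    unfolding tr herm_sd_sq by (simp add: sum_distrib_left) (intro sum.cong refl, auto)
  also have "\<dots> = (\<Sum>a\<in>UNIV. - (x a)\<^sup>2 / (2 * (herm_sd a)\<^sup>2))"
    by (simp add: sum.cartesian_product case_prod_beta flip: UNIV_Times_UNIV)
  finally have "gue_weight ?H = (\<Prod>a\<in>UNIV. exp (- (x a)\<^sup>2 / (2 * (herm_sd a)\<^sup>2)))"
    by (simp add: gue_weight_def exp_sum)
  also have "\<dots> = (\<Prod>a\<in>UNIV. sqrt (2 * pi * (herm_sd a)\<^sup>2) * normal_density 0 (herm_sd a) (x a))"
  proof (rule prod.cong[OF refl])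
    fix a :: "'n \<times> 'n"
    show "exp (- (x a)\<^sup>2 / (2 * (herm_sd a)\<^sup>2)) = sqrt (2 * pi * (herm_sd a)\<^sup>2) * normal_density 0 (herm_sd a) (x a)"
      using herm_sd_pos[of a] unfolding normal_density_def by simp
  qed
  finally show ?thesis by (simp add: prod.distrib)
qed

lemma measurable_entry [measurable]: "(\<lambda>H :: 'n::finite cmat. H $ i $ j) \<in> borel_measurable borel"
  by (intro borel_measurable_continuous_onI continuous_intros)

lemma gue_weight_measurable [measurable]: "gue_weight \<in> borel_measurable (borel :: 'n::finite cmat measure)"
proof -
  have "gue_weight = (\<lambda>H :: 'n cmat. exp (- (real CARD('n) / 2) * (\<Sum>i\<in>UNIV. \<Sum>j\<in>UNIV. (cmod (H $ i $ j))\<^sup>2)))"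
    by (simp add: fun_eq_iff gue_weight_def trace_def matrix_matrix_mult_def conj_transpose_def transpose_def complex_mult_cnj cmod_power2)
  also have "\<dots> \<in> borel_measurable borel" by measurable
  finally show ?thesis .
qed

abbreviation herm_gauss :: "('n::{finite,linorder} \<times> 'n \<Rightarrow> real) measure" where
  "herm_gauss \<equiv> Pi\<^sub>M UNIV (\<lambda>a. normal_measure (herm_sd a))"

text \<open>Since the weight factors over the coordinates, the integral that
  \<open>gue_const\<close> inverts is the product \<open>?Z\<close> of the one-dimensional
  normalizing constants. It cancels and leaves independent normal coordinates.\<close>

lemma gue_eq_distr: "(gue :: 'n::{finite,linorder} cmat measure) = distr herm_gauss borel herm_of"
proof -
  let ?L = "Pi\<^sub>M UNIV (\<lambda>_::'n \<times> 'n. lborel :: real measure)"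
  let ?Z = "\<Prod>a\<in>UNIV. sqrt (2 * pi * (herm_sd (a :: 'n \<times> 'n))\<^sup>2)"
  let ?f = "\<lambda>x. \<Prod>a\<in>UNIV. normal_density 0 (herm_sd (a :: 'n \<times> 'n)) (x a)"
  interpret L: product_sigma_finite "\<lambda>_::'n \<times> 'n. lborel :: real measure" by standard
  have Z: "?Z > 0"
  proof (rule prod_pos)
    fix a :: "'n \<times> 'n"
    show "0 < sqrt (2 * pi * (herm_sd a)\<^sup>2)" using herm_sd_pos[of a] by simp
  qed
  have "(\<integral>H. gue_weight (H :: 'n cmat) \<partial>herm_lebesgue) = (\<integral>x. gue_weight (herm_of x :: 'n cmat) \<partial>?L)"
    unfolding herm_lebesgue_def by (rule integral_distr) measurable
  also have "\<dots> = ?Z * (\<integral>x. ?f x \<partial>?L)" unfolding gue_weight_herm_of by simp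
  also have "(\<integral>x. ?f x \<partial>?L) = (\<Prod>a\<in>UNIV. \<integral>x. normal_density 0 (herm_sd (a :: 'n \<times> 'n)) x \<partial>lborel)"
    by (rule L.product_integral_prod) (simp_all add: herm_sd_pos)
  also have "\<dots> = 1" by (simp add: herm_sd_pos)
  finally have c: "gue_const TYPE('n) = 1 / ?Z" by (simp add: gue_const_def)
  have "gue = distr (density ?L (\<lambda>x. ennreal (gue_const TYPE('n) * gue_weight (herm_of x :: 'n cmat)))) borel herm_of"
    unfolding gue_def herm_lebesgue_def by (rule density_distr) measurable
  also have "(\<lambda>x. ennreal (gue_const TYPE('n) * gue_weight (herm_of x :: 'n cmat))) = (\<lambda>x. \<Prod>a\<in>UNIV. ennreal (normal_density 0 (herm_sd a) (x a)))"
  proof -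
    have "1 / z * (z * y) = y" if "0 < z" for y z :: real using that by simp
    note this[OF Z]
    then show ?thesis unfolding c gue_weight_herm_of by (simp only: prod_ennreal[OF normal_density_nonneg])
  qed
  also have "density ?L \<dots> = herm_gauss"
    unfolding normal_measure_def
    by (rule density_PiM_prod) (auto intro!: prob_space_imp_sigma_finite prob_space_normal_density herm_sd_pos)
  finally show ?thesis .
qed

lemma measurable_herm_of_gauss [measurable]:
  "(herm_of :: _ \<Rightarrow> 'n::{finite,linorder} cmat) \<in> measurable herm_gauss borel"
proof -
  have "sets (herm_gauss :: ('n \<times> 'n \<Rightarrow> real) measure) = sets (Pi\<^sub>M UNIV (\<lambda>_. lborel))"
    by (rule sets_PiM_cong) simp_all
  then show ?thesis using measurable_herm_of measurable_cong_sets by blast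
qed

lemma prob_space_gue: "prob_space (gue :: 'n::{finite,linorder} cmat measure)"
  unfolding gue_eq_distr
  by (intro prob_space.prob_space_distr prob_space_PiM prob_space_normal_measure herm_sd_pos) measurable

lemma sets_gue [simp, measurable_cong]: "sets (gue :: 'n::{finite,linorder} cmat measure) = sets borel"
  by (simp add: gue_eq_distr)

text \<open>Each of the d/2 pairs carries a covariance 1/N. A power of 1/sqrt N avoids halving
  \<open>d\<close>; for odd \<open>d\<close> there are no pairings.\<close>

definition wick_weight :: "'n itself \<Rightarrow> nat \<Rightarrow> (nat \<Rightarrow> nat) \<Rightarrow> complex" where
  "wick_weight _ d z = (if z \<in> pairings {..<d} then of_real (1 / sqrt (real CARD('n))) ^ d else 0)"

lemma gue_moment_integrable:
  fixes i j :: "'k \<Rightarrow> 'n::{finite,linorder}"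
  assumes K: "finite K"
  shows "integrable gue (\<lambda>H :: 'n cmat. \<Prod>k\<in>K. H $ i k $ j k)"
proof -
  interpret moment_family "\<lambda>a. normal_measure (herm_sd a)" "\<lambda>a::'n \<times> 'n. (herm_sd a)\<^sup>2"
    by (rule moment_family_normal[OF herm_sd_pos])
  show ?thesis unfolding gue_eq_distr
    using prod_lin_integrable[OF K, of "\<lambda>k. herm_coef (i k) (j k)"]
    by (subst integrable_distr_eq) (simp_all add: herm_of_eq lin_def)
qed

lemma gue_moment:
  fixes i j :: "nat \<Rightarrow> 'n::{finite,linorder}"
  shows "(\<integral>H. (\<Prod>k<d. (H :: 'n cmat) $ i k $ j k) \<partial>gue)
    = (\<Sum>z\<in>Sy d. wick_weight TYPE('n) d z * (if \<forall>k<d. i k = j (z k) then 1 else 0))"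
proof -
  interpret moment_family "\<lambda>a. normal_measure (herm_sd a)" "\<lambda>a::'n \<times> 'n. (herm_sd a)\<^sup>2"
    by (rule moment_family_normal[OF herm_sd_pos])
  let ?c = "\<lambda>k. herm_coef (i k) (j k)"
  define v where "v = complex_of_real (1 / sqrt (real CARD('n)))"
  have "(1 / sqrt (real CARD('n)))\<^sup>2 = 1 / real CARD('n)" by (simp add: power_divide)
  then have v2: "v\<^sup>2 = 1 / of_nat CARD('n)" unfolding v_def of_real_power[symmetric] by simp
  have "(\<integral>H. (\<Prod>k<d. (H :: 'n cmat) $ i k $ j k) \<partial>gue) = (\<integral>x. (\<Prod>k<d. herm_of x $ i k $ j k) \<partial>herm_gauss)"
    unfolding gue_eq_distr by (rule integral_distr) measurable
  also have "\<dots> = EL ?c {..<d}" by (simp add: EL_def lin_def herm_of_eq)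
  also have "\<dots> = v ^ card {..<d} * (\<Sum>z\<in>pairings {..<d}. if \<forall>k\<in>{..<d}. i k = j (z k) then 1 else 0)"
  proof (rule wick_pairings)
    fix K :: "nat set" and k0 assume K: "finite K" "k0 \<notin> K"
    show "EL ?c (insert k0 K) = (\<Sum>k\<in>K. (if i k0 = j k \<and> j k0 = i k then v\<^sup>2 else 0) * EL ?c (K - {k}))"
      unfolding EL_stein[OF K] herm_covariance v2 ..
  qed (simp_all add: EL_empty)
  also have "\<dots> = (\<Sum>z\<in>pairings {..<d}. v ^ d * (if \<forall>k<d. i k = j (z k) then 1 else 0))"
    by (simp add: sum_distrib_left Ball_def)
  also have "\<dots> = (\<Sum>z\<in>Sy d. wick_weight TYPE('n) d z * (if \<forall>k<d. i k = j (z k) then 1 else 0))"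
  proof (rule sum.mono_neutral_cong_left)
    show "pairings {..<d} \<subseteq> Sy d" by (auto simp: pairings_def Sy_def)
  qed (auto simp: wick_weight_def v_def)
  finally show ?thesis .
qed

lemma class_fun_wick_weight: "class_fun d (wick_weight TYPE('n) d)"
  unfolding class_fun_def
proof (intro ballI)
  fix x h assume x: "x \<in> Sy d" and h: "h \<in> Sy d"
  have hi: "h (inv h y) = y" "inv h (h y) = y" for y
    using Sy_bij[OF h] by (simp_all add: bij_is_surj bij_is_inj surj_f_inv_f)
  have inj: "inv h a = inv h b \<longleftrightarrow> a = b" for a b using Sy_bij[OF Sy_inv[OF h]] by (simp add: bij_is_inj inj_eq)
  have "inv h \<circ> (x \<circ> h) \<in> Sy d" using x h by simp
  moreover have "(\<forall>k\<in>{..<d}. inv h (x (h k)) \<noteq> k \<and> inv h (x (h (inv h (x (h k))))) = k)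
      \<longleftrightarrow> (\<forall>k\<in>{..<d}. x k \<noteq> k \<and> x (x k) = k)" (is "?A \<longleftrightarrow> ?B")
  proof
    assume A: ?A
    show ?B
    proof
      fix k assume "k \<in> {..<d}"
      then have "inv h k \<in> {..<d}" using h by simp
      from bspec[OF A this] show "x k \<noteq> k \<and> x (x k) = k" by (simp add: hi inj)
    qed
  next
    assume B: ?B
    show ?A
    proof
      fix k assume "k \<in> {..<d}"
      then have "h k \<in> {..<d}" using h by simp
      from bspec[OF B this] show "inv h (x (h k)) \<noteq> k \<and> inv h (x (h (inv h (x (h k))))) = k"
        by (metis hi)
    qed
  qed
  ultimately show "wick_weight TYPE('n) d (inv h \<circ> (x \<circ> h)) = wick_weight TYPE('n) d x"
    using x by (simp add: wick_weight_def pairings_def Sy_def)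
qed

section \<open>Mixed moments of the ordered product\<close>

lemma foldr_mat_mult: "foldr (**) xs B = foldr (**) xs (mat 1) ** B"
  for B :: "'n::finite cmat"
  by (induction xs) (simp_all add: matrix_mul_assoc)

lemma ordered_prod_0 [simp]: "ordered_prod H 0 = mat 1"
  by (simp add: ordered_prod_def)

lemma ordered_prod_Suc: "ordered_prod H (Suc n) = ordered_prod H n ** H (Suc n)"
  using foldr_mat_mult[of "map H [1..<Suc n]" "H (Suc n)"]
  by (simp add: ordered_prod_def)

text \<open>The mixed moments of the entries of \<open>H\<^sub>1 \<dots> H\<^sub>n\<close>, with one new factor per step.\<close>

primrec prod_moment :: "nat \<Rightarrow> nat \<Rightarrow> (nat \<Rightarrow> 'n::{finite,linorder}) \<Rightarrow> (nat \<Rightarrow> 'n) \<Rightarrow> complex" where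
  "prod_moment d 0 f f' = (if \<forall>k<d. f k = f' k then 1 else 0)"
| "prod_moment d (Suc n) f f' = (\<Sum>h\<in>{..<d} \<rightarrow>\<^sub>E UNIV. prod_moment d n f h *
     (\<integral>H. (\<Prod>k<d. (H :: 'n cmat) $ h k $ f' k) \<partial>gue))"

lemma prod_moment_cong:
  fixes f f' f'' :: "nat \<Rightarrow> 'a::{finite,linorder}"
  assumes "\<And>k. k < d \<Longrightarrow> f' k = f'' k" shows "prod_moment d n f f' = prod_moment d n f f''"
proof (cases n)
  case 0
  have "(\<forall>k<d. f k = f' k) \<longleftrightarrow> (\<forall>k<d. f k = f'' k)" using assms by metis
  then show ?thesis by (simp only: 0 prod_moment.simps)
next
  case (Suc n)
  have "(\<Prod>k<d. H $ h k $ f' k) = (\<Prod>k<d. H $ h k $ f'' k)" for H :: "'a cmat" and h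
    by (rule prod.cong) (simp_all only: assms lessThan_iff)
  then show ?thesis by (simp only: Suc prod_moment.simps)
qed

text \<open>In each Wick term the constraint determines the intermediate index map as
  \<open>f' \<circ> z\<close>. The contraction collapses, and all that is left of the new factor is
  the action of \<open>z\<close> on the outer indices.\<close>

lemma prod_moment_step:
  fixes f f' :: "nat \<Rightarrow> 'n::{finite,linorder}"
  shows "prod_moment d (Suc n) f f' = (\<Sum>z\<in>Sy d. wick_weight TYPE('n) d z * prod_moment d n f (f' \<circ> z))"
proof -
  have "(\<Sum>h\<in>{..<d} \<rightarrow>\<^sub>E UNIV. prod_moment d n f h * (if \<forall>k<d. h k = f' (z k) then 1 else 0))
      = prod_moment d n f (f' \<circ> z)" for z
  proof -
    let ?h = "restrict (f' \<circ> z) {..<d}"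
    have "(\<forall>k<d. h k = f' (z k)) \<longleftrightarrow> h = ?h" if "h \<in> {..<d} \<rightarrow>\<^sub>E UNIV" for h :: "nat \<Rightarrow> 'n"
      using that by (auto simp: fun_eq_iff restrict_def PiE_iff extensional_def)
    note eq = this
    have "(\<Sum>h\<in>{..<d} \<rightarrow>\<^sub>E UNIV. prod_moment d n f h * (if \<forall>k<d. h k = f' (z k) then 1 else 0))
        = (\<Sum>h\<in>{..<d} \<rightarrow>\<^sub>E UNIV. if h = ?h then prod_moment d n f h else 0)"
    proof (rule sum.cong[OF refl])
      fix h :: "nat \<Rightarrow> 'n" assume h: "h \<in> {..<d} \<rightarrow>\<^sub>E UNIV"
      show "prod_moment d n f h * (if \<forall>k<d. h k = f' (z k) then 1 else 0)
          = (if h = ?h then prod_moment d n f h else 0)"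
        unfolding eq[OF h] by (simp only: if_distrib[of "\<lambda>t. _ * t"] mult_1_right mult_zero_right)
    qed
    also have "\<dots> = prod_moment d n f ?h"
      by (subst sum.delta) (auto intro: finite_PiE)
    also have "\<dots> = prod_moment d n f (f' \<circ> z)" by (rule prod_moment_cong) simp
    finally show ?thesis .
  qed
  note delta = this
  have "prod_moment d (Suc n) f f' = (\<Sum>h\<in>{..<d} \<rightarrow>\<^sub>E UNIV. \<Sum>z\<in>Sy d.
      wick_weight TYPE('n) d z * (prod_moment d n f h * (if \<forall>k<d. h k = f' (z k) then 1 else 0)))"
    unfolding prod_moment.simps gue_moment sum_distrib_left by (intro sum.cong refl) (rule mult.left_commute)
  also have "\<dots> = (\<Sum>z\<in>Sy d. wick_weight TYPE('n) d z * (\<Sum>h\<in>{..<d} \<rightarrow>\<^sub>E UNIV.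
      prod_moment d n f h * (if \<forall>k<d. h k = f' (z k) then 1 else 0)))"
    by (subst sum.swap) (simp only: sum_distrib_left)
  finally show ?thesis unfolding delta .
qed

text \<open>The factors \<open>u i\<close> hold functions of the matrices already split off from the
  product, so the induction stays on the one product measure over \<open>{1..m}\<close>. At n = 0
  only functions of separate matrices remain, where independence applies.\<close>

lemma ordered_prod_moment_aux:
  fixes f f' :: "nat \<Rightarrow> 'n::{finite,linorder}" and u :: "nat \<Rightarrow> 'n cmat \<Rightarrow> complex"
  assumes "n \<le> m" "\<And>i. integrable gue (u i)"
  shows "integrable (Pi\<^sub>M {1..m} (\<lambda>_. gue)) (\<lambda>H. (\<Prod>k<d. ordered_prod H n $ f k $ f' k) * (\<Prod>i\<in>{n<..m}. u i (H i)))
    \<and> (\<integral>H. (\<Prod>k<d. ordered_prod H n $ f k $ f' k) * (\<Prod>i\<in>{n<..m}. u i (H i)) \<partial>Pi\<^sub>M {1..m} (\<lambda>_. gue))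
      = prod_moment d n f f' * (\<Prod>i\<in>{n<..m}. \<integral>H. u i H \<partial>gue)"
  using assms
proof (induction n arbitrary: f' u)
  case 0
  interpret product_sigma_finite "\<lambda>_::nat. gue :: 'n cmat measure"
    by (rule product_sigma_finite.intro) (rule prob_space_imp_sigma_finite[OF prob_space_gue])
  have iv: "{0<..m} = {1..m}" by auto
  have p: "(\<Prod>k<d. (mat 1 :: 'n cmat) $ f k $ f' k) = prod_moment d 0 f f'"
    by (auto simp: mat_def prod_zero_iff)
  have "integrable (Pi\<^sub>M {1..m} (\<lambda>_. gue)) (\<lambda>H. \<Prod>i\<in>{1..m}. u i (H i))"
    by (rule product_integrable_prod) (simp_all add: 0)
  moreover have "(\<integral>H. (\<Prod>i\<in>{1..m}. u i (H i)) \<partial>Pi\<^sub>M {1..m} (\<lambda>_. gue)) = (\<Prod>i\<in>{1..m}. \<integral>H. u i H \<partial>gue)"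
    by (rule product_integral_prod) (simp_all add: 0)
  ultimately show ?case unfolding iv ordered_prod_0 p by simp
next
  case (Suc n)
  let ?M = "Pi\<^sub>M {1..m} (\<lambda>_. gue :: 'n cmat measure)"
  \<comment> \<open>The entries of the last matrix are handed to slot \<open>Suc n\<close>, which
    does not occur in the product over \<open>{Suc n<..m}\<close>.\<close>
  define v where "v h = u(Suc n := (\<lambda>H. \<Prod>k<d. H $ h k $ f' k))" for h
  have vint: "integrable gue (v h i)" for h i
    using Suc.prems(2) gue_moment_integrable[of "{..<d}" h f'] by (simp add: v_def)
  have iv: "{n<..m} = insert (Suc n) {Suc n<..m}" using Suc.prems(1) by auto
  have vp: "(\<Prod>i\<in>{n<..m}. w (v h i) i) = w (\<lambda>H. \<Prod>k<d. H $ h k $ f' k) (Suc n) * (\<Prod>i\<in>{Suc n<..m}. w (u i) i)"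
    for h and w :: "('n cmat \<Rightarrow> complex) \<Rightarrow> nat \<Rightarrow> complex"
  proof -
    have "(\<Prod>i\<in>{Suc n<..m}. w (v h i) i) = (\<Prod>i\<in>{Suc n<..m}. w (u i) i)"
      by (rule prod.cong) (auto simp: v_def)
    then show ?thesis unfolding iv by (simp add: v_def)
  qed
  let ?g = "\<lambda>h H. (\<Prod>k<d. ordered_prod H n $ f k $ h k) * (\<Prod>i\<in>{n<..m}. v h i (H i))"
  have expand: "(\<Prod>k<d. ordered_prod H (Suc n) $ f k $ f' k) * (\<Prod>i\<in>{Suc n<..m}. u i (H i))
      = (\<Sum>h\<in>{..<d} \<rightarrow>\<^sub>E UNIV. ?g h H)" for H
  proof -
    have "(\<Prod>k<d. ordered_prod H (Suc n) $ f k $ f' k)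
        = (\<Sum>h\<in>{..<d} \<rightarrow>\<^sub>E UNIV. \<Prod>k<d. ordered_prod H n $ f k $ h k * H (Suc n) $ h k $ f' k)"
      unfolding ordered_prod_Suc matrix_matrix_mult_def vec_lambda_beta
      by (rule prod_sum_PiE) simp_all
    then show ?thesis
      by (simp add: vp[of "\<lambda>v i. v (H i)"] prod.distrib sum_distrib_right mult.assoc)
  qed
  have IH: "integrable ?M (?g h)" "(\<integral>H. ?g h H \<partial>?M) = prod_moment d n f h * (\<Prod>i\<in>{n<..m}. \<integral>H. v h i H \<partial>gue)" for h
    using Suc.IH[of "v h" h] vint Suc.prems(1) by auto
  have "integrable ?M (\<lambda>H. \<Sum>h\<in>{..<d} \<rightarrow>\<^sub>E UNIV. ?g h H)"
    by (rule Bochner_Integration.integrable_sum) (rule IH(1))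
  moreover have "(\<integral>H. (\<Sum>h\<in>{..<d} \<rightarrow>\<^sub>E UNIV. ?g h H) \<partial>?M) = (\<Sum>h\<in>{..<d} \<rightarrow>\<^sub>E UNIV. \<integral>H. ?g h H \<partial>?M)"
    by (rule Bochner_Integration.integral_sum) (rule IH(1))
  moreover have "\<dots> = prod_moment d (Suc n) f f' * (\<Prod>i\<in>{Suc n<..m}. \<integral>H. u i H \<partial>gue)"
    unfolding IH(2) vp[of "\<lambda>v i. \<integral>H. v H \<partial>gue"] by (simp add: sum_distrib_right mult.assoc)
  ultimately show ?case unfolding expand by simp
qed

lemma ordered_prod_moment:
  fixes f f' :: "nat \<Rightarrow> 'n::{finite,linorder}"
  shows "integrable (Pi\<^sub>M {1..n} (\<lambda>_. gue)) (\<lambda>H. \<Prod>k<d. ordered_prod H n $ f k $ f' k)"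
    and "(\<integral>H. (\<Prod>k<d. ordered_prod H n $ f k $ f' k) \<partial>Pi\<^sub>M {1..n} (\<lambda>_. gue)) = prod_moment d n f f'"
proof -
  have "integrable gue (\<lambda>_ :: 'n cmat. 0 :: complex)" by simp
  from ordered_prod_moment_aux[where n = n and m = n and d = d and f = f and f' = f', OF order_refl this]
  show "integrable (Pi\<^sub>M {1..n} (\<lambda>_. gue)) (\<lambda>H. \<Prod>k<d. ordered_prod H n $ f k $ f' k)"
    "(\<integral>H. (\<Prod>k<d. ordered_prod H n $ f k $ f' k) \<partial>Pi\<^sub>M {1..n} (\<lambda>_. gue)) = prod_moment d n f f'"
    by simp_all
qed

definition trace_moment :: "'n::{finite,linorder} itself \<Rightarrow> nat \<Rightarrow> nat multiset \<Rightarrow> complex" where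
  "trace_moment _ n M = (\<integral>H. (\<Prod>m\<in>#M. trace (mat_pow (ordered_prod H n :: 'n cmat) m)) \<partial>Pi\<^sub>M {1..n} (\<lambda>_. gue))"

lemma trace_moment_cycle_type:
  assumes g: "g \<in> Sy d"
  shows "trace_moment TYPE('n::{finite,linorder}) n (cycle_type d g)
    = (\<Sum>f\<in>{..<d} \<rightarrow>\<^sub>E (UNIV :: 'n set). prod_moment d n f (f \<circ> g))"
  unfolding trace_moment_def prod_trace_cycle_type[OF g] o_def ordered_prod_moment(2)[symmetric]
  by (rule Bochner_Integration.integral_sum) (rule ordered_prod_moment(1))

lemma trace_moment_Suc:
  assumes g: "g \<in> Sy d"
  shows "trace_moment TYPE('n::{finite,linorder}) (Suc n) (cycle_type d g)
    = (\<Sum>z\<in>Sy d. wick_weight TYPE('n) d z * trace_moment TYPE('n) n (cycle_type d (g \<circ> z)))"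
proof -
  have "trace_moment TYPE('n) (Suc n) (cycle_type d g)
      = (\<Sum>f\<in>{..<d} \<rightarrow>\<^sub>E (UNIV :: 'n set). \<Sum>z\<in>Sy d. wick_weight TYPE('n) d z * prod_moment d n f (f \<circ> (g \<circ> z)))"
    unfolding trace_moment_cycle_type[OF g] prod_moment_step comp_assoc ..
  also have "\<dots> = (\<Sum>z\<in>Sy d. wick_weight TYPE('n) d z * (\<Sum>f\<in>{..<d} \<rightarrow>\<^sub>E (UNIV :: 'n set). prod_moment d n f (f \<circ> (g \<circ> z))))"
    by (subst sum.swap) (simp only: sum_distrib_left)
  also have "\<dots> = (\<Sum>z\<in>Sy d. wick_weight TYPE('n) d z * trace_moment TYPE('n) n (cycle_type d (g \<circ> z)))"
    by (intro sum.cong refl) (simp add: trace_moment_cycle_type[OF Sy_comp[OF g]])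
  finally show ?thesis .
qed

lemma trace_moment_0:
  assumes g: "g \<in> Sy d"
  shows "trace_moment TYPE('n::{finite,linorder}) 0 (cycle_type d g)
    = (\<Sum>f\<in>{..<d} \<rightarrow>\<^sub>E (UNIV :: 'n set). if \<forall>k<d. f (g k) = f k then 1 else 0)"
  unfolding trace_moment_cycle_type[OF g] by (intro sum.cong refl) (auto simp: eq_commute)

section \<open>Coefficients of the two formal power series\<close>

lemma coeff_zero_mps [simp]: "coeff_mps 0 M = 0"
  and coeff_plus_mps [simp]: "coeff_mps (f + g) M = coeff_mps f M + coeff_mps g M"
  by (simp_all add: zero_mps_def plus_mps_def)

lemma coeff_sum_mps: "coeff_mps (sum f A) M = (\<Sum>a\<in>A. coeff_mps (f a) M)"
  by (induction A rule: infinite_finite_induct) simp_all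

lemma coeff_mps_const_mult: "coeff_mps (mps_const c * f) M = c * coeff_mps f M"
proof -
  have "coeff_mps (mps_const c * f) M = (\<Sum>P\<in>{(A, B). A + B = M}. if P = ({#}, M) then c * coeff_mps f M else 0)"
    unfolding times_mps_def mps_const_def coeff_Abs_mps by (rule sum.cong) (auto split: if_splits)
  then show ?thesis by (simp only: sum.delta[OF finite_mset_splits]) simp
qed

lemma coeff_mult_mps_const: "coeff_mps (f * mps_const c) M = c * coeff_mps f M"
  using coeff_mps_const_mult[of c f M] by (simp add: mult.commute)

lemma of_nat_mps: "of_nat n = mps_const (of_nat n :: complex)"
  by (induction n) (auto intro!: mps_eqI simp: mps_const_def one_mps_def)

text \<open>A series that is a linear form \<open>\<Sum>\<^sub>m a\<^sub>m p\<^sub>m\<close>.\<close>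

definition linear_mps :: "(nat \<Rightarrow> complex) \<Rightarrow> complex mps" where
  "linear_mps a = Abs_mps (\<lambda>M. if size M = 1 then a (the_elem (set_mset M)) else 0)"

lemma coeff_linear_mps_mult:
  "coeff_mps (linear_mps a * f) M = (\<Sum>m\<in>set_mset M. a m * coeff_mps f (M - {#m#}))"
proof -
  let ?S = "{(A, B). A + B = M}"
  have "(\<Sum>m\<in>set_mset M. a m * coeff_mps f (M - {#m#})) = (\<Sum>(A, B)\<in>(\<lambda>m. ({#m#}, M - {#m#})) ` set_mset M. coeff_mps (linear_mps a) A * coeff_mps f B)"
    by (subst sum.reindex) (auto simp: inj_on_def linear_mps_def)
  also have "\<dots> = (\<Sum>(A, B)\<in>?S. coeff_mps (linear_mps a) A * coeff_mps f B)"
  proof (rule sum.mono_neutral_left)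
    show "\<forall>i\<in>?S - (\<lambda>m. ({#m#}, M - {#m#})) ` set_mset M. (case i of (A, B) \<Rightarrow> coeff_mps (linear_mps a) A * coeff_mps f B) = 0"
    proof
      fix i assume i: "i \<in> ?S - (\<lambda>m. ({#m#}, M - {#m#})) ` set_mset M"
      obtain A B where AB: "i = (A, B)" "A + B = M" using i by auto
      have "size A \<noteq> 1"
      proof
        assume "size A = 1"
        then obtain m where "A = {#m#}" by (metis size_1_singleton_mset)
        then show False using i AB by auto
      qed
      then show "(case i of (A, B) \<Rightarrow> coeff_mps (linear_mps a) A * coeff_mps f B) = 0"
        by (simp add: AB linear_mps_def)
    qed
  qed (auto simp: finite_mset_splits)
  finally show ?thesis by (simp add: times_mps_def)
qed

text \<open>The coefficient of the monomial \<open>M\<close> in the exponential of the linear form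
  with coefficients \<open>a\<close>; see \<open>coeff_mps_exp_linear\<close>.\<close>

definition exp_weight :: "(nat \<Rightarrow> complex) \<Rightarrow> nat multiset \<Rightarrow> complex" where
  "exp_weight a M = (\<Prod>m\<in>set_mset M. a m ^ count M m / fact (count M m))"

lemma exp_weight_superset:
  assumes "finite A" "set_mset M \<subseteq> A"
  shows "exp_weight a M = (\<Prod>m\<in>A. a m ^ count M m / fact (count M m))"
  unfolding exp_weight_def using assms by (intro prod.mono_neutral_left) (auto simp: not_in_iff)

lemma exp_weight_add: "of_nat (Suc (count M m)) * exp_weight a (add_mset m M) = a m * exp_weight a M"
proof -
  let ?A = "insert m (set_mset M)" let ?B = "?A - {m}"
  let ?R = "\<Prod>i\<in>?B. a i ^ count M i / fact (count M i)"
  have "exp_weight a (add_mset m M) = (\<Prod>i\<in>?A. a i ^ count (add_mset m M) i / fact (count (add_mset m M) i))"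
    by (rule exp_weight_superset) auto
  also have "\<dots> = a m ^ Suc (count M m) / fact (Suc (count M m)) * (\<Prod>i\<in>?B. a i ^ count (add_mset m M) i / fact (count (add_mset m M) i))"
    by (subst prod.remove[of ?A m]) auto
  also have "(\<Prod>i\<in>?B. a i ^ count (add_mset m M) i / fact (count (add_mset m M) i)) = ?R"
    by (rule prod.cong) auto
  finally have 1: "exp_weight a (add_mset m M) = a m ^ Suc (count M m) / fact (Suc (count M m)) * ?R" .
  have "exp_weight a M = (\<Prod>i\<in>?A. a i ^ count M i / fact (count M i))"
    by (rule exp_weight_superset) auto
  also have "\<dots> = a m ^ count M m / fact (count M m) * ?R"
    by (subst prod.remove[of ?A m]) auto
  finally have 2: "exp_weight a M = a m ^ count M m / fact (count M m) * ?R" .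
  have "of_nat (Suc c) * (a m ^ Suc c / fact (Suc c)) = a m * (a m ^ c / fact c)" for c
    by (simp add: field_simps del: of_nat_Suc)
  then show ?thesis unfolding 1 2 by (simp only: mult.assoc[symmetric])
qed

text \<open>The multinomial theorem. Splitting off one factor removes an index m from
  \<open>M\<close>; by \<open>exp_weight_add\<close> this costs the factor \<open>count M m\<close>,
  and the multiplicities add up to the exponent.\<close>

lemma coeff_linear_mps_power:
  "coeff_mps (linear_mps a ^ k) M = (if size M = k then fact k * exp_weight a M else 0)"
proof (induction k arbitrary: M)
  case 0
  then show ?case by (auto simp: one_mps_def exp_weight_def)
next
  case (Suc k)
  have "coeff_mps (linear_mps a ^ Suc k) M = (\<Sum>m\<in>set_mset M. a m * coeff_mps (linear_mps a ^ k) (M - {#m#}))"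
    by (simp add: coeff_linear_mps_mult)
  also have "\<dots> = (\<Sum>m\<in>set_mset M. if size M = Suc k then fact k * (of_nat (count M m) * exp_weight a M) else 0)"
  proof (rule sum.cong[OF refl])
    fix m assume "m \<in># M"
    then obtain B where B: "M = add_mset m B" by (metis insert_DiffM)
    have "a m * exp_weight a B = of_nat (count M m) * exp_weight a M"
      unfolding B using exp_weight_add[of B m a] by simp
    then show "a m * coeff_mps (linear_mps a ^ k) (M - {#m#})
        = (if size M = Suc k then fact k * (of_nat (count M m) * exp_weight a M) else 0)"
      unfolding Suc.IH using B by simp
  qed
  also have "\<dots> = (if size M = Suc k then fact k * (of_nat (\<Sum>m\<in>set_mset M. count M m) * exp_weight a M) else 0)"
    by (simp add: sum_distrib_left sum_distrib_right)
  also have "(\<Sum>m\<in>set_mset M. count M m) = size M" by (simp add: size_multiset_overloaded_eq)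
  finally show ?case by (simp add: algebra_simps)
qed

lemma coeff_mps_exp_linear: "coeff_mps (mps_exp (linear_mps a)) M = exp_weight a M"
proof -
  let ?c = "\<lambda>k. coeff_mps (mps_const (1 / fact k) * linear_mps a ^ k) M"
  have c: "?c k = (if k = size M then exp_weight a M else 0)" for k
    by (auto simp: coeff_mps_const_mult coeff_linear_mps_power)
  have "coeff_mps (mps_exp (linear_mps a)) M = (\<Sum>k | k \<in> UNIV \<and> ?c k \<noteq> 0. ?c k)"
    by (simp add: mps_exp_def mps_sum_def)
  also have "\<dots> = (\<Sum>k\<in>{size M}. ?c k)"
    by (rule sum.mono_neutral_left) (auto simp: c)
  finally show ?thesis by (simp add: c)
qed

lemma coeff_mps_const_var: "coeff_mps (mps_const c * mps_var m) M = (if M = {#m#} then c else 0)"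
  by (simp add: coeff_mps_const_mult mps_var_def)

text \<open>The linear form on the right also has an index 0, but its coefficient is a quotient by 0
  and hence 0, in accordance with the sum over \<open>{1..}\<close>.\<close>

lemma mps_sum_linear:
  "of_nat N * mps_sum (\<lambda>m. mps_const (t m / of_nat m) * mps_var m) {1..}
     = linear_mps (\<lambda>m. of_nat N * t m / of_nat m)"
proof (rule mps_eqI)
  fix M
  let ?c = "\<lambda>m. coeff_mps (mps_const (t m / of_nat m) * mps_var m) M"
  have "coeff_mps (mps_sum (\<lambda>m. mps_const (t m / of_nat m) * mps_var m) {1..}) M = (\<Sum>m | m \<in> {1..} \<and> ?c m \<noteq> 0. ?c m)"
    by (simp add: mps_sum_def)
  also have "\<dots> = (if size M = 1 then t (the_elem (set_mset M)) / of_nat (the_elem (set_mset M)) else 0)"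
  proof (cases "size M = 1")
    case True
    then obtain m where m: "M = {#m#}" by (metis size_1_singleton_mset)
    have "(\<Sum>k | k \<in> {1..} \<and> ?c k \<noteq> 0. ?c k) = (\<Sum>k\<in>{m}. ?c k)"
      by (rule sum.mono_neutral_left) (auto simp: coeff_mps_const_var m)
    then show ?thesis by (simp add: m coeff_mps_const_var)
  next
    case False
    then have "?c k = 0" for k by (auto simp: coeff_mps_const_var)
    then show ?thesis using False by simp
  qed
  finally show "coeff_mps (of_nat N * mps_sum (\<lambda>m. mps_const (t m / of_nat m) * mps_var m) {1..}) M
      = coeff_mps (linear_mps (\<lambda>m. of_nat N * t m / of_nat m)) M"
    by (simp add: of_nat_mps coeff_mps_const_mult linear_mps_def)
qed

lemma exp_weight_zero: "a 0 = 0 \<Longrightarrow> 0 \<in># M \<Longrightarrow> exp_weight a M = 0"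
  unfolding exp_weight_def by (auto simp: prod_zero_iff)

text \<open>The denominators m of the exponent and the factorials of the exponential series combine
  to z_M, the weight of a conjugacy class.\<close>

lemma exp_weight_eq:
  assumes "0 \<notin># M"
  shows "exp_weight (\<lambda>m. x * t m / of_nat m) M = x ^ size M / of_nat (z_mset M) * (\<Prod>m\<in>#M. t m)"
proof -
  have "exp_weight (\<lambda>m. x * t m / of_nat m) M
      = (\<Prod>m\<in>set_mset M. x ^ count M m * (1 / of_nat (fact (count M m) * m ^ count M m)) * t m ^ count M m)"
    unfolding exp_weight_def by (intro prod.cong refl) (simp add: power_mult_distrib power_divide)
  also have "\<dots> = x ^ (\<Sum>m\<in>set_mset M. count M m) * (1 / of_nat (z_mset M)) * (\<Prod>m\<in>#M. t m)"
    by (simp add: prod.distrib prod_dividef z_mset_def power_sum image_prod_mset_multiplicity)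
  finally show ?thesis by (simp add: size_multiset_overloaded_eq)
qed

lemma coeff_prod_list_var:
  "coeff_mps (prod_list (map (\<lambda>m. of_nat N * mps_var m) mu)) M
     = (if M = mset mu then of_nat N ^ length mu else (0 :: complex))"
proof (induction mu arbitrary: M)
  case Nil
  then show ?case by (simp add: one_mps_def)
next
  case (Cons m mu)
  have l: "mps_var m = linear_mps (\<lambda>i. if i = m then 1 else 0)"
  proof (rule mps_eqI)
    fix K
    show "coeff_mps (mps_var m) K = coeff_mps (linear_mps (\<lambda>i. if i = m then 1 else 0)) K"
    proof (cases "size K = 1")
      case True
      then obtain x where "K = {#x#}" by (metis size_1_singleton_mset)
      then show ?thesis by (simp add: mps_var_def linear_mps_def)
    next
      case False
      then show ?thesis by (auto simp: mps_var_def linear_mps_def)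
    qed
  qed
  have "coeff_mps (prod_list (map (\<lambda>m. of_nat N * mps_var m) (m # mu))) M
      = of_nat N * (\<Sum>i\<in>set_mset M. (if i = m then 1 else 0) * (if M - {#i#} = mset mu then of_nat N ^ length mu else (0 :: complex)))"
    by (simp add: of_nat_mps coeff_mps_const_mult mult.assoc l coeff_linear_mps_mult Cons.IH[unfolded of_nat_mps])
  also have "(\<Sum>i\<in>set_mset M. (if i = m then 1 else 0) * (if M - {#i#} = mset mu then of_nat N ^ length mu else (0 :: complex)))
      = (\<Sum>i\<in>set_mset M. if i = m then (if M - {#m#} = mset mu then of_nat N ^ length mu else 0) else 0)"
    by (rule sum.cong) auto
  also have "\<dots> = (if m \<in># M \<and> M - {#m#} = mset mu then of_nat N ^ length mu else 0)"
    by simp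
  also have "(m \<in># M \<and> M - {#m#} = mset mu) \<longleftrightarrow> M = mset (m # mu)"
    by (metis add_mset_remove_trivial insert_DiffM mset.simps(2) union_single_eq_member)
  finally show ?case by simp
qed

lemma coeff_schur_mps:
  "coeff_mps (schur_mps la (\<lambda>m. of_nat N * mps_var m)) M
    = (\<Sum>mu\<in>partitions_of (sum_list la). if M = mset mu then sym_char la mu / of_nat (z_part mu) * of_nat N ^ size M else 0)"
  by (auto simp: schur_mps_def schur_gen_def coeff_sum_mps coeff_mps_const_mult coeff_prod_list_var intro!: sum.cong)

section \<open>The character expansion\<close>

text \<open>The same choice as inside \<open>sym_char\<close>, so that \<open>sym_char_eq\<close>
  compares values at one and the same permutation.\<close>

definition cycle_rep :: "nat \<Rightarrow> nat multiset \<Rightarrow> nat \<Rightarrow> nat" where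
  "cycle_rep d M = (SOME g. g \<in> Sy d \<and> cycle_type d g = M)"

lemma cycle_rep: "M \<in> mparts d \<Longrightarrow> cycle_rep d M \<in> Sy d \<and> cycle_type d (cycle_rep d M) = M"
  using someI_ex[of "\<lambda>g. g \<in> Sy d \<and> cycle_type d g = M"] exists_cycle_type[of M d]
  unfolding cycle_rep_def by blast

lemma irrep_char_cycle_type:
  assumes "g \<in> Sy (sum_list la)" "g' \<in> Sy (sum_list la)" "cycle_type (sum_list la) g = cycle_type (sum_list la) g'"
  shows "irrep_char la g = irrep_char la g'"
  by (rule class_fun_cycle_type[OF class_fun_irrep_char assms])

lemma irrep_char_cycle_rep:
  assumes "g \<in> Sy (sum_list la)"
  shows "irrep_char la (cycle_rep (sum_list la) (cycle_type (sum_list la) g)) = irrep_char la g"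
  using cycle_rep[OF cycle_type_mparts[OF assms]] assms by (intro irrep_char_cycle_type) auto

lemma irrep_char_inv: "g \<in> Sy (sum_list la) \<Longrightarrow> irrep_char la (inv g) = irrep_char la g"
  by (intro irrep_char_cycle_type) (simp_all add: cycle_type_inv)

lemma sym_char_eq:
  assumes mu: "mset mu \<in> mparts (sum_list la)"
  shows "sym_char la mu = irrep_char la (cycle_rep (sum_list la) (mset mu))"
proof -
  have "(SOME g. g permutes {..<sum_list la} \<and> cycle_type (sum_list la) g = mset mu) = cycle_rep (sum_list la) (mset mu)"
    by (simp add: cycle_rep_def Sy_def)
  then show ?thesis
    using cycle_rep[OF mu] by (simp add: sym_char_def trace_irrep)
qed

text \<open>The Schur function with each power sum monomial replaced by the value of
  \<open>F\<close>, that is, the pairing of the character with \<open>F\<close>. The symmetrizer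
  stands in for the character by \<open>sum_irrep_char_class_fun\<close>.\<close>

definition schur_value :: "nat list \<Rightarrow> (nat multiset \<Rightarrow> complex) \<Rightarrow> complex" where
  "schur_value la F = (\<Sum>y\<in>Sy (sum_list la). young_symmetrizer la y * F (cycle_type (sum_list la) y)) / young_scale la"

lemma sum_Sy_irrep_char:
  "(\<Sum>g\<in>Sy (sum_list la). irrep_char la g * F (cycle_type (sum_list la) g)) = fact (sum_list la) * schur_value la F"
proof -
  have "(\<Sum>g\<in>Sy (sum_list la). irrep_char la g * F (cycle_type (sum_list la) g))
      = (\<Sum>g\<in>Sy (sum_list la). irrep_char la g * F (cycle_type (sum_list la) (inv g)))"
    by (rule sum.cong) (simp_all add: cycle_type_inv)
  also have "\<dots> = fact (sum_list la) * schur_value la F"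
    using sum_irrep_char_class_fun[OF class_fun_of_cycle_type[of "sum_list la" F]]
    by (simp add: schur_value_def)
  finally show ?thesis .
qed

lemma sum_mparts_irrep_char:
  "(\<Sum>M\<in>mparts (sum_list la). irrep_char la (cycle_rep (sum_list la) M) * F M / of_nat (z_mset M)) = schur_value la F"
proof -
  let ?d = "sum_list la"
  have "(\<Sum>M\<in>mparts ?d. irrep_char la (cycle_rep ?d M) * F M / of_nat (z_mset M))
      = (\<Sum>g\<in>Sy ?d. irrep_char la (cycle_rep ?d (cycle_type ?d g)) * F (cycle_type ?d g)) / fact ?d"
    by (rule sum_mparts_eq_sum_Sy)
  also have "\<dots> = (\<Sum>g\<in>Sy ?d. irrep_char la g * F (cycle_type ?d g)) / fact ?d"
    by (simp add: irrep_char_cycle_rep cong: sum.cong)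
  finally show ?thesis by (simp add: sum_Sy_irrep_char)
qed

lemma sum_partitions_sym_char:
  "(\<Sum>mu\<in>partitions_of (sum_list la). 1 / of_nat (z_part mu) * sym_char la mu * F (mset mu)) = schur_value la F"
proof -
  let ?d = "sum_list la"
  have "(\<Sum>mu\<in>partitions_of ?d. 1 / of_nat (z_part mu) * sym_char la mu * F (mset mu))
      = (\<Sum>mu\<in>partitions_of ?d. irrep_char la (cycle_rep ?d (mset mu)) * F (mset mu) / of_nat (z_mset (mset mu)))"
  proof (rule sum.cong[OF refl])
    fix mu assume "mu \<in> partitions_of ?d"
    then have "mset mu \<in> mparts ?d" using bij_mset_partitions bij_betwE by blast
    then show "1 / of_nat (z_part mu) * sym_char la mu * F (mset mu)
        = irrep_char la (cycle_rep ?d (mset mu)) * F (mset mu) / of_nat (z_mset (mset mu))"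
      by (simp add: sym_char_eq z_part_eq)
  qed
  also have "\<dots> = schur_value la F"
    unfolding sum_mparts_irrep_char[symmetric] by (rule sum.reindex_bij_betw[OF bij_mset_partitions])
  finally show ?thesis .
qed

lemma irrep_char_orthonormal:
  assumes la: "la \<in> partitions_of d" and mu: "mu \<in> partitions_of d"
  shows "(\<Sum>M\<in>mparts d. irrep_char la (cycle_rep d M) * irrep_char mu (cycle_rep d M) / of_nat (z_mset M))
    = (if la = mu then 1 else 0)"
proof -
  have d: "sum_list la = d" "sum_list mu = d" "la \<in> partitions" "mu \<in> partitions"
    using la mu by (simp_all add: partitions_of_def)
  have "(\<Sum>M\<in>mparts d. irrep_char la (cycle_rep d M) * irrep_char mu (cycle_rep d M) / of_nat (z_mset M))
      = (\<Sum>g\<in>Sy d. irrep_char la (cycle_rep d (cycle_type d g)) * irrep_char mu (cycle_rep d (cycle_type d g))) / fact d"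
    by (rule sum_mparts_eq_sum_Sy)
  also have "(\<Sum>g\<in>Sy d. irrep_char la (cycle_rep d (cycle_type d g)) * irrep_char mu (cycle_rep d (cycle_type d g)))
      = (\<Sum>g\<in>Sy d. irrep_char la g * irrep_char mu (inv g))"
    using d irrep_char_cycle_rep[of _ la] irrep_char_cycle_rep[of _ mu] irrep_char_inv[of _ mu]
    by (intro sum.cong refl) auto
  also have "\<dots> = (if la = mu then fact d else 0)"
    using irrep_char_norm[of la] irrep_char_orthogonal[of la mu] d by auto
  finally show ?thesis by simp
qed

text \<open>With weights 1/z_M the character table is a real matrix with orthonormal rows, and it is
  square because partitions index both rows and columns. \<open>orthogonal_columns\<close> then
  gives the second orthogonality relation, which picks out the value at \<open>M\<close>.\<close>

lemma class_function_expansion: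
  assumes M: "M \<in> mparts d"
  shows "F M = (\<Sum>la\<in>partitions_of d. schur_value la F * irrep_char la (cycle_rep d M))"
proof -
  define X where "X la M = Re (irrep_char la (cycle_rep d M))" for la M
  have X: "irrep_char la (cycle_rep d M) = of_real (X la M)" for la M
    using irrep_char_real[of la] by (simp add: X_def of_real_Re)
  have zpos: "z_mset M > 0" if "M \<in> mparts d" for M using that z_mset_pos by (auto simp: mparts_def)
  have orth: "(1 / real (z_mset M')) * (\<Sum>la\<in>partitions_of d. X la M' * X la M) = (if M' = M then 1 else 0)"
    if M': "M' \<in> mparts d" for M'
  proof (rule orthogonal_columns[where I = "partitions_of d" and J = "mparts d"])
    show "card (partitions_of d) = card (mparts d)" by (rule bij_betw_same_card[OF bij_mset_partitions])
    fix la mu assume "la \<in> partitions_of d" "mu \<in> partitions_of d"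
    then have "complex_of_real (\<Sum>M\<in>mparts d. 1 / real (z_mset M) * X la M * X mu M) = of_real (if la = mu then 1 else 0)"
      using irrep_char_orthonormal[of la d mu] by (simp add: X)
    then show "(\<Sum>M\<in>mparts d. 1 / real (z_mset M) * X la M * X mu M) = (if la = mu then 1 else 0)"
      by (simp only: of_real_eq_iff)
  qed (use M M' zpos in auto)
  have "F M = (\<Sum>M'\<in>mparts d. if M' = M then F M' else 0)" using M by simp
  also have "\<dots> = (\<Sum>M'\<in>mparts d. of_real ((1 / real (z_mset M')) * (\<Sum>la\<in>partitions_of d. X la M' * X la M)) * F M')"
  proof (rule sum.cong[OF refl])
    fix M' assume M': "M' \<in> mparts d"
    show "(if M' = M then F M' else 0)
        = of_real ((1 / real (z_mset M')) * (\<Sum>la\<in>partitions_of d. X la M' * X la M)) * F M'"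
      unfolding orth[OF M'] by simp
  qed
  also have "\<dots> = (\<Sum>M'\<in>mparts d. \<Sum>la\<in>partitions_of d. of_real (X la M') * F M' / of_nat (z_mset M') * of_real (X la M))"
    by (intro sum.cong refl) (simp add: sum_distrib_left sum_distrib_right mult_ac)
  also have "\<dots> = (\<Sum>la\<in>partitions_of d. (\<Sum>M'\<in>mparts d. of_real (X la M') * F M' / of_nat (z_mset M')) * of_real (X la M))"
    by (subst sum.swap) (simp only: sum_distrib_right)
  also have "\<dots> = (\<Sum>la\<in>partitions_of d. schur_value la F * irrep_char la (cycle_rep d M))"
  proof (rule sum.cong[OF refl])
    fix la assume "la \<in> partitions_of d"
    then have "sum_list la = d" by (simp add: partitions_of_def)
    then show "(\<Sum>M'\<in>mparts d. of_real (X la M') * F M' / of_nat (z_mset M')) * of_real (X la M)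
        = schur_value la F * irrep_char la (cycle_rep d M)"
      using sum_mparts_irrep_char[of la F] by (simp add: X)
  qed
  finally show ?thesis .
qed

lemma schur_value_trace_moment_Suc:
  "schur_value la (trace_moment TYPE('n::{finite,linorder}) (Suc n))
    = central_char la (wick_weight TYPE('n) (sum_list la)) * schur_value la (trace_moment TYPE('n) n)"
proof -
  let ?d = "sum_list la"
  have "(\<Sum>g\<in>Sy ?d. young_symmetrizer la g * trace_moment TYPE('n) (Suc n) (cycle_type ?d g))
      = (\<Sum>g\<in>Sy ?d. young_symmetrizer la g * (\<Sum>z\<in>Sy ?d. wick_weight TYPE('n) ?d z * trace_moment TYPE('n) n (cycle_type ?d (g \<circ> z))))"
    by (intro sum.cong refl) (simp only: trace_moment_Suc)
  also have "\<dots> = central_char la (wick_weight TYPE('n) ?d) *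
      (\<Sum>g\<in>Sy ?d. young_symmetrizer la g * trace_moment TYPE('n) n (cycle_type ?d g))"
    by (rule young_pairing_conv[OF class_fun_wick_weight])
  finally show ?thesis by (simp add: schur_value_def)
qed

lemma schur_value_trace_moment:
  "schur_value la (trace_moment TYPE('n::{finite,linorder}) n)
    = central_char la (wick_weight TYPE('n) (sum_list la)) ^ n * schur_value la (trace_moment TYPE('n) 0)"
  by (induction n) (simp_all add: schur_value_trace_moment_Suc)

lemma schur_mat_eq: "schur_mat la A = schur_value la (\<lambda>M. \<Prod>m\<in>#M. trace (mat_pow A m))"
  using sum_partitions_sym_char[of la "\<lambda>M. \<Prod>m\<in>#M. trace (mat_pow A m)"]
  by (simp add: schur_mat_def schur_gen_def flip: prod_mset_prod_list mset_map)

text \<open>For n = 0 the ordered product is the identity, and the integral is that of a constant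
  over the empty product of probability spaces.\<close>

lemma schur_mat_one:
  "schur_mat la (mat 1 :: 'n::{finite,linorder} cmat) = schur_value la (trace_moment TYPE('n) 0)"
proof -
  have "prob_space (Pi\<^sub>M {1..0::nat} (\<lambda>_. gue :: 'n cmat measure))"
    by (rule prob_space_PiM) (rule prob_space_gue)
  from prob_space.prob_space[OF this] have "trace_moment TYPE('n) 0 M = (\<Prod>m\<in>#M. trace (mat_pow (mat 1 :: 'n cmat) m))" for M
    by (simp only: trace_moment_def ordered_prod_0 lebesgue_integral_const scaleR_one)
  then have "trace_moment TYPE('n) 0 = (\<lambda>M. \<Prod>m\<in>#M. trace (mat_pow (mat 1 :: 'n cmat) m))" by (rule ext)
  then show ?thesis by (simp only: schur_mat_eq)
qed

lemma prod_trace_gue: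
  assumes M: "M \<in> mparts d"
  shows "integrable gue (\<lambda>H :: 'n::{finite,linorder} cmat. \<Prod>m\<in>#M. trace (mat_pow H m))"
    and "(\<integral>H. (\<Prod>m\<in>#M. trace (mat_pow (H :: 'n cmat) m)) \<partial>gue) = trace_moment TYPE('n) (Suc 0) M"
proof -
  interpret product_sigma_finite "\<lambda>_::nat. gue :: 'n cmat measure"
    by (rule product_sigma_finite.intro) (rule prob_space_imp_sigma_finite[OF prob_space_gue])
  obtain g where g: "g \<in> Sy d" "cycle_type d g = M" using exists_cycle_type[OF M] by blast
  show int: "integrable gue (\<lambda>H :: 'n cmat. \<Prod>m\<in>#M. trace (mat_pow H m))"
    unfolding g(2)[symmetric] prod_trace_cycle_type[OF g(1)]
    by (rule Bochner_Integration.integrable_sum) (rule gue_moment_integrable, simp)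
  have "{1..Suc 0} = {Suc 0}" by auto
  moreover have "ordered_prod H (Suc 0) = H (Suc 0)" for H :: "nat \<Rightarrow> 'n cmat"
    by (simp add: ordered_prod_Suc)
  ultimately show "(\<integral>H. (\<Prod>m\<in>#M. trace (mat_pow (H :: 'n cmat) m)) \<partial>gue) = trace_moment TYPE('n) (Suc 0) M"
    unfolding trace_moment_def
    using product_integral_singleton[of "\<lambda>H. \<Prod>m\<in>#M. trace (mat_pow (H :: 'n cmat) m)" "Suc 0"] int
    by simp
qed

lemma gue_schur_eq:
  "gue_schur TYPE('n::{finite,linorder}) la = schur_value la (trace_moment TYPE('n) (Suc 0))"
proof -
  let ?d = "sum_list la"
  have ct: "cycle_type ?d y \<in> mparts ?d" if "y \<in> Sy ?d" for y using that by (rule cycle_type_mparts)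
  have "gue_schur TYPE('n) la = (\<integral>H. (\<Sum>y\<in>Sy ?d. young_symmetrizer la y * (\<Prod>m\<in>#cycle_type ?d y. trace (mat_pow (H :: 'n cmat) m))) \<partial>gue) / young_scale la"
    unfolding gue_schur_def schur_mat_eq schur_value_def by simp
  also have "(\<integral>H. (\<Sum>y\<in>Sy ?d. young_symmetrizer la y * (\<Prod>m\<in>#cycle_type ?d y. trace (mat_pow (H :: 'n cmat) m))) \<partial>gue)
      = (\<Sum>y\<in>Sy ?d. \<integral>H. young_symmetrizer la y * (\<Prod>m\<in>#cycle_type ?d y. trace (mat_pow (H :: 'n cmat) m)) \<partial>gue)"
    by (intro Bochner_Integration.integral_sum integrable_mult_right prod_trace_gue(1)[OF ct])
  also have "\<dots> = (\<Sum>y\<in>Sy ?d. young_symmetrizer la y * trace_moment TYPE('n) (Suc 0) (cycle_type ?d y))"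
    by (intro sum.cong refl) (simp add: prod_trace_gue(2)[OF ct])
  finally show ?thesis by (simp only: schur_value_def)
qed

text \<open>For n = 0 the moment counts the maps from boxes to the \<open>N\<close> indices that are
  invariant under the permutation. Each map contributes 0 to the pairing with the symmetrizer, as
  the first column has more boxes than there are indices.\<close>

lemma schur_mat_one_eq_0:
  assumes la: "la \<in> partitions" and len: "CARD('n) < length la"
  shows "schur_mat la (mat 1 :: 'n::{finite,linorder} cmat) = 0"
proof -
  let ?d = "sum_list la"
  let ?I = "\<lambda>f y. if \<forall>k<?d. f (y k) = f k then 1 else 0 :: complex"
  have "(\<Sum>y\<in>Sy ?d. young_symmetrizer la y * trace_moment TYPE('n) 0 (cycle_type ?d y))
      = (\<Sum>y\<in>Sy ?d. \<Sum>f\<in>{..<?d} \<rightarrow>\<^sub>E (UNIV :: 'n set). young_symmetrizer la y * ?I f y)"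
    by (intro sum.cong refl) (simp only: trace_moment_0 sum_distrib_left)
  also have "\<dots> = (\<Sum>f\<in>{..<?d} \<rightarrow>\<^sub>E (UNIV :: 'n set). \<Sum>y\<in>Sy ?d. young_symmetrizer la y * ?I f y)"
    by (rule sum.swap)
  also have "\<dots> = 0"
    by (rule sum.neutral, rule ballI, rule young_sum_invariant_eq_0[OF la subset_UNIV finite len])
  finally show ?thesis by (simp add: schur_mat_one schur_value_def)
qed

lemma coeff_schur_mps_eq:
  assumes la: "la \<in> partitions"
  shows "coeff_mps (schur_mps la (\<lambda>m. of_nat N * mps_var m)) M =
    (if M \<in> mparts (sum_list la) then irrep_char la (cycle_rep (sum_list la) M) / of_nat (z_mset M) * of_nat N ^ size M else 0)"
proof -
  let ?d = "sum_list la"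
  let ?F = "\<lambda>M'. if M = M' then irrep_char la (cycle_rep ?d M) / of_nat (z_mset M) * of_nat N ^ size M else 0"
  have "coeff_mps (schur_mps la (\<lambda>m. of_nat N * mps_var m)) M = (\<Sum>mu\<in>partitions_of ?d. ?F (mset mu))"
    unfolding coeff_schur_mps
  proof (rule sum.cong[OF refl])
    fix mu assume "mu \<in> partitions_of ?d"
    then have "mset mu \<in> mparts ?d" using bij_mset_partitions bij_betwE by blast
    then show "(if M = mset mu then sym_char la mu / of_nat (z_part mu) * of_nat N ^ size M else 0) = ?F (mset mu)"
      by (simp add: sym_char_eq z_part_eq)
  qed
  also have "\<dots> = (\<Sum>M'\<in>mparts ?d. ?F M')" by (rule sum.reindex_bij_betw[OF bij_mset_partitions])
  finally show ?thesis by simp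
qed

theorem proposition2p2:
  fixes n :: nat
  assumes "n \<ge> 1"
  shows
    "mps_integral (Pi\<^sub>M {1..n} (\<lambda>_. gue :: 'n::{finite,linorder} cmat measure))
       (\<lambda>H. mps_exp (of_nat CARD('n) *
          mps_sum (\<lambda>m. mps_const (trace (mat_pow (ordered_prod H n) m) / of_nat m) * mps_var m) {1..}))
     = mps_sum (\<lambda>la. mps_const (schur_mat la (mat 1 :: 'n cmat))
          * schur_mps la (\<lambda>m. of_nat CARD('n) * mps_var m)
          * mps_const ((gue_schur TYPE('n) la / schur_mat la (mat 1 :: 'n cmat)) ^ n))
        {la \<in> partitions. length la \<le> CARD('n)}"
proof (rule mps_eqI)
  fix M :: "nat multiset"
  let ?N = "CARD('n)" and ?d = "sum_mset M"
  let ?S = "\<lambda>la. schur_mat la (mat 1 :: 'n cmat)"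
  let ?I = "{la \<in> partitions. length la \<le> ?N}"
  let ?t = "\<lambda>la. mps_const (?S la) * schur_mps la (\<lambda>m. of_nat ?N * mps_var m) * mps_const ((gue_schur TYPE('n) la / ?S la) ^ n)"
  let ?G = "\<lambda>la. schur_value la (trace_moment TYPE('n) n) * (irrep_char la (cycle_rep ?d M) / of_nat (z_mset M) * of_nat ?N ^ size M)"
  let ?lhs = "mps_integral (Pi\<^sub>M {1..n} (\<lambda>_. gue :: 'n cmat measure))
       (\<lambda>H. mps_exp (of_nat ?N * mps_sum (\<lambda>m. mps_const (trace (mat_pow (ordered_prod H n) m) / of_nat m) * mps_var m) {1..}))"
  have lhs: "coeff_mps ?lhs M = (\<integral>H. exp_weight (\<lambda>m. of_nat ?N * trace (mat_pow (ordered_prod H n :: 'n cmat) m) / of_nat m) M \<partial>Pi\<^sub>M {1..n} (\<lambda>_. gue))"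
    unfolding mps_integral_def mps_sum_linear coeff_Abs_mps coeff_mps_exp_linear ..
  \<comment> \<open>If \<open>?S la\<close> is 0, both sides vanish, the right one being a multiple
    of \<open>?S la\<close>. Otherwise the quotient is the scalar
    \<open>central_char\<close>.\<close>
  have power: "?S la * (gue_schur TYPE('n) la / ?S la) ^ n = schur_value la (trace_moment TYPE('n) n)" for la
  proof (cases "?S la = 0")
    case True
    then show ?thesis by (simp add: schur_value_trace_moment[of la n] flip: schur_mat_one)
  next
    case False
    have "gue_schur TYPE('n) la = central_char la (wick_weight TYPE('n) (sum_list la)) * ?S la"
      by (simp add: gue_schur_eq schur_value_trace_moment[of la "Suc 0"] schur_mat_one)
    then show ?thesis using False by (simp add: schur_value_trace_moment[of la n] schur_mat_one)
  qed
  have t: "coeff_mps (?t la) M = (if M \<in> mparts (sum_list la) then schur_value la (trace_moment TYPE('n) n) *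
       (irrep_char la (cycle_rep (sum_list la) M) / of_nat (z_mset M) * of_nat ?N ^ size M) else 0)"
    if "la \<in> partitions" for la
    unfolding coeff_mult_mps_const coeff_mps_const_mult coeff_schur_mps_eq[OF that] power[symmetric] by simp
  have rhs: "coeff_mps (mps_sum ?t ?I) M = (\<Sum>la | la \<in> ?I \<and> coeff_mps (?t la) M \<noteq> 0. coeff_mps (?t la) M)"
    by (simp only: mps_sum_def coeff_Abs_mps)
  show "coeff_mps ?lhs M = coeff_mps (mps_sum ?t ?I) M"
  \<comment> \<open>Monomials containing p_0 have coefficient 0 on both sides: on the left through
    the quotient by 0, on the right because 0 is never a part.\<close>
  proof (cases "0 \<in># M")
    case True
    then have "coeff_mps ?lhs M = 0" unfolding lhs by (simp add: exp_weight_zero)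
    moreover have "coeff_mps (?t la) M = 0" if "la \<in> ?I" for la
      using that True by (simp only: t mem_Collect_eq) (simp add: mparts_def)
    ultimately show ?thesis unfolding rhs by (simp only:) simp
  next
    case False
    then have M: "M \<in> mparts ?d" by (simp add: mparts_def)
    have "coeff_mps ?lhs M = of_nat ?N ^ size M / of_nat (z_mset M) * trace_moment TYPE('n) n M"
      unfolding lhs exp_weight_eq[OF False] trace_moment_def by (rule integral_mult_right_zero)
    also have "\<dots> = (\<Sum>la\<in>partitions_of ?d. ?G la)"
      unfolding class_function_expansion[OF M, of "trace_moment TYPE('n) n"] sum_distrib_left
      by (intro sum.cong refl) (simp add: mult_ac)
    also have "\<dots> = (\<Sum>la | la \<in> ?I \<and> coeff_mps (?t la) M \<noteq> 0. coeff_mps (?t la) M)"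
    \<comment> \<open>The expansion runs over all partitions of \<open>?d\<close>. A partition
      missing on the right either has zero coefficient, which \<open>mps_sum\<close> leaves out, or
      has more than \<open>?N\<close> parts, and then \<open>?S la\<close> is 0.\<close>
    proof (rule sum.mono_neutral_cong_right)
      show "{la \<in> ?I. coeff_mps (?t la) M \<noteq> 0} \<subseteq> partitions_of ?d"
      proof
        fix la assume "la \<in> {la \<in> ?I. coeff_mps (?t la) M \<noteq> 0}"
        then have la: "la \<in> partitions" "coeff_mps (?t la) M \<noteq> 0" by auto
        then have "M \<in> mparts (sum_list la)" by (metis t)
        then show "la \<in> partitions_of ?d" using la by (simp add: mparts_def partitions_of_def)
      qed
      have eq: "coeff_mps (?t la) M = ?G la"
        if "la \<in> partitions_of ?d" for la
        using that M t[of la] by (simp add: partitions_of_def)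
      show "\<forall>la\<in>partitions_of ?d - {la \<in> ?I. coeff_mps (?t la) M \<noteq> 0}.
          ?G la = 0"
      proof
        fix la assume la: "la \<in> partitions_of ?d - {la \<in> ?I. coeff_mps (?t la) M \<noteq> 0}"
        then have p: "la \<in> partitions" by (simp add: partitions_of_def)
        show "?G la = 0"
        proof (cases "length la \<le> ?N")
          case True
          then have "coeff_mps (?t la) M = 0" using la p by blast
          then show ?thesis using eq[of la] la by simp
        next
          case False
          then have "?S la = 0" by (intro schur_mat_one_eq_0[OF p]) simp
          then have "schur_value la (trace_moment TYPE('n) n) = 0" unfolding power[symmetric] by simp
          then show ?thesis by simp
        qed
      qed
      show "?G la
          = coeff_mps (?t la) M" if "la \<in> {la \<in> ?I. coeff_mps (?t la) M \<noteq> 0}" for la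
        using that \<open>{la \<in> ?I. coeff_mps (?t la) M \<noteq> 0} \<subseteq> partitions_of ?d\<close> eq[of la] by auto
    qed simp
    finally show ?thesis unfolding rhs .
  qed
qed

end
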